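(* Let $\mathcal X$ be a superelliptic curve over $\mathbb C$ of level $n$ (with respect to a central cyclic subgroup $H$ of order $n$ of its automorphism group). If the reduced automorphism group $\mathrm{Aut}(\mathcal X)/H$ is nontrivial and not isomorphic to a cyclic group, then $\mathcal X$ can be written with an affine equation $$y^n = f(x) \quad\text{or}\quad y^n = x\cdot f(x),$$ where $f(x)\in\mathbb C[x]$ is a palindromic or antipalindromic polynomial. If the reduced automorphism group is isomorphic to $A_5$, then $f(x)$ is a quasi-palindromic polynomial.
   Context: A superelliptic curve $\mathcal X$ of level $n$ over $\mathbb C$ is an algebraic curve of genus $g\ge 2$ whose full automorphism group $G=\mathrm{Aut}(\mathcal X)$ contains a cyclic subgroup $H$ of order $n\ge 2$, contained in the center of $G$, such that the quotient curve $\mathcal X/H$ has genus zero. The reduced automorphism group of $\mathcal X$ with respect to $H$ is the quotient group $\bar G=G/H$. To say that $\mathcal X$ can be written with an affine equation $y^n=h(x)$ means that its function field is $\mathbb C(x,y)$ with $y^n=h(x)$, where $\mathbb C(x)$ is the fixed field of $H$. For a polynomial $f(x)=\sum_{i=0}^N a_i x^i\in\mathbb C[x]$ of degree $N$: $f$ is palindromic if $x^N f(1/x)=f(x)$ (that is, $a_i=a_{N-i}$ for all $i$); $f$ is antipalindromic if $x^N f(1/x)=-f(x)$ (that is, $a_i=-a_{N-i}$ for all $i$); $f$ is quasi-palindromic if $|a_i|=|a_{N-i}|$ for all $i=0,\dots,N$. *)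

theory Defs
  imports
    "HOL-Algebra.Elementary_Groups"
    "HOL-Algebra.Sym_Groups"
    "HOL-Computational_Algebra.Polynomial"
    Complex_Main
begin

text \<open>
  A (smooth projective, irreducible) algebraic curve over the complex numbers is represented by its
  function field: a field \<open>'k\<close> with an embedding \<open>c\<close> of the complex numbers, finitely generated and
  of transcendence degree one.  Automorphisms of the curve are the automorphisms of \<open>'k\<close> that fix
  the constants, and the quotient by a finite group of automorphisms is the fixed subfield.
  Subfields are sets of elements of \<open>'k\<close>.
\<close>

definition complex_embedding :: "(complex \<Rightarrow> 'k::field) \<Rightarrow> bool" where
  "complex_embedding c \<longleftrightarrow>
     c 1 = 1 \<and> (\<forall>a b. c (a + b) = c a + c b) \<and> (\<forall>a b. c (a * b) = c a * c b)"

lemma complex_embedding_0: "complex_embedding c \<Longrightarrow> c 0 = 0"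
  unfolding complex_embedding_def by (metis add_cancel_left_left)

definition poly_at :: "(complex \<Rightarrow> 'k::field) \<Rightarrow> complex poly \<Rightarrow> 'k \<Rightarrow> 'k" where
  "poly_at c p x = poly (map_poly c p) x"

definition intermediate_field :: "(complex \<Rightarrow> 'k::field) \<Rightarrow> 'k set \<Rightarrow> bool" where
  "intermediate_field c F \<longleftrightarrow>
     range c \<subseteq> F \<and> (\<forall>y\<in>F. \<forall>z\<in>F. y + z \<in> F \<and> y * z \<in> F) \<and> (\<forall>z\<in>F. - z \<in> F \<and> inverse z \<in> F)"

definition adjoin :: "(complex \<Rightarrow> 'k::field) \<Rightarrow> 'k set \<Rightarrow> 'k set" where
  "adjoin c S = \<Inter>{F. intermediate_field c F \<and> S \<subseteq> F}"

lemma intermediate_field_adjoin: "intermediate_field c (adjoin c S)"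
  unfolding adjoin_def intermediate_field_def by blast

lemma subset_adjoin: "S \<subseteq> adjoin c S"
  unfolding adjoin_def by blast

definition transcendental_over_C :: "(complex \<Rightarrow> 'k::field) \<Rightarrow> 'k \<Rightarrow> bool" where
  "transcendental_over_C c x \<longleftrightarrow> (\<forall>p. poly_at c p x = 0 \<longrightarrow> p = 0)"

definition function_field_of_curve :: "(complex \<Rightarrow> 'k::field) \<Rightarrow> bool" where
  "function_field_of_curve c \<longleftrightarrow> complex_embedding c \<and>
     (\<exists>x. transcendental_over_C c x \<and>
        (\<exists>B. finite B \<and>
           (\<forall>z. \<exists>u. (\<forall>b\<in>B. u b \<in> adjoin c {x}) \<and> z = (\<Sum>b\<in>B. u b * b))))"

text \<open>
  The points of the curve with function field \<open>F\<close> are the normalised discrete valuations of \<open>F\<close> that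
  are trivial on the constants.  Valuations are given the dummy value 0 at 0 and outside
  \<open>F\<close>, so that each point is counted once; every formula below guards against evaluation at 0.
\<close>

definition places :: "(complex \<Rightarrow> 'k::field) \<Rightarrow> 'k set \<Rightarrow> ('k \<Rightarrow> int) set" where
  "places c F = {v.
     (\<forall>z. z \<notin> F - {0} \<longrightarrow> v z = 0) \<and>
     (\<forall>a. v (c a) = 0) \<and>
     (\<forall>y\<in>F - {0}. \<forall>z\<in>F - {0}. v (y * z) = v y + v z) \<and>
     (\<forall>y\<in>F - {0}. \<forall>z\<in>F - {0}. y + z \<noteq> 0 \<longrightarrow> v (y + z) \<ge> min (v y) (v z)) \<and>
     (\<exists>t\<in>F - {0}. v t = 1)}"

definition divisors :: "(complex \<Rightarrow> 'k::field) \<Rightarrow> 'k set \<Rightarrow> (('k \<Rightarrow> int) \<Rightarrow> int) set" where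
  "divisors c F = {D. finite {v. D v \<noteq> 0} \<and> {v. D v \<noteq> 0} \<subseteq> places c F}"

text \<open>All residue fields equal the algebraically closed field of constants, so points have degree 1.\<close>

definition divisor_degree :: "(('k \<Rightarrow> int) \<Rightarrow> int) \<Rightarrow> int" where
  "divisor_degree D = (\<Sum>v\<in>{v. D v \<noteq> 0}. D v)"

definition riemann_roch_space ::
  "(complex \<Rightarrow> 'k::field) \<Rightarrow> 'k set \<Rightarrow> (('k \<Rightarrow> int) \<Rightarrow> int) \<Rightarrow> 'k set" where
  "riemann_roch_space c F D = {z\<in>F. z = 0 \<or> (\<forall>v\<in>places c F. v z + D v \<ge> 0)}"

definition ell :: "(complex \<Rightarrow> 'k::field) \<Rightarrow> 'k set \<Rightarrow> (('k \<Rightarrow> int) \<Rightarrow> int) \<Rightarrow> nat" where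
  "ell c F D = vector_space.dim (\<lambda>a z. c a * z) (riemann_roch_space c F D)"

lemma vector_space_complex_embedding:
  "complex_embedding c \<Longrightarrow> vector_space (\<lambda>a z. c a * z)"
  by unfold_locales (simp_all add: complex_embedding_def algebra_simps)

text \<open>
  The genus is the maximum of \<open>deg D - l(D) + 1\<close> over all divisors \<open>D\<close> (Riemann's theorem).  It is
  a relation, so that no value is assigned unless the maximum exists.
\<close>

definition has_genus :: "(complex \<Rightarrow> 'k::field) \<Rightarrow> 'k set \<Rightarrow> nat \<Rightarrow> bool" where
  "has_genus c F g \<longleftrightarrow>
     (\<exists>D\<in>divisors c F. divisor_degree D - int (ell c F D) + 1 = int g) \<and>
     (\<forall>D\<in>divisors c F. divisor_degree D - int (ell c F D) + 1 \<le> int g)"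

definition aut_group :: "(complex \<Rightarrow> 'k::field) \<Rightarrow> ('k \<Rightarrow> 'k) monoid" where
  "aut_group c = \<lparr>
     carrier = {\<sigma>. bij \<sigma> \<and> (\<forall>y z. \<sigma> (y + z) = \<sigma> y + \<sigma> z) \<and> (\<forall>y z. \<sigma> (y * z) = \<sigma> y * \<sigma> z) \<and>
                   (\<forall>a. \<sigma> (c a) = c a)},
     monoid.mult = (\<circ>),
     monoid.one = id\<rparr>"

lemma group_aut_group: "group (aut_group c)"
proof (rule groupI)
  fix \<sigma> assume "\<sigma> \<in> carrier (aut_group c)"
  then have b: "bij \<sigma>" and add: "\<And>y z. \<sigma> (y + z) = \<sigma> y + \<sigma> z"
    and mult: "\<And>y z. \<sigma> (y * z) = \<sigma> y * \<sigma> z" and const: "\<And>a. \<sigma> (c a) = c a"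
    by (simp_all add: aut_group_def)
  have s: "\<sigma> (Hilbert_Choice.inv \<sigma> z) = z" "Hilbert_Choice.inv \<sigma> (\<sigma> z) = z" for z
    using b by (simp_all add: bij_is_surj surj_f_inv_f bij_is_inj)
  have "Hilbert_Choice.inv \<sigma> \<in> carrier (aut_group c)"
    unfolding aut_group_def
    using b by (simp add: bij_imp_bij_inv) (metis s add mult const)
  moreover have "Hilbert_Choice.inv \<sigma> \<circ> \<sigma> = id"
    using s by auto
  ultimately show "\<exists>\<tau>\<in>carrier (aut_group c). \<tau> \<otimes>\<^bsub>aut_group c\<^esub> \<sigma> = \<one>\<^bsub>aut_group c\<^esub>"
    by (auto simp: aut_group_def)
qed (auto simp: aut_group_def bij_comp)

definition fixed_field :: "('k \<Rightarrow> 'k) set \<Rightarrow> 'k set" where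
  "fixed_field H = {z. \<forall>\<sigma>\<in>H. \<sigma> z = z}"

definition superelliptic_curve ::
  "(complex \<Rightarrow> 'k::field) \<Rightarrow> nat \<Rightarrow> ('k \<Rightarrow> 'k) set \<Rightarrow> bool" where
  "superelliptic_curve c n H \<longleftrightarrow>
     function_field_of_curve c \<and>
     (\<exists>g\<ge>2. has_genus c UNIV g) \<and>
     n \<ge> 2 \<and>
     subgroup H (aut_group c) \<and>
     cyclic_group (aut_group c \<lparr>carrier := H\<rparr>) \<and>
     card H = n \<and>
     (\<forall>h\<in>H. \<forall>\<sigma>\<in>carrier (aut_group c). h \<circ> \<sigma> = \<sigma> \<circ> h) \<and>
     has_genus c (fixed_field H) 0"

definition reduced_aut_group ::
  "(complex \<Rightarrow> 'k::field) \<Rightarrow> ('k \<Rightarrow> 'k) set \<Rightarrow> ('k \<Rightarrow> 'k) set monoid" where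
  "reduced_aut_group c H = aut_group c Mod H"

definition has_affine_equation ::
  "(complex \<Rightarrow> 'k::field) \<Rightarrow> ('k \<Rightarrow> 'k) set \<Rightarrow> nat \<Rightarrow> complex poly \<Rightarrow> bool" where
  "has_affine_equation c H n h \<longleftrightarrow>
     (\<exists>x y. fixed_field H = adjoin c {x} \<and> UNIV = adjoin c {x, y} \<and> y ^ n = poly_at c h x)"

definition palindromic :: "complex poly \<Rightarrow> bool" where
  "palindromic f \<longleftrightarrow> (\<forall>i\<le>degree f. coeff f i = coeff f (degree f - i))"

definition antipalindromic :: "complex poly \<Rightarrow> bool" where
  "antipalindromic f \<longleftrightarrow> (\<forall>i\<le>degree f. coeff f i = - coeff f (degree f - i))"

definition quasi_palindromic :: "complex poly \<Rightarrow> bool" where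
  "quasi_palindromic f \<longleftrightarrow> (\<forall>i\<le>degree f. cmod (coeff f i) = cmod (coeff f (degree f - i)))"

end

theory Submission
  imports
    "HOL-Algebra.Multiplicative_Group"
    Defs
    "HOL-Computational_Algebra.Fundamental_Theorem_Algebra"
begin

text \<open>
  The quotient by \<open>H\<close> is a projective line with function field \<open>F = \<complex>(x)\<close>, and by Kummer theory the
  curve is \<open>y\<^sup>n = f(x)\<close> for some \<open>y\<close> on which a generator \<open>h\<close> of \<open>H\<close> acts as multiplication by a
  primitive root of unity.  Since \<open>H\<close> is central, every automorphism \<open>\<sigma>\<close> maps \<open>y\<close> to \<open>s y\<close> with
  \<open>s \<in> F\<close>.  So the automorphisms act on the line by Moebius transformations that preserve, modulo
  \<open>n\<close>, the multiplicities of the zeros and poles of \<open>f\<close>.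

  An involution \<open>\<tau>\<close> among these transformations suffices.  Choose the coordinate \<open>x\<close> so that its pole
  is not a branch point and not fixed by \<open>\<tau>\<close>, that its zero is the image of the pole under \<open>\<tau>\<close>, and
  that \<open>\<tau>\<close> is \<open>x \<mapsto> 1/x\<close>.  Reduce the exponents in \<open>f\<close> below \<open>n\<close>.  Then \<open>f\<close> and its reversal
  differ by an \<open>n\<close>-th power in \<open>F\<close> with neither zeros nor poles, so by a constant, and the square of
  this constant is \<open>1\<close>: the polynomial \<open>f\<close> is palindromic or antipalindromic
  (\<open>involution_imp_palindromic\<close>).  Both kinds of polynomials are quasi-palindromic, which settles the
  assertion about \<open>A\<^sub>5\<close>.

  To find an involution, consider the action of the automorphism group on the line.  It permutes the
  branch points, of which there are at least three (\<open>card_branch\<close>): with two branch points the curve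
  would itself be a line, with \<open>h\<close> acting by \<open>w \<mapsto> a w\<close>, and \<open>h\<close> would not commute with
  \<open>w \<mapsto> w + 1\<close>.  A Moebius transformation that fixes three points is the identity, so the group is
  finite.  Count the elements that have a fixed point in a given orbit
  (\<open>fixed_point_or_swap\<close>): either some element exchanges two points, and then it is \<open>x \<mapsto> a/x\<close> in
  a suitable coordinate, hence an involution; or all elements fix a common point, hence they are
  affine, and the reduced group embeds into the multiplicative group of \<open>\<complex>\<close> and is cyclic
  (\<open>fixed_place_imp_cyclic\<close>).

  All facts on function fields are derived from the definitions.  Two facts carry them.  Any two
  elements of the function field are algebraically dependent (\<open>algebraically_dependent\<close>), which makes
  residue fields equal to \<open>\<complex>\<close> and elements of \<open>F\<close> integral over \<open>\<complex>[x]\<close> up to a denominator.  And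
  genus \<open>0\<close> means \<open>\<ell>(D) \<ge> deg D + 1\<close> for every divisor, which shows that a function without
  poles is constant (\<open>no_poles_imp_constant\<close>) and yields for each place a coordinate with its only,
  simple, pole there (\<open>coordinate_exists\<close>); such a coordinate identifies the places of \<open>F\<close> with the
  points of the projective line.
\<close>


section \<open>Fields over the complex numbers\<close>

locale field_over_C =
  fixes c :: "complex \<Rightarrow> 'k::field"
  assumes emb: "complex_embedding c"
begin

lemma c_one [simp]: "c 1 = 1"
  and c_add: "c (a + b) = c a + c b"
  and c_mult: "c (a * b) = c a * c b"
  using emb by (auto simp: complex_embedding_def)

lemma c_zero [simp]: "c 0 = 0"
  using emb by (rule complex_embedding_0)

lemma c_minus: "c (- a) = - c a"
  using c_add[of a "- a"] by (simp add: eq_neg_iff_add_eq_0 add.commute)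

lemma c_diff: "c (a - b) = c a - c b"
  using c_add[of a "- b"] by (simp add: c_minus)

lemma c_eq_0_iff [simp]: "c a = 0 \<longleftrightarrow> a = 0"
proof
  assume "c a = 0"
  then have "c (a * inverse a) = 0" by (simp add: c_mult)
  then show "a = 0" by (metis c_one right_inverse zero_neq_one)
qed simp

lemma c_eq_iff [simp]: "c a = c b \<longleftrightarrow> a = b"
  using c_eq_0_iff[of "a - b"] by (simp add: c_diff del: c_eq_0_iff)

lemma c_inverse: "c (inverse a) = inverse (c a)"
proof (cases "a = 0")
  case False
  then have "c a * c (inverse a) = 1" by (simp flip: c_mult)
  then show ?thesis by (simp add: inverse_unique)
qed simp

lemma c_power: "c (a ^ m) = c a ^ m"
  by (induction m) (simp_all add: c_mult)

lemma c_of_nat: "c (of_nat m) = of_nat m"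
  by (induction m) (simp_all add: c_add)

lemma of_nat_ne_0 [simp]: "m > 0 \<Longrightarrow> (of_nat m :: 'k) \<noteq> 0"
  by (metis c_eq_0_iff c_of_nat of_nat_eq_0_iff not_gr_zero)

lemma poly_at_0 [simp]: "poly_at c 0 x = 0"
  by (simp add: poly_at_def)

lemma poly_at_pCons [simp]: "poly_at c (pCons a p) x = c a + x * poly_at c p x"
  by (simp add: poly_at_def map_poly_pCons)

lemma poly_at_1 [simp]: "poly_at c 1 x = 1"
  by (simp add: one_pCons)

lemma poly_at_add: "poly_at c (p + q) x = poly_at c p x + poly_at c q x"
proof (induction p arbitrary: q)
  case (pCons a p)
  then show ?case by (cases q) (simp add: c_add algebra_simps)
qed simp

lemma poly_at_smult: "poly_at c (smult a p) x = c a * poly_at c p x"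
  by (induction p) (simp_all add: c_mult algebra_simps)

lemma poly_at_minus: "poly_at c (- p) x = - poly_at c p x"
  using poly_at_smult[of "- 1" p x] by (simp add: c_minus)

lemma poly_at_diff: "poly_at c (p - q) x = poly_at c p x - poly_at c q x"
  using poly_at_add[of p "- q" x] by (simp add: poly_at_minus)

lemma poly_at_mult: "poly_at c (p * q) x = poly_at c p x * poly_at c q x"
  by (induction p) (simp_all add: poly_at_add poly_at_smult algebra_simps)

lemma poly_at_power: "poly_at c (p ^ m) x = poly_at c p x ^ m"
  by (induction m) (simp_all add: poly_at_mult)

lemma poly_at_monom: "poly_at c (monom a m) x = c a * x ^ m"
  by (induction m) (simp_all add: monom_0 monom_Suc mult_ac)

lemma poly_at_sum: "poly_at c (\<Sum>i\<in>I. p i) x = (\<Sum>i\<in>I. poly_at c (p i) x)"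
  by (induction I rule: infinite_finite_induct) (simp_all add: poly_at_add)

text \<open>The complex numbers are algebraically closed, so they are algebraically closed in every
  extension field: split off the roots of the annihilating polynomial one at a time.\<close>

lemma algebraic_imp_constant:
  assumes "poly_at c p z = 0" "p \<noteq> 0"
  shows "z \<in> range c"
  using assms
proof (induction "degree p" arbitrary: p rule: less_induct)
  case less
  show ?case
  proof (cases "degree p = 0")
    case True
    then obtain a where "p = [:a:]" by (metis degree_eq_zeroE)
    with less.prems show ?thesis by simp
  next
    case False
    then have "\<not> constant (poly p)" by (simp add: constant_degree)
    then obtain a where "poly p a = 0" using fundamental_theorem_of_algebra by blast
    then obtain q where q: "p = [:- a, 1:] * q" by (metis dvd_def poly_eq_0_iff_dvd)
    have q0: "q \<noteq> 0" using less.prems q by auto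
    have deg: "degree q < degree p" unfolding q using degree_mult_eq[of "[:- a, 1:]" q] q0 by (simp del: mult_pCons_left)
    have "(z - c a) * poly_at c q z = 0"
      using less.prems(1) unfolding q by (simp only: poly_at_mult) (simp add: c_minus)
    then consider "z = c a" | "poly_at c q z = 0" by auto
    then show ?thesis using less.hyps[OF deg _ q0] by cases auto
  qed
qed

lemma power_constant_imp_constant:
  assumes "z ^ m \<in> range c" "m > 0"
  shows "z \<in> range c"
proof -
  obtain a where a: "z ^ m = c a" using assms by auto
  have "coeff (monom (1::complex) m - [:a:]) m = 1"
    using assms(2) by (simp add: coeff_pCons split: nat.split)
  then have "monom 1 m - [:a:] \<noteq> 0" by (metis coeff_0 zero_neq_one)
  moreover have "poly_at c (monom 1 m - [:a:]) z = 0"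
    by (simp add: poly_at_diff poly_at_monom a)
  ultimately show ?thesis by (rule algebraic_imp_constant[rotated])
qed

lemma transcendental_iff: "transcendental_over_C c x \<longleftrightarrow> x \<notin> range c"
proof
  assume t: "transcendental_over_C c x"
  show "x \<notin> range c"
  proof
    assume "x \<in> range c"
    then obtain a where "x = c a" by auto
    then have "poly_at c [:- a, 1:] x = 0" by (simp add: c_minus)
    with t have "[:- a, 1:] = 0" unfolding transcendental_over_C_def by blast
    then show False by simp
  qed
qed (use algebraic_imp_constant in \<open>auto simp: transcendental_over_C_def\<close>)

lemma poly_at_eq_0_iff: "x \<notin> range c \<Longrightarrow> poly_at c p x = 0 \<longleftrightarrow> p = 0"
  using algebraic_imp_constant by fastforce

lemma poly_at_eq_iff: "x \<notin> range c \<Longrightarrow> poly_at c p x = poly_at c q x \<longleftrightarrow> p = q"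
  using poly_at_eq_0_iff[of x "p - q"] by (simp add: poly_at_diff)

text \<open>The quotients of polynomials in \<open>x\<close> form an intermediate field containing \<open>x\<close>.\<close>

lemma adjoin_single:
  assumes "z \<in> adjoin c {x}"
  shows "\<exists>p q. poly_at c q x \<noteq> 0 \<and> z = poly_at c p x / poly_at c q x"
proof -
  let ?R = "{z. \<exists>p q. poly_at c q x \<noteq> 0 \<and> z = poly_at c p x / poly_at c q x}"
  have "intermediate_field c ?R"
    unfolding intermediate_field_def
  proof (intro conjI ballI subsetI)
    fix z assume "z \<in> range c"
    then obtain a where "z = c a" by auto
    then have "poly_at c 1 x \<noteq> 0 \<and> z = poly_at c [:a:] x / poly_at c 1 x" by simp
    then show "z \<in> ?R" by blast
  next
    fix y z assume "y \<in> ?R" "z \<in> ?R"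
    then obtain p q p' q' where *: "poly_at c q x \<noteq> 0" "y = poly_at c p x / poly_at c q x"
      "poly_at c q' x \<noteq> 0" "z = poly_at c p' x / poly_at c q' x" by blast
    then have "poly_at c (q * q') x \<noteq> 0 \<and> y + z = poly_at c (p * q' + p' * q) x / poly_at c (q * q') x"
      by (simp add: poly_at_mult poly_at_add add_frac_eq)
    then show "y + z \<in> ?R" by blast
    have "poly_at c (q * q') x \<noteq> 0 \<and> y * z = poly_at c (p * p') x / poly_at c (q * q') x"
      using * by (simp add: poly_at_mult)
    then show "y * z \<in> ?R" by blast
  next
    fix z assume "z \<in> ?R"
    then obtain p q where *: "poly_at c q x \<noteq> 0" "z = poly_at c p x / poly_at c q x" by blast
    then have "poly_at c q x \<noteq> 0 \<and> - z = poly_at c (- p) x / poly_at c q x"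
      by (simp add: poly_at_minus)
    then show "- z \<in> ?R" by blast
    show "inverse z \<in> ?R"
    proof (cases "poly_at c p x = 0")
      case True
      with * have "poly_at c 1 x \<noteq> 0 \<and> inverse z = poly_at c 0 x / poly_at c 1 x" by simp
      then show ?thesis by blast
    next
      case False
      with * have "poly_at c p x \<noteq> 0 \<and> inverse z = poly_at c q x / poly_at c p x" by simp
      then show ?thesis by blast
    qed
  qed
  moreover have "x \<in> ?R"
  proof -
    have "poly_at c 1 x \<noteq> 0 \<and> x = poly_at c [:0, 1:] x / poly_at c 1 x" by simp
    then show ?thesis by blast
  qed
  ultimately have "adjoin c {x} \<subseteq> ?R" unfolding adjoin_def by blast
  with assms show ?thesis by blast
qed

lemma adjoin_minimal: "intermediate_field c M \<Longrightarrow> S \<subseteq> M \<Longrightarrow> adjoin c S \<subseteq> M"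
  unfolding adjoin_def by blast

sublocale VC: vector_space "\<lambda>a z. c a * z"
  by (rule vector_space_complex_embedding[OF emb])

text \<open>A version of the dimension bound for indexed families, in which repetitions count as
  dependencies.\<close>

lemma family_dependent:
  fixes f :: "'i \<Rightarrow> 'k"
  assumes "finite I" "finite B" "f ` I \<subseteq> VC.span B" "card B < card I"
  shows "\<exists>a. (\<exists>i\<in>I. a i \<noteq> 0) \<and> (\<Sum>i\<in>I. c (a i) * f i) = 0"
proof (cases "inj_on f I")
  case True
  then have "\<not> card (f ` I) \<le> card B" using assms(4) by (simp add: card_image)
  then have "VC.dependent (f ` I)"
    using VC.independent_span_bound[OF assms(2) _ assms(3)] by blast
  then obtain u where u: "\<exists>v\<in>f ` I. u v \<noteq> 0" "(\<Sum>v\<in>f ` I. c (u v) * v) = 0"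
    using VC.dependent_finite[of "f ` I"] assms(1) by auto
  have "(\<Sum>i\<in>I. c (u (f i)) * f i) = 0"
    using u(2) by (simp add: sum.reindex[OF True])
  with u(1) show ?thesis by (intro exI[of _ "u \<circ> f"]) auto
next
  case False
  then obtain i j where ij: "i \<in> I" "j \<in> I" "i \<noteq> j" "f i = f j" by (auto simp: inj_on_def)
  define a where "a k = (if k = i then 1 else if k = j then - 1 else (0::complex))" for k
  have "(\<Sum>k\<in>I. c (a k) * f k) = (\<Sum>k\<in>{i, j}. c (a k) * f k)"
    using ij assms(1) by (intro sum.mono_neutral_right) (auto simp: a_def)
  also have "\<dots> = 0" using ij by (simp add: a_def c_minus)
  finally show ?thesis using ij(1) by (intro exI[of _ a]) (auto simp: a_def)
qed

end

locale subfield_over_C = field_over_C c for c :: "complex \<Rightarrow> 'k::field" +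
  fixes F :: "'k set"
  assumes F_field: "intermediate_field c F"
begin

lemma F_add [intro, simp]: "y \<in> F \<Longrightarrow> z \<in> F \<Longrightarrow> y + z \<in> F"
  and F_mult [intro, simp]: "y \<in> F \<Longrightarrow> z \<in> F \<Longrightarrow> y * z \<in> F"
  and F_minus [intro, simp]: "z \<in> F \<Longrightarrow> - z \<in> F"
  and F_inverse [intro, simp]: "z \<in> F \<Longrightarrow> inverse z \<in> F"
  and F_const [intro, simp]: "c a \<in> F"
  using F_field by (auto simp: intermediate_field_def)

lemma F_0 [simp]: "0 \<in> F" using F_const[of 0] by simp
lemma F_1 [simp]: "1 \<in> F" using F_const[of 1] by simp

lemma F_diff [intro, simp]: "y \<in> F \<Longrightarrow> z \<in> F \<Longrightarrow> y - z \<in> F"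
  using F_add[of y "- z"] by auto

lemma F_divide [intro, simp]: "y \<in> F \<Longrightarrow> z \<in> F \<Longrightarrow> y / z \<in> F"
  using F_mult[of y "inverse z"] by (auto simp: divide_inverse)

lemma F_power [intro, simp]: "z \<in> F \<Longrightarrow> z ^ m \<in> F"
  by (induction m) auto

lemma F_poly_at [intro, simp]: "z \<in> F \<Longrightarrow> poly_at c p z \<in> F"
  by (induction p) auto

lemma F_sum [intro, simp]: "(\<And>i. i \<in> I \<Longrightarrow> f i \<in> F) \<Longrightarrow> (\<Sum>i\<in>I. f i) \<in> F"
  by (induction I rule: infinite_finite_induct) auto

end

section \<open>Algebraic dependence in a function field of one variable\<close>

context field_over_C
begin

lemma poly_at_altdef: "poly_at c p x = (\<Sum>i\<le>degree p. c (coeff p i) * x ^ i)"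
proof -
  have "poly_at c (\<Sum>i\<le>degree p. monom (coeff p i) i) x = (\<Sum>i\<le>degree p. c (coeff p i) * x ^ i)"
    by (simp add: poly_at_sum poly_at_monom)
  then show ?thesis by (simp add: poly_as_sum_of_monoms)
qed

text \<open>Over \<open>\<complex>(x)\<close> the field is spanned by the finite set \<open>B\<close>; these are the finite-dimensional
  pieces, over \<open>\<complex>\<close>, of the \<open>\<complex>[x]\<close>-module generated by \<open>B\<close>.\<close>

definition monomial_span :: "'k \<Rightarrow> 'k set \<Rightarrow> nat \<Rightarrow> 'k set" where
  "monomial_span x B m = VC.span ((\<lambda>(i, b). x ^ i * b) ` ({..m} \<times> B))"

lemma monomial_span_mono: "m \<le> m' \<Longrightarrow> u \<in> monomial_span x B m \<Longrightarrow> u \<in> monomial_span x B m'"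
  unfolding monomial_span_def by (rule subsetD[OF VC.span_mono]) auto

lemma monomial_span_induct [consumes 1, case_names base add scale]:
  assumes "u \<in> monomial_span x B m"
    and "\<And>i b. i \<le> m \<Longrightarrow> b \<in> B \<Longrightarrow> P (x ^ i * b)"
    and "\<And>u v. P u \<Longrightarrow> P v \<Longrightarrow> P (u + v)"
    and "\<And>a u. P u \<Longrightarrow> P (c a * u)"
    and "P 0"
  shows "P u"
proof -
  have "VC.subspace {u. P u}"
    using assms(3-5) by (auto simp: VC.subspace_def)
  with assms(1) show ?thesis unfolding monomial_span_def
    by (rule VC.span_induct) (use assms(2) in auto)
qed

lemma monomial_span_shift: "u \<in> monomial_span x B m \<Longrightarrow> x ^ k * u \<in> monomial_span x B (m + k)"
proof (induction rule: monomial_span_induct)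
  case (base i b)
  then show ?case unfolding monomial_span_def
    by (intro VC.span_base) (auto intro!: image_eqI[of _ _ "(k + i, b)"] simp: power_add mult.assoc)
next
  case (add u v)
  then show ?case by (simp add: distrib_left monomial_span_def VC.span_add)
next
  case (scale a u)
  then show ?case unfolding mult.left_commute[of _ "c a"] monomial_span_def by (rule VC.span_scale)
qed (simp add: monomial_span_def VC.span_zero)

lemma monomial_span_poly:
  assumes "u \<in> monomial_span x B m"
  shows "poly_at c p x * u \<in> monomial_span x B (m + degree p)"
proof -
  have "c (coeff p i) * (x ^ i * u) \<in> monomial_span x B (m + degree p)" if "i \<le> degree p" for i
  proof -
    have "x ^ i * u \<in> monomial_span x B (m + degree p)"
      by (rule monomial_span_mono[OF _ monomial_span_shift[OF assms]]) (use that in auto)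
    then show ?thesis unfolding monomial_span_def by (rule VC.span_scale)
  qed
  then show ?thesis
    unfolding poly_at_altdef sum_distrib_right mult.assoc
    unfolding monomial_span_def by (intro VC.span_sum) auto
qed

lemma monomial_span_mult:
  assumes "u \<in> monomial_span x B m" "\<And>b. b \<in> B \<Longrightarrow> w * b \<in> monomial_span x B D"
  shows "w * u \<in> monomial_span x B (m + D)"
  using assms(1)
proof (induction rule: monomial_span_induct)
  case (base i b)
  have "x ^ i * (w * b) \<in> monomial_span x B (m + D)"
    by (rule monomial_span_mono[OF _ monomial_span_shift[OF assms(2)[OF base(2)]]])
      (use base in auto)
  then show ?case by (simp add: mult_ac)
next
  case (add u v)
  then show ?case by (simp add: distrib_left monomial_span_def VC.span_add)
next
  case (scale a u)
  then show ?case unfolding mult.left_commute[of _ "c a"] monomial_span_def by (rule VC.span_scale)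
qed (simp add: monomial_span_def VC.span_zero)

text \<open>Finitely many elements can be moved into the \<open>\<complex>[x]\<close>-module generated by \<open>B\<close> by one
  polynomial multiplier, the product of the denominators of all their coefficients.\<close>

lemma common_denominator:
  assumes x: "x \<notin> range c" and B: "finite B"
    and gen: "\<And>z. \<exists>u. (\<forall>b\<in>B. u b \<in> adjoin c {x}) \<and> z = (\<Sum>b\<in>B. u b * b)"
    and W: "finite W"
  shows "\<exists>q D. q \<noteq> 0 \<and> (\<forall>w\<in>W. poly_at c q x * w \<in> monomial_span x B D)"
  using W
proof induction
  case empty
  show ?case by (intro exI[of _ 1]) auto
next
  case (insert w W)
  then obtain q1 D1 where 1: "q1 \<noteq> 0" "\<And>w. w \<in> W \<Longrightarrow> poly_at c q1 x * w \<in> monomial_span x B D1"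
    by blast
  obtain u where u: "\<And>b. b \<in> B \<Longrightarrow> u b \<in> adjoin c {x}" "w = (\<Sum>b\<in>B. u b * b)"
    using gen[of w] by blast
  have "\<exists>p q. q \<noteq> 0 \<and> (b \<in> B \<longrightarrow> u b = poly_at c p x / poly_at c q x)" for b
  proof (cases "b \<in> B")
    case True
    obtain p q where "poly_at c q x \<noteq> 0" "u b = poly_at c p x / poly_at c q x"
      using adjoin_single[OF u(1)[OF True]] by blast
    moreover from this have "q \<noteq> 0" by auto
    ultimately show ?thesis by blast
  next
    case False
    then show ?thesis by (intro exI[of _ 1]) simp
  qed
  then obtain p q where pq: "\<And>b. q b \<noteq> 0"
    "\<And>b. b \<in> B \<Longrightarrow> u b = poly_at c (p b) x / poly_at c (q b) x"
    by metis
  define q2 where "q2 = (\<Prod>b\<in>B. q b)"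
  define r where "r b = p b * (\<Prod>b\<in>B - {b}. q b)" for b
  have q2: "q2 \<noteq> 0" using pq(1) B by (simp add: q2_def)
  have r: "poly_at c q2 x * u b = poly_at c (r b) x" if "b \<in> B" for b
  proof -
    have "poly_at c (q b) x \<noteq> 0" using pq(1) poly_at_eq_0_iff[OF x] by blast
    then show ?thesis
      using B that by (simp add: q2_def r_def prod.remove[of B b] poly_at_mult pq(2))
  qed
  define D2 where "D2 = (\<Sum>b\<in>B. degree (r b))"
  have "poly_at c (r b) x * b \<in> monomial_span x B D2" if "b \<in> B" for b
  proof (rule monomial_span_mono)
    have "b \<in> monomial_span x B 0" unfolding monomial_span_def
      using that by (intro VC.span_base) (auto intro!: image_eqI[of _ _ "(0, b)"])
    then show "poly_at c (r b) x * b \<in> monomial_span x B (0 + degree (r b))"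
      by (rule monomial_span_poly)
    show "0 + degree (r b) \<le> D2"
      using member_le_sum[of b B "\<lambda>b. degree (r b)"] that B by (simp add: D2_def)
  qed
  then have "(\<Sum>b\<in>B. poly_at c (r b) x * b) \<in> monomial_span x B D2"
    unfolding monomial_span_def by (intro VC.span_sum) auto
  also have "(\<Sum>b\<in>B. poly_at c (r b) x * b) = poly_at c q2 x * w"
    unfolding u(2) sum_distrib_left using r by (intro sum.cong) (simp_all flip: mult.assoc)
  finally have 2: "poly_at c q2 x * w \<in> monomial_span x B D2" .
  have "poly_at c (q1 * q2) x * w' \<in> monomial_span x B (D1 + degree q2 + (D2 + degree q1))"
    if "w' \<in> insert w W" for w'
  proof (cases "w' = w")
    case True
    have "poly_at c q1 x * (poly_at c q2 x * w) \<in> monomial_span x B (D1 + degree q2 + (D2 + degree q1))"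
      by (rule monomial_span_mono[OF _ monomial_span_poly[OF 2]]) simp
    with True show ?thesis by (simp add: poly_at_mult mult_ac)
  next
    case False
    then have "w' \<in> W" using that by simp
    have "poly_at c q2 x * (poly_at c q1 x * w') \<in> monomial_span x B (D1 + degree q2 + (D2 + degree q1))"
      by (rule monomial_span_mono[OF _ monomial_span_poly[OF 1(2)[OF \<open>w' \<in> W\<close>]]]) simp
    then show ?thesis by (simp add: poly_at_mult mult_ac)
  qed
  moreover have "q1 * q2 \<noteq> 0" using 1(1) q2 by simp
  ultimately show ?case by blast
qed

text \<open>A function field has transcendence degree one.  The proof counts dimensions: after clearing
  denominators, the monomials \<open>s\<^sup>i z\<^sup>j\<close> with \<open>i, j \<le> L\<close>, which are quadratically many in \<open>L\<close>, lie in a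
  space of dimension linear in \<open>L\<close>.\<close>

lemma algebraically_dependent:
  assumes "function_field_of_curve c"
  shows "\<exists>N q. q N \<noteq> 0 \<and> (\<Sum>j\<le>(N::nat). poly_at c (q j) s * z ^ j) = 0"
proof -
  obtain x B where x: "x \<notin> range c" and B: "finite B"
    and gen: "\<And>z. \<exists>u. (\<forall>b\<in>B. u b \<in> adjoin c {x}) \<and> z = (\<Sum>b\<in>B. u b * b)"
    using assms transcendental_iff unfolding function_field_of_curve_def by metis
  let ?V = "monomial_span x B"
  obtain q D where q: "q \<noteq> 0"
    and D: "\<And>w. w \<in> insert 1 (B \<union> (*) s ` B \<union> (*) z ` B) \<Longrightarrow> poly_at c q x * w \<in> ?V D"
    using common_denominator[OF x B gen, of "insert 1 (B \<union> (*) s ` B \<union> (*) z ` B)"] B by blast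
  define e where "e = poly_at c q x"
  have e: "e \<noteq> 0" using q poly_at_eq_0_iff[OF x] by (simp add: e_def)
  have V1: "e \<in> ?V D" using D[of 1] by (simp add: e_def)
  have Vs: "e * s * u \<in> ?V (m + D)" and Vz: "e * z * u \<in> ?V (m + D)" and V0: "e * u \<in> ?V (m + D)"
    if "u \<in> ?V m" for u m
    by (rule monomial_span_mult[OF that]; use D in \<open>auto simp: e_def mult.assoc\<close>)+
  have Vs': "(e * s) ^ i * u \<in> ?V (m + i * D)" if "u \<in> ?V m" for u m i
  proof (induction i)
    case (Suc i)
    from Vs[OF Suc] show ?case by (simp add: mult_ac add_ac)
  qed (use that in simp)
  have Vz': "(e * z) ^ i * u \<in> ?V (m + i * D)" if "u \<in> ?V m" for u m i
  proof (induction i)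
    case (Suc i)
    from Vz[OF Suc] show ?case by (simp add: mult_ac add_ac)
  qed (use that in simp)
  have V0': "e ^ i * u \<in> ?V (m + i * D)" if "u \<in> ?V m" for u m i
  proof (induction i)
    case (Suc i)
    from V0[OF Suc] show ?case by (simp add: mult_ac add_ac)
  qed (use that in simp)
  define k where "k = card B"
  \<comment> \<open>Chosen so that \<open>(L + 1)\<^sup>2\<close> exceeds the dimension bound \<open>((2 L + 1) D + 1) k\<close>.\<close>
  define L where "L = (2 * D + 1) * k"
  \<comment> \<open>Each factor \<open>s\<close>, \<open>z\<close> costs one factor \<open>e\<close> and raises the degree bound by \<open>D\<close>; the total
    is the same for all \<open>i, j \<le> L\<close> after padding with \<open>e\<close>.\<close>
  define f where "f = (\<lambda>(i, j). e ^ (2 * L + 1) * (s ^ i * z ^ j))"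
  define I where "I = {..L} \<times> {..L}"
  define M where "M = (2 * L + 1) * D"
  have "f ij \<in> ?V M" if ijI: "ij \<in> I" for ij
  proof -
    obtain i j where ij: "ij = (i, j)" "i \<le> L" "j \<le> L"
      using ijI by (cases ij) (auto simp: I_def)
    then have "e ^ (2 * L + 1) = e ^ (i + j + (2 * L - i - j) + 1)" by simp
    also have "\<dots> = e ^ i * e ^ j * e ^ (2 * L - i - j) * e" by (simp only: power_add power_one_right)
    finally have e_power: "e ^ (2 * L + 1) = e ^ i * e ^ j * e ^ (2 * L - i - j) * e" .
    have "f ij = (e * s) ^ i * ((e * z) ^ j * (e ^ (2 * L - i - j) * e))"
      unfolding f_def ij prod.case e_power power_mult_distrib by (simp only: mult_ac)
    also have "\<dots> \<in> ?V (D + (2 * L - i - j) * D + j * D + i * D)"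
      by (intro Vs' Vz' V0' V1)
    also have "D + (2 * L - i - j) * D + j * D + i * D = (1 + (2 * L - i - j) + j + i) * D"
      by (simp add: algebra_simps)
    also have "1 + (2 * L - i - j) + j + i = 2 * L + 1" using ij by simp
    finally show ?thesis by (simp add: M_def)
  qed
  then have "f ` I \<subseteq> VC.span ((\<lambda>(i, b). x ^ i * b) ` ({..M} \<times> B))"
    by (auto simp: monomial_span_def)
  moreover have "card ((\<lambda>(i, b). x ^ i * b) ` ({..M} \<times> B)) < card I"
  proof -
    have "card ((\<lambda>(i, b). x ^ i * b) ` ({..M} \<times> B)) \<le> (M + 1) * k"
      using card_image_le[of "{..M} \<times> B"] B by (simp add: card_cartesian_product k_def)
    also have "\<dots> \<le> ((2 * D + 1) * (L + 1)) * k"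
      by (intro mult_right_mono) (simp_all add: M_def algebra_simps)
    also have "\<dots> = L * (L + 1)" by (simp add: L_def algebra_simps)
    also have "\<dots> < (L + 1) * (L + 1)" by simp
    finally show ?thesis by (simp add: I_def card_cartesian_product)
  qed
  ultimately obtain a where a: "\<exists>ij\<in>I. a ij \<noteq> 0" "(\<Sum>ij\<in>I. c (a ij) * f ij) = 0"
    using family_dependent[of I "(\<lambda>(i, b). x ^ i * b) ` ({..M} \<times> B)" f] B by (auto simp: I_def)
  define r where "r j = (\<Sum>i\<le>L. monom (a (i, j)) i)" for j
  have "e ^ (2 * L + 1) * (\<Sum>j\<le>L. poly_at c (r j) s * z ^ j) = 0"
  proof -
    have "(\<Sum>ij\<in>I. c (a ij) * f ij) = (\<Sum>i\<le>L. \<Sum>j\<le>L. c (a (i, j)) * f (i, j))"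
      unfolding I_def by (simp add: sum.cartesian_product)
    also have "\<dots> = (\<Sum>j\<le>L. \<Sum>i\<le>L. c (a (i, j)) * f (i, j))" by (rule sum.swap)
    also have "\<dots> = e ^ (2 * L + 1) * (\<Sum>j\<le>L. poly_at c (r j) s * z ^ j)"
      unfolding sum_distrib_left
      by (simp add: r_def f_def poly_at_sum poly_at_monom sum_distrib_left sum_distrib_right mult_ac)
    finally show ?thesis using a(2) by simp
  qed
  then have sum0: "(\<Sum>j\<le>L. poly_at c (r j) s * z ^ j) = 0" using e by simp
  obtain i j where ij: "i \<le> L" "j \<le> L" "a (i, j) \<noteq> 0" using a(1) by (auto simp: I_def)
  then have "coeff (r j) i \<noteq> 0" by (simp add: r_def coeff_sum)
  then have "r j \<noteq> 0" by auto
  \<comment> \<open>Cut off the vanishing top coefficients.\<close>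
  define N where "N = (GREATEST j. j \<le> L \<and> r j \<noteq> 0)"
  have N: "N \<le> L \<and> r N \<noteq> 0"
    unfolding N_def by (rule GreatestI_nat[of _ j L]) (use ij \<open>r j \<noteq> 0\<close> in auto)
  have "r j = 0" if "j \<le> L" "j > N" for j
    using that Greatest_le_nat[of "\<lambda>j. j \<le> L \<and> r j \<noteq> 0" j L] by (auto simp: N_def)
  then have "(\<Sum>j\<le>N. poly_at c (r j) s * z ^ j) = (\<Sum>j\<le>L. poly_at c (r j) s * z ^ j)"
    using N by (intro sum.mono_neutral_left) auto
  with sum0 N show ?thesis by (intro exI[of _ N] exI[of _ r]) simp
qed

end

section \<open>Valuations\<close>

text \<open>The valuation of \<open>0\<close> is infinite, but a place has a dummy value there; this predicate says
  \<open>v z \<ge> k\<close> with the correct reading at \<open>0\<close>.\<close>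

definition ord_ge :: "('k::zero \<Rightarrow> int) \<Rightarrow> int \<Rightarrow> 'k \<Rightarrow> bool" where
  "ord_ge v k z \<longleftrightarrow> z = 0 \<or> v z \<ge> k"

lemma ord_ge_0 [simp]: "ord_ge v k 0"
  by (simp add: ord_ge_def)

lemma ord_ge_mono: "ord_ge v k z \<Longrightarrow> l \<le> k \<Longrightarrow> ord_ge v l z"
  by (auto simp: ord_ge_def)

context subfield_over_C
begin

lemma place_outside: "v \<in> places c F \<Longrightarrow> z \<notin> F - {0} \<Longrightarrow> v z = 0"
  by (simp add: places_def)

lemma place_const: "v \<in> places c F \<Longrightarrow> v (c a) = 0"
  by (simp add: places_def)

lemma place_1: "v \<in> places c F \<Longrightarrow> v 1 = 0"
  using place_const[of v 1] by (simp only: c_one)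

lemma place_mult:
  "v \<in> places c F \<Longrightarrow> y \<in> F \<Longrightarrow> z \<in> F \<Longrightarrow> y \<noteq> 0 \<Longrightarrow> z \<noteq> 0 \<Longrightarrow> v (y * z) = v y + v z"
  by (simp add: places_def)

lemma place_add_ge:
  "v \<in> places c F \<Longrightarrow> y \<in> F \<Longrightarrow> z \<in> F \<Longrightarrow> y \<noteq> 0 \<Longrightarrow> z \<noteq> 0 \<Longrightarrow> y + z \<noteq> 0 \<Longrightarrow> v (y + z) \<ge> min (v y) (v z)"
  by (simp add: places_def)

lemma place_uniformizer: "v \<in> places c F \<Longrightarrow> \<exists>t\<in>F. t \<noteq> 0 \<and> v t = 1"
  by (auto simp: places_def)

lemma place_inverse: 
  assumes "v \<in> places c F" "z \<in> F"
  shows "v (inverse z) = - v z"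
proof (cases "z = 0")
  case True
  then show ?thesis using place_outside[OF assms(1), of 0] by simp
next
  case False
  then have "v z + v (inverse z) = 0"
    using place_mult[OF assms(1), of z "inverse z"] assms place_1[OF assms(1)] by (simp add: F_inverse)
  then show ?thesis by simp
qed

lemma place_divide:
  "v \<in> places c F \<Longrightarrow> y \<in> F \<Longrightarrow> z \<in> F \<Longrightarrow> y \<noteq> 0 \<Longrightarrow> z \<noteq> 0 \<Longrightarrow> v (y / z) = v y - v z"
  using place_mult[of v y "inverse z"] place_inverse[of v z] by (simp add: divide_inverse F_inverse)

lemma place_power:
  assumes "v \<in> places c F" "z \<in> F" "z \<noteq> 0"
  shows "v (z ^ m) = int m * v z"
  using assms place_1[OF assms(1)]
  by (induction m) (simp_all add: place_mult[OF assms(1)] F_power algebra_simps)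

lemma place_const_mult:
  "v \<in> places c F \<Longrightarrow> z \<in> F \<Longrightarrow> z \<noteq> 0 \<Longrightarrow> a \<noteq> 0 \<Longrightarrow> v (c a * z) = v z"
  by (simp add: place_mult place_const)

lemma ord_ge_add:
  assumes "v \<in> places c F" "y \<in> F" "z \<in> F" "ord_ge v k y" "ord_ge v k z"
  shows "ord_ge v k (y + z)"
  using assms place_add_ge[of v y z] by (cases "y = 0"; cases "z = 0"; cases "y + z = 0") (auto simp: ord_ge_def)

lemma ord_ge_mult:
  assumes "v \<in> places c F" "y \<in> F" "z \<in> F" "ord_ge v k y" "ord_ge v l z"
  shows "ord_ge v (k + l) (y * z)"
  using assms place_mult[of v y z] by (cases "y = 0"; cases "z = 0") (auto simp: ord_ge_def)

lemma ord_ge_const: "v \<in> places c F \<Longrightarrow> ord_ge v 0 (c a)"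
  by (simp add: ord_ge_def place_const)

lemma ord_ge_const_mult:
  assumes "v \<in> places c F" "z \<in> F" "ord_ge v k z"
  shows "ord_ge v k (c a * z)"
  using ord_ge_mult[OF assms(1) F_const assms(2) ord_ge_const[OF assms(1)] assms(3)] by simp

lemma ord_ge_minus:
  assumes "v \<in> places c F" "z \<in> F" "ord_ge v k z"
  shows "ord_ge v k (- z)"
  using ord_ge_const_mult[OF assms, of "- 1"] by (simp add: c_minus)

lemma ord_ge_diff:
  assumes "v \<in> places c F" "y \<in> F" "z \<in> F" "ord_ge v k y" "ord_ge v k z"
  shows "ord_ge v k (y - z)"
  using ord_ge_add[of v y "- z" k] ord_ge_minus[of v z k] assms by auto

lemma ord_ge_sum:
  assumes "v \<in> places c F" "\<And>i. i \<in> I \<Longrightarrow> f i \<in> F" "\<And>i. i \<in> I \<Longrightarrow> ord_ge v k (f i)"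
  shows "ord_ge v k (\<Sum>i\<in>I. f i)"
  using assms(2,3)
  by (induction I rule: infinite_finite_induct) (auto intro!: ord_ge_add[OF assms(1)])

lemma ord_ge_power:
  assumes "v \<in> places c F" "z \<in> F" "ord_ge v 0 z"
  shows "ord_ge v 0 (z ^ m)"
  using assms place_1[OF assms(1)]
  by (cases "z = 0") (auto simp: ord_ge_def place_power power_0_left)

lemma ord_ge_poly_at:
  assumes "v \<in> places c F" "z \<in> F" "ord_ge v 0 z"
  shows "ord_ge v 0 (poly_at c p z)"
proof (induction p)
  case (pCons a p)
  then show ?case
    using ord_ge_mult[OF assms(1,2) _ assms(3), of "poly_at c p z" 0] assms
    by (auto intro!: ord_ge_add ord_ge_const)
qed simp

lemma ord_ge_1_const: "v \<in> places c F \<Longrightarrow> ord_ge v 1 (c a) \<Longrightarrow> a = 0"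
  using place_const[of v a] by (auto simp: ord_ge_def)

lemma place_add_eq:
  assumes v: "v \<in> places c F" and F: "y \<in> F" "z \<in> F" and "y \<noteq> 0" and z: "ord_ge v (v y + 1) z"
  shows "y + z \<noteq> 0 \<and> v (y + z) = v y"
proof (cases "z = 0")
  case False
  then have gt: "v z > v y" using z by (simp add: ord_ge_def)
  have "v (- z) = v z" using place_const_mult[OF v F(2) False, of "- 1"] by (simp add: c_minus)
  then have ne: "y + z \<noteq> 0" using gt by (metis add.inverse_inverse eq_neg_iff_add_eq_0 order_less_irrefl)
  have "v (y + z) \<ge> v y" using place_add_ge[OF v F \<open>y \<noteq> 0\<close> False ne] gt by simp
  moreover have "\<not> v (y + z) > v y"
  proof
    assume "v (y + z) > v y"
    then have "ord_ge v (v y + 1) ((y + z) - z)"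
      using z F by (intro ord_ge_diff[OF v]) (auto simp: ord_ge_def)
    then show False using \<open>y \<noteq> 0\<close> by (simp add: ord_ge_def)
  qed
  ultimately show ?thesis using ne by simp
qed (use assms in simp)

lemma ord_ge_poly_at_diff:
  assumes "v \<in> places c F" "z \<in> F" "ord_ge v 1 (z - c a)"
  shows "ord_ge v 1 (poly_at c p z - c (poly p a))"
proof (induction p)
  case (pCons b p)
  have z0: "ord_ge v 0 z"
    using ord_ge_add[OF assms(1) _ _ ord_ge_mono[OF assms(3)] ord_ge_const[OF assms(1)], of a] assms(2)
    by (simp add: F_diff)
  have "ord_ge v (0 + 1) (z * (poly_at c p z - c (poly p a)))"
    using assms z0 pCons by (intro ord_ge_mult) auto
  moreover have "ord_ge v 1 (c (poly p a) * (z - c a))"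
    using assms by (intro ord_ge_const_mult) auto
  ultimately have "ord_ge v 1 (z * (poly_at c p z - c (poly p a)) + c (poly p a) * (z - c a))"
    using assms by (intro ord_ge_add) auto
  then show ?case by (simp add: c_add c_mult algebra_simps)
qed simp

end

locale subfield_of_curve = subfield_over_C c F for c :: "complex \<Rightarrow> 'k::field" and F +
  assumes curve: "function_field_of_curve c"
begin

text \<open>If a product of factors \<open>z - a\<close> without poles vanishes at \<open>v\<close>, then so does one factor.\<close>

lemma ord_ge_poly_root:
  assumes v: "v \<in> places c F" and z: "z \<in> F" "ord_ge v 0 z"
    and "ord_ge v 1 (poly_at c p z)" "p \<noteq> 0"
  shows "\<exists>a. ord_ge v 1 (z - c a)"
  using assms(4,5)
proof (induction "degree p" arbitrary: p rule: less_induct)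
  case less
  show ?case
  proof (cases "degree p = 0")
    case True
    then obtain a where "p = [:a:]" by (metis degree_eq_zeroE)
    with less.prems ord_ge_1_const[OF v] show ?thesis by simp
  next
    case False
    then have "\<not> constant (poly p)" by (simp add: constant_degree)
    then obtain a where "poly p a = 0" using fundamental_theorem_of_algebra by blast
    then obtain q where q: "p = [:- a, 1:] * q" by (metis dvd_def poly_eq_0_iff_dvd)
    have q0: "q \<noteq> 0" using less.prems q by auto
    have deg: "degree q < degree p"
      unfolding q using degree_mult_eq[of "[:- a, 1:]" q] q0 by (simp del: mult_pCons_left)
    have "poly_at c p z = (z - c a) * poly_at c q z"
      unfolding q by (simp only: poly_at_mult) (simp add: c_minus)
    then have "ord_ge v 1 ((z - c a) * poly_at c q z)" using less.prems(1) by simp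
    then have "ord_ge v 1 (z - c a) \<or> ord_ge v 1 (poly_at c q z)"
      using place_mult[OF v, of "z - c a" "poly_at c q z"] z
      by (cases "z - c a = 0"; cases "poly_at c q z = 0") (auto simp: ord_ge_def)
    then show ?thesis using less.hyps[OF deg _ q0] by blast
  qed
qed

text \<open>Residue fields are algebraic over \<open>\<complex>\<close>, so each element without a pole at \<open>v\<close> has a complex
  value there.  The relation comes from an algebraic dependence between the element and a
  uniformizer, reduced modulo the uniformizer.\<close>

lemma residue_exists:
  assumes v: "v \<in> places c F" and z: "z \<in> F" "ord_ge v 0 z"
  shows "\<exists>a. ord_ge v 1 (z - c a)"
proof -
  obtain t where t: "t \<in> F" "t \<noteq> 0" "v t = 1" using place_uniformizer[OF v] by blast
  obtain N q where q: "q N \<noteq> 0" "(\<Sum>j\<le>(N::nat). poly_at c (q j) z * t ^ j) = 0"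
    using algebraically_dependent[OF curve] by blast
  \<comment> \<open>Powers of \<open>t\<close> dividing the relation are irrelevant, so its lowest coefficient is the one
    that survives modulo \<open>t\<close>.\<close>
  define m where "m = (LEAST j. q j \<noteq> 0)"
  have m: "q m \<noteq> 0" "m \<le> N" and least: "\<And>j. j < m \<Longrightarrow> q j = 0"
    unfolding m_def by (rule LeastI[of _ N], fact q(1), rule Least_le, fact q(1))
      (use not_less_Least in blast)
  have "(\<Sum>j\<le>N. poly_at c (q j) z * t ^ j) = (\<Sum>j\<in>{m..N}. poly_at c (q j) z * t ^ j)"
    using least by (intro sum.mono_neutral_right) (auto simp: not_le)
  also have "\<dots> = poly_at c (q m) z * t ^ m + (\<Sum>j\<in>{m<..N}. poly_at c (q j) z * t ^ j)"
    using m(2) by (simp add: sum.head)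
  finally have eq: "poly_at c (q m) z * t ^ m = - (\<Sum>j\<in>{m<..N}. poly_at c (q j) z * t ^ j)"
    using q(2) by (simp add: eq_neg_iff_add_eq_0)
  have "ord_ge v (0 + int (m + 1)) (poly_at c (q j) z * t ^ j)" if "j \<in> {m<..N}" for j
    using that t v z
    by (intro ord_ge_mult ord_ge_poly_at) (auto simp: ord_ge_def place_power)
  then have "ord_ge v (0 + int (m + 1)) (poly_at c (q m) z * t ^ m)"
    unfolding eq using z t by (intro ord_ge_minus ord_ge_sum v) auto
  then have "ord_ge v 1 (poly_at c (q m) z)"
    using t z place_mult[OF v, of "poly_at c (q m) z" "t ^ m"]
    by (cases "poly_at c (q m) z = 0") (auto simp: ord_ge_def place_power v)
  then show ?thesis using ord_ge_poly_root[OF v z _ m(1)] by blast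
qed

text \<open>Every element is integral over \<open>\<complex>[x]\<close> up to a factor from \<open>\<complex>[x]\<close>, hence after
  multiplication by that factor its poles are among the poles of \<open>x\<close>.\<close>

lemma integral_multiple:
  assumes x: "x \<in> F" "x \<notin> range c" and z: "z \<in> F"
  shows "\<exists>q. q \<noteq> 0 \<and> (\<forall>v\<in>places c F. ord_ge v 0 x \<longrightarrow> ord_ge v 0 (poly_at c q x * z))"
proof -
  obtain N q where q: "q N \<noteq> 0" "(\<Sum>j\<le>(N::nat). poly_at c (q j) x * z ^ j) = 0"
    using algebraically_dependent[OF curve] by blast
  define e where "e = poly_at c (q N) x"
  define w where "w = e * z"
  have e: "e \<noteq> 0" "e \<in> F" using q(1) x poly_at_eq_0_iff by (auto simp: e_def)
  then have N: "N \<noteq> 0" using q(2) by (auto simp: e_def intro: ccontr)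
  have w: "w \<in> F" using e z by (auto simp: w_def)
  \<comment> \<open>Multiplying the relation by \<open>e\<^sup>N\<^sup>-\<^sup>1\<close> makes it monic in \<open>w = e z\<close>.\<close>
  have "0 = e ^ (N - 1) * ((\<Sum>j<N. poly_at c (q j) x * z ^ j) + e * z ^ N)"
    using q(2) by (simp add: e_def lessThan_Suc_atMost[symmetric])
  also have "\<dots> = (\<Sum>j<N. poly_at c (q j) x * e ^ (N - 1 - j) * w ^ j) + w ^ N"
  proof -
    have "e ^ (N - 1) * (poly_at c (q j) x * z ^ j) = poly_at c (q j) x * e ^ (N - 1 - j) * w ^ j"
      if "j < N" for j
    proof -
      have "e ^ (N - 1) = e ^ (N - 1 - j) * e ^ j"
        using that by (simp flip: power_add)
      then show ?thesis by (simp add: w_def power_mult_distrib mult_ac)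
    qed
    moreover have "e ^ (N - 1) * (e * z ^ N) = w ^ N"
      using N by (cases N) (simp_all add: w_def power_mult_distrib mult_ac)
    ultimately show ?thesis
      unfolding distrib_left sum_distrib_left
      by (intro arg_cong2[where f = "(+)"] sum.cong) (auto simp only: lessThan_iff)
  qed
  finally have rel: "w ^ N = - (\<Sum>j<N. poly_at c (q j) x * e ^ (N - 1 - j) * w ^ j)"
    by (simp add: eq_neg_iff_add_eq_0 add.commute)
  have "ord_ge v 0 w" if v: "v \<in> places c F" and xv: "ord_ge v 0 x" for v
  proof (rule ccontr)
    assume "\<not> ord_ge v 0 w"
    then have w0: "w \<noteq> 0" "v w < 0" by (auto simp: ord_ge_def)
    have "ord_ge v (0 + 0 + int (N - 1) * v w) (poly_at c (q j) x * e ^ (N - 1 - j) * w ^ j)"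
      if "j < N" for j
    proof (intro ord_ge_mult v)
      have "int (N - 1) * v w \<le> int j * v w"
        using that w0 by (intro mult_right_mono_neg) auto
      then show "ord_ge v (int (N - 1) * v w) (w ^ j)"
        using w w0 by (simp add: ord_ge_def place_power v)
      show "ord_ge v 0 (e ^ (N - 1 - j))"
        using e by (intro ord_ge_power v) (auto simp: e_def intro!: ord_ge_poly_at v x xv)
    qed (use e w x xv v in \<open>auto intro!: ord_ge_poly_at\<close>)
    then have "ord_ge v (0 + 0 + int (N - 1) * v w) (w ^ N)"
      unfolding rel using e w x by (intro ord_ge_minus ord_ge_sum v) auto
    then have "int (N - 1) * v w \<le> v (w ^ N)"
      using w0 by (simp add: ord_ge_def)
    also have "v (w ^ N) = int (N - 1) * v w + v w"
      using place_power[OF v w w0(1), of N] N by (cases N) (simp_all add: distrib_right)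
    finally show False using w0 by simp
  qed
  then show ?thesis using q(1) unfolding w_def e_def by blast
qed

end

section \<open>Function fields of genus zero\<close>

locale genus_zero_field = subfield_of_curve c F for c :: "complex \<Rightarrow> 'k::field" and F +
  assumes genus_zero: "has_genus c F 0"
    and nonconstant: "F \<noteq> range c"
begin

lemma riemann: "D \<in> divisors c F \<Longrightarrow> int (ell c F D) \<ge> divisor_degree D + 1"
  using genus_zero unfolding has_genus_def by force

lemma ell_eq: "ell c F D = VC.dim (riemann_roch_space c F D)"
  by (simp add: ell_def)

text \<open>Dimension \<open>0\<close> is also the value that the dimension function takes on spaces of infinite
  dimension, so positivity of \<open>ell\<close> entails finiteness of the dimension.  Hence the
  functions without poles form a finite extension of \<open>\<complex>\<close>, which is \<open>\<complex>\<close> itself.\<close>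

lemma no_poles_imp_constant:
  assumes z: "z \<in> F" and "\<And>v. v \<in> places c F \<Longrightarrow> ord_ge v 0 z"
  shows "z \<in> range c"
proof -
  let ?V = "riemann_roch_space c F (\<lambda>_. 0)"
  have "int (ell c F (\<lambda>_. 0)) \<ge> 1"
    using riemann[of "\<lambda>_. 0"] by (simp add: divisors_def divisor_degree_def)
  then have dim: "VC.dim ?V > 0" by (simp add: ell_eq)
  obtain B where B: "VC.independent B" "?V \<subseteq> VC.span B" "card B = VC.dim ?V"
    using VC.basis_exists[of ?V] by blast
  have "finite B" using B(3) dim by (metis card.infinite not_gr_zero)
  have "z ^ i \<in> ?V" for i
    using z assms(2) ord_ge_power[of _ z i] by (auto simp: riemann_roch_space_def ord_ge_def)
  then have "(\<lambda>i. z ^ i) ` {..card B} \<subseteq> VC.span B" using B(2) by blast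
  then obtain a where a: "\<exists>i\<in>{..card B}. a i \<noteq> 0" "(\<Sum>i\<in>{..card B}. c (a i) * z ^ i) = 0"
    using family_dependent[of "{..card B}" B "\<lambda>i. z ^ i"] \<open>finite B\<close> by auto
  define p where "p = (\<Sum>i\<in>{..card B}. monom (a i) i)"
  have "poly_at c p z = 0" using a(2) by (simp add: p_def poly_at_sum poly_at_monom)
  moreover have "p \<noteq> 0"
  proof -
    obtain i where "i \<le> card B" "a i \<noteq> 0" using a(1) by auto
    then have "coeff p i \<noteq> 0" by (simp add: p_def coeff_sum)
    then show ?thesis by auto
  qed
  ultimately show ?thesis by (rule algebraic_imp_constant)
qed

lemma places_nonempty: "places c F \<noteq> {}"
  using no_poles_imp_constant nonconstant by auto

text \<open>A coordinate with pole \<open>P\<close> is an isomorphism to the projective line that maps \<open>P\<close> to infinity.\<close>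

definition coordinate :: "'k \<Rightarrow> ('k \<Rightarrow> int) \<Rightarrow> bool" where
  "coordinate x P \<longleftrightarrow> P \<in> places c F \<and> x \<in> F \<and> x \<noteq> 0 \<and> P x = - 1 \<and>
     (\<forall>v\<in>places c F. v \<noteq> P \<longrightarrow> ord_ge v 0 x)"

text \<open>For the divisor \<open>P\<close> of degree one, \<open>\<ell>(P) \<ge> 2\<close> leaves room for a nonconstant function, and such
  a function must have a pole.\<close>

lemma coordinate_exists:
  assumes P: "P \<in> places c F"
  shows "\<exists>x. coordinate x P"
proof -
  define D where "D v = (if v = P then 1 else 0 :: int)" for v :: "'k \<Rightarrow> int"
  have supp: "{v. D v \<noteq> 0} = {P}" by (auto simp: D_def)
  let ?V = "riemann_roch_space c F D"
  have "int (ell c F D) \<ge> 2"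
    using riemann[of D] P by (simp add: divisors_def divisor_degree_def supp) (simp add: D_def)
  then have dim: "VC.dim ?V > 1" by (simp add: ell_eq)
  have "\<not> ?V \<subseteq> range c"
  proof
    assume "?V \<subseteq> range c"
    also have "range c \<subseteq> VC.span {1}"
      using VC.span_scale[OF VC.span_base[of 1 "{1}"]] by auto
    finally show False using VC.dim_le_card[of ?V "{1}"] dim by simp
  qed
  then obtain x where x: "x \<in> ?V" "x \<notin> range c" by blast
  then have x0: "x \<noteq> 0" using c_zero by (metis rangeI)
  from x have xF: "x \<in> F" by (auto simp: riemann_roch_space_def)
  have other: "ord_ge v 0 x" if "v \<in> places c F" "v \<noteq> P" for v
    using x(1) that by (force simp: riemann_roch_space_def D_def ord_ge_def)
  have "P x \<ge> - 1" using x(1) x0 P by (force simp: riemann_roch_space_def D_def)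
  moreover have "\<not> ord_ge P 0 x"
    using no_poles_imp_constant[OF xF] other x(2) by metis
  ultimately have "P x = - 1" using x0 by (simp add: ord_ge_def)
  with P xF x0 other show ?thesis unfolding coordinate_def by blast
qed

lemma coordinateD:
  assumes "coordinate x P"
  shows "P \<in> places c F" "x \<in> F" "x \<noteq> 0" "P x = - 1"
    "\<And>v. v \<in> places c F \<Longrightarrow> v \<noteq> P \<Longrightarrow> ord_ge v 0 x" "x \<notin> range c"
  using assms place_const[of P] by (auto simp: coordinate_def)

text \<open>Subtracting a suitable multiple of \<open>x\<^sup>m\<close> lowers a pole of order \<open>m\<close> at \<open>P\<close>.\<close>

lemma one_pole_imp_polynomial:
  assumes x: "coordinate x P" and z: "z \<in> F"
    and "\<And>v. v \<in> places c F \<Longrightarrow> v \<noteq> P \<Longrightarrow> ord_ge v 0 z" "ord_ge P (- int m) z"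
  shows "\<exists>p. degree p \<le> m \<and> z = poly_at c p x"
  using assms(2-)
proof (induction m arbitrary: z)
  case 0
  then have "\<And>v. v \<in> places c F \<Longrightarrow> ord_ge v 0 z" by (metis minus_zero of_nat_0)
  then obtain a where "z = c a" using no_poles_imp_constant[OF 0(1)] by blast
  then show ?case by (intro exI[of _ "[:a:]"]) simp
next
  case (Suc m)
  note x = coordinateD[OF x]
  define u where "u = z / x ^ Suc m"
  have u: "u \<in> F" "ord_ge P 0 u"
    using Suc.prems x
    by (auto simp: u_def ord_ge_def place_divide place_power simp del: power_Suc)
  then obtain a where a: "ord_ge P 1 (u - c a)" using residue_exists[OF x(1)] by blast
  define z' where "z' = z - c a * x ^ Suc m"
  have "z' = x ^ Suc m * (u - c a)" using x by (simp add: z'_def u_def field_simps)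
  moreover have "ord_ge P (- int (Suc m)) (x ^ Suc m)"
    using x by (simp add: ord_ge_def place_power del: power_Suc)
  ultimately have "ord_ge P (- int (Suc m) + 1) z'"
    using x u a ord_ge_mult[of P "x ^ Suc m" "u - c a" "- int (Suc m)" 1] by simp
  then have P: "ord_ge P (- int m) z'" by simp
  have "ord_ge v 0 z'" if "v \<in> places c F" "v \<noteq> P" for v
    unfolding z'_def using that Suc.prems x
    by (intro ord_ge_diff ord_ge_const_mult ord_ge_power) auto
  moreover have "z' \<in> F" using Suc.prems x by (simp add: z'_def)
  ultimately obtain p where p: "degree p \<le> m" "z' = poly_at c p x" using Suc.IH P by blast
  have "z = poly_at c (p + monom a (Suc m)) x"
    using p(2) by (simp add: poly_at_add poly_at_monom z'_def diff_eq_eq)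
  moreover have "degree (p + monom a (Suc m)) \<le> Suc m"
    using p(1) degree_monom_le[of a "Suc m"] by (intro degree_add_le) auto
  ultimately show ?case by blast
qed

text \<open>After multiplication by a polynomial in \<open>x\<close> all poles other than \<open>P\<close> disappear.\<close>

lemma coordinate_quotient:
  assumes x: "coordinate x P" and z: "z \<in> F"
  shows "\<exists>p q. q \<noteq> 0 \<and> z = poly_at c p x / poly_at c q x"
proof -
  note xD = coordinateD[OF x]
  obtain q where q: "q \<noteq> 0" "\<And>v. v \<in> places c F \<Longrightarrow> ord_ge v 0 x \<Longrightarrow> ord_ge v 0 (poly_at c q x * z)"
    using integral_multiple[OF xD(2,6) z] by blast
  define w where "w = poly_at c q x * z"
  have w: "w \<in> F" using xD z by (simp add: w_def)
  have "- int (nat \<bar>P w\<bar>) \<le> P w" by linarith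
  then have "ord_ge P (- int (nat \<bar>P w\<bar>)) w" by (simp add: ord_ge_def)
  then obtain p where "w = poly_at c p x"
    using one_pole_imp_polynomial[OF x w] q(2) xD(5) unfolding w_def by blast
  moreover have "poly_at c q x \<noteq> 0" using q(1) xD(6) poly_at_eq_0_iff by blast
  ultimately have "z = poly_at c p x / poly_at c q x" by (simp add: w_def field_simps)
  with q(1) show ?thesis by blast
qed

lemma coordinate_adjoin:
  assumes x: "coordinate x P"
  shows "F = adjoin c {x}"
proof
  show "adjoin c {x} \<subseteq> F" using adjoin_minimal[OF F_field] coordinateD[OF x] by simp
  interpret A: subfield_over_C c "adjoin c {x}"
    by unfold_locales (rule intermediate_field_adjoin)
  have "x \<in> adjoin c {x}" using subset_adjoin[of "{x}" c] by simp
  then show "F \<subseteq> adjoin c {x}"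
    using coordinate_quotient[OF x] by (metis A.F_divide A.F_poly_at subsetI)
qed

subsection \<open>The places as points of the projective line\<close>

lemma coordinate_value:
  assumes "coordinate x P" "v \<in> places c F" "v \<noteq> P"
  shows "\<exists>a. ord_ge v 1 (x - c a)"
  using residue_exists coordinateD[OF assms(1)] assms by blast

lemma value_unique:
  assumes "v \<in> places c F" "x \<in> F" "ord_ge v 1 (x - c a)" "ord_ge v 1 (x - c b)"
  shows "a = b"
proof -
  have "ord_ge v 1 ((x - c b) - (x - c a))"
    by (rule ord_ge_diff) (use assms in auto)
  then have "ord_ge v 1 (c (a - b))" by (simp add: c_diff)
  then show ?thesis using ord_ge_1_const[OF assms(1)] by fastforce
qed

lemma value_imp_no_pole:
  assumes "v \<in> places c F" "x \<in> F" "ord_ge v 1 (x - c a)"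
  shows "ord_ge v 0 x"
  using ord_ge_add[OF assms(1) _ _ ord_ge_mono[OF assms(3)] ord_ge_const[OF assms(1)], of a] assms(2)
  by simp

lemma value_imp_ne_pole:
  assumes "coordinate x P" "v \<in> places c F" "ord_ge v 1 (x - c a)"
  shows "v \<noteq> P"
  using value_imp_no_pole[OF assms(2) _ assms(3)] coordinateD[OF assms(1)] by (auto simp: ord_ge_def)

lemma pole_poly_at:
  assumes x: "coordinate x P" and "p \<noteq> 0"
  shows "P (poly_at c p x) = - int (degree p)"
  using \<open>p \<noteq> 0\<close>
proof (induction p)
  case (pCons a p)
  note x = coordinateD[OF x]
  show ?case
  proof (cases "p = 0")
    case True
    with place_const[OF x(1), of a] show ?thesis by simp
  next
    case False
    then have ne: "poly_at c p x \<noteq> 0" using poly_at_eq_0_iff[OF x(6)] by blast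
    have val: "P (x * poly_at c p x) = - int (degree (pCons a p))"
      using False ne x pCons by (simp add: place_mult)
    have "ord_ge P (P (x * poly_at c p x) + 1) (c a)"
      unfolding val using False by (intro ord_ge_mono[OF ord_ge_const[OF x(1)]]) simp
    then show ?thesis
      using place_add_eq[OF x(1), of "x * poly_at c p x" "c a"] ne x val by (simp add: add.commute)
  qed
qed simp

lemma pole_shift:
  assumes "coordinate x P"
  shows "P (x - c a) = - 1"
  using pole_poly_at[OF assms, of "[:- a, 1:]"] by (simp add: c_minus)

lemma coordinate_ne_const: "coordinate x P \<Longrightarrow> x - c a \<noteq> 0"
  using coordinateD(6) by fastforce

text \<open>Otherwise \<open>1/(x - a)\<close> would have no poles.\<close>

lemma place_exists:
  assumes x: "coordinate x P"
  shows "\<exists>v\<in>places c F. ord_ge v 1 (x - c a)"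
proof (rule ccontr)
  assume no: "\<not> ?thesis"
  note xD = coordinateD[OF x]
  have ne: "x - c a \<noteq> 0" by (rule coordinate_ne_const[OF x])
  have "ord_ge v 0 (inverse (x - c a))" if v: "v \<in> places c F" for v
  proof (cases "v = P")
    case True
    then show ?thesis using place_inverse[OF v, of "x - c a"] pole_shift[OF x] xD by (simp add: ord_ge_def)
  next
    case False
    then have "ord_ge v 0 (x - c a)" using v xD by (intro ord_ge_diff ord_ge_const) auto
    moreover have "\<not> ord_ge v 1 (x - c a)" using no v by blast
    ultimately have "v (x - c a) = 0" using ne by (auto simp: ord_ge_def)
    then show ?thesis using place_inverse[OF v, of "x - c a"] xD by (simp add: ord_ge_def)
  qed
  then have "inverse (x - c a) \<in> range c" using no_poles_imp_constant xD by simp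
  then obtain b where "inverse (x - c a) = c b" by blast
  then have "x - c a = c (inverse b)" using c_inverse[of b] by (metis inverse_inverse_eq)
  then have "x = c (inverse b + a)" by (simp add: c_add algebra_simps)
  with xD(6) show False by simp
qed

lemma ord_ge_poly_at_iff:
  assumes "v \<in> places c F" "x \<in> F" "ord_ge v 1 (x - c a)"
  shows "ord_ge v 1 (poly_at c p x) \<longleftrightarrow> poly p a = 0"
proof -
  have d: "ord_ge v 1 (poly_at c p x - c (poly p a))" by (rule ord_ge_poly_at_diff[OF assms])
  show ?thesis
  proof
    assume "ord_ge v 1 (poly_at c p x)"
    then have "ord_ge v 1 (poly_at c p x - (poly_at c p x - c (poly p a)))"
      by (rule ord_ge_diff[rotated 3]) (use d assms in auto)
    then show "poly p a = 0" using ord_ge_1_const[OF assms(1)] by simp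
  qed (use d in simp)
qed

text \<open>A place is determined by the value of a coordinate, because the valuation of a rational function
  can be computed from the multiplicities of its numerator and denominator.\<close>

lemma place_poly_at_scaled:
  assumes x: "coordinate x P" and v: "v \<in> places c F" "ord_ge v 1 (x - c a)" and "p \<noteq> 0"
  shows "v (poly_at c p x) = int (order a p) * v (x - c a)"
proof -
  note xD = coordinateD[OF x]
  obtain q where q: "p = [:- a, 1:] ^ order a p * q" "\<not> [:- a, 1:] dvd q"
    using order_decomp[OF \<open>p \<noteq> 0\<close>] by blast
  have q0: "poly q a \<noteq> 0" using q(2) by (simp add: poly_eq_0_iff_dvd)
  then have ne: "poly_at c q x \<noteq> 0" using poly_at_eq_0_iff[OF xD(6)] by auto
  have "ord_ge v 0 (poly_at c q x)" "\<not> ord_ge v 1 (poly_at c q x)"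
    using ord_ge_poly_at_iff[OF v(1) xD(2) v(2)] q0 value_imp_no_pole[OF v(1) xD(2) v(2)] v xD
    by (auto intro: ord_ge_poly_at)
  then have "v (poly_at c q x) = 0" by (auto simp: ord_ge_def)
  moreover have "poly_at c p x = (x - c a) ^ order a p * poly_at c q x"
    by (subst q(1)) (simp only: poly_at_mult poly_at_power, simp add: c_minus)
  ultimately show ?thesis
    using ne coordinate_ne_const[OF x] xD v by (simp add: place_mult place_power)
qed

text \<open>Every value of \<open>v\<close> is a multiple of \<open>v (x - a)\<close>, and \<open>v\<close> is normalised.\<close>

lemma place_local_parameter:
  assumes x: "coordinate x P" and v: "v \<in> places c F" "ord_ge v 1 (x - c a)"
  shows "v (x - c a) = 1"
proof -
  note xD = coordinateD[OF x]
  obtain t where t: "t \<in> F" "t \<noteq> 0" "v t = 1" using place_uniformizer[OF v(1)] by blast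
  obtain p q where pq: "q \<noteq> 0" "t = poly_at c p x / poly_at c q x"
    using coordinate_quotient[OF x t(1)] by blast
  then have p: "p \<noteq> 0" using t(2) by auto
  have "v t = v (poly_at c p x) - v (poly_at c q x)"
    unfolding pq(2) using p pq(1) xD v poly_at_eq_0_iff[OF xD(6)] by (intro place_divide) auto
  also have "\<dots> = (int (order a p) - int (order a q)) * v (x - c a)"
    using place_poly_at_scaled[OF x v] p pq(1) by (simp add: left_diff_distrib)
  finally have "v (x - c a) dvd 1" using t(3) by (metis dvd_triv_right)
  moreover have "v (x - c a) \<ge> 1" using v(2) coordinate_ne_const[OF x] by (simp add: ord_ge_def)
  ultimately show ?thesis by (simp add: zdvd1_eq)
qed

lemma place_poly_at:
  assumes "coordinate x P" "v \<in> places c F" "ord_ge v 1 (x - c a)" "p \<noteq> 0"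
  shows "v (poly_at c p x) = int (order a p)"
  using place_poly_at_scaled[OF assms] place_local_parameter[OF assms(1-3)] by simp

lemma place_unique:
  assumes x: "coordinate x P" and v: "v \<in> places c F" "ord_ge v 1 (x - c a)"
    and w: "w \<in> places c F" "ord_ge w 1 (x - c a)"
  shows "v = w"
proof
  fix z
  note xD = coordinateD[OF x]
  show "v z = w z"
  proof (cases "z \<in> F - {0}")
    case False
    then show ?thesis using place_outside v(1) w(1) by metis
  next
    case True
    then obtain p q where pq: "q \<noteq> 0" "z = poly_at c p x / poly_at c q x"
      using coordinate_quotient[OF x] by blast
    then have p: "p \<noteq> 0" using True by auto
    have "u z = int (order a p) - int (order a q)" if "u \<in> places c F" "ord_ge u 1 (x - c a)" for u
      unfolding pq(2) using p pq(1) xD that place_poly_at[OF x that]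
      by (subst place_divide) (auto simp: poly_at_eq_0_iff)
    with v w show ?thesis by metis
  qed
qed

lemma infinite_places: "infinite (places c F)"
proof
  assume fin: "finite (places c F)"
  obtain P x where x: "coordinate x P" using places_nonempty coordinate_exists by blast
  obtain f where f: "\<And>a. f a \<in> places c F" "\<And>a. ord_ge (f a) 1 (x - c a)"
    using place_exists[OF x] by metis
  have "inj f"
    using value_unique f coordinateD(2)[OF x] by (metis injI)
  moreover have "range f \<subseteq> places c F" using f(1) by blast
  ultimately have "finite (UNIV :: complex set)"
    using fin by (metis finite_imageD finite_subset)
  then show False using infinite_UNIV_char_0 by blast
qed

end

section \<open>Automorphisms\<close>

context field_over_C
begin

abbreviation Aut :: "('k \<Rightarrow> 'k) set" where
  "Aut \<equiv> carrier (aut_group c)"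

lemma aut_bij: "\<sigma> \<in> Aut \<Longrightarrow> bij \<sigma>"
  and aut_add: "\<sigma> \<in> Aut \<Longrightarrow> \<sigma> (y + z) = \<sigma> y + \<sigma> z"
  and aut_mult: "\<sigma> \<in> Aut \<Longrightarrow> \<sigma> (y * z) = \<sigma> y * \<sigma> z"
  and aut_const: "\<sigma> \<in> Aut \<Longrightarrow> \<sigma> (c a) = c a"
  by (simp_all add: aut_group_def)

lemma aut_0: "\<sigma> \<in> Aut \<Longrightarrow> \<sigma> 0 = 0"
  using aut_const[of \<sigma> 0] by simp

lemma aut_1: "\<sigma> \<in> Aut \<Longrightarrow> \<sigma> 1 = 1"
  using aut_const[of \<sigma> 1] by simp

lemma aut_eq_iff: "\<sigma> \<in> Aut \<Longrightarrow> \<sigma> y = \<sigma> z \<longleftrightarrow> y = z"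
  by (meson aut_bij bij_is_inj injD)

lemma aut_eq_0_iff: "\<sigma> \<in> Aut \<Longrightarrow> \<sigma> z = 0 \<longleftrightarrow> z = 0"
  by (metis aut_0 aut_eq_iff)

lemma aut_minus: "\<sigma> \<in> Aut \<Longrightarrow> \<sigma> (- z) = - \<sigma> z"
  using aut_mult[of \<sigma> "c (- 1)" z] aut_const[of \<sigma> "- 1"] by (simp add: c_minus)

lemma aut_diff: "\<sigma> \<in> Aut \<Longrightarrow> \<sigma> (y - z) = \<sigma> y - \<sigma> z"
  using aut_add[of \<sigma> y "- z"] by (simp add: aut_minus)

lemma aut_inverse: "\<sigma> \<in> Aut \<Longrightarrow> \<sigma> (inverse z) = inverse (\<sigma> z)"
  by (cases "z = 0") (metis aut_0 inverse_zero, metis aut_1 aut_mult inverse_unique right_inverse)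

lemma aut_divide: "\<sigma> \<in> Aut \<Longrightarrow> \<sigma> (y / z) = \<sigma> y / \<sigma> z"
  by (simp add: divide_inverse aut_mult aut_inverse)

lemma aut_power: "\<sigma> \<in> Aut \<Longrightarrow> \<sigma> (z ^ m) = \<sigma> z ^ m"
  by (induction m) (simp_all add: aut_1 aut_mult)

lemma aut_poly_at: "\<sigma> \<in> Aut \<Longrightarrow> \<sigma> (poly_at c p z) = poly_at c p (\<sigma> z)"
  by (induction p) (simp_all add: aut_0 aut_add aut_mult aut_const)

lemma aut_sum: "\<sigma> \<in> Aut \<Longrightarrow> \<sigma> (\<Sum>i\<in>I. f i) = (\<Sum>i\<in>I. \<sigma> (f i))"
  by (induction I rule: infinite_finite_induct) (simp_all add: aut_0 aut_add)

lemma aut_id: "id \<in> Aut"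
  by (simp add: aut_group_def)

lemma aut_comp: "\<sigma> \<in> Aut \<Longrightarrow> \<tau> \<in> Aut \<Longrightarrow> \<sigma> \<circ> \<tau> \<in> Aut"
  by (auto simp: aut_group_def bij_comp)

lemma aut_funpow: "\<sigma> \<in> Aut \<Longrightarrow> \<sigma> ^^ i \<in> Aut"
  by (induction i) (auto intro: aut_id aut_comp)

lemma aut_inverse_exists: "\<sigma> \<in> Aut \<Longrightarrow> \<exists>\<tau>\<in>Aut. \<tau> \<circ> \<sigma> = id \<and> \<sigma> \<circ> \<tau> = id"
proof -
  assume \<sigma>: "\<sigma> \<in> Aut"
  interpret G: group "aut_group c" by (rule group_aut_group)
  show ?thesis
    using G.inv_closed[OF \<sigma>] G.l_inv[OF \<sigma>] G.r_inv[OF \<sigma>] by (auto simp: aut_group_def)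
qed

lemma autI:
  assumes add: "\<And>y z. \<sigma> (y + z) = \<sigma> y + \<sigma> z" and mult: "\<And>y z. \<sigma> (y * z) = \<sigma> y * \<sigma> z"
    and const: "\<And>a. \<sigma> (c a) = c a" and "surj \<sigma>"
  shows "\<sigma> \<in> Aut"
proof -
  have "inj \<sigma>"
  proof (rule injI)
    fix y z assume eq: "\<sigma> y = \<sigma> z"
    have "\<sigma> (y - z) + \<sigma> z = \<sigma> y" by (simp flip: add)
    then have s0: "\<sigma> (y - z) = 0" using eq by simp
    show "y = z"
    proof (rule ccontr)
      assume "y \<noteq> z"
      then have "(y - z) * inverse (y - z) = 1" by simp
      then have "\<sigma> (y - z) * \<sigma> (inverse (y - z)) = 1" using const[of 1] by (simp flip: mult)
      with s0 show False by simp
    qed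
  qed
  with assms show ?thesis by (simp add: aut_group_def bij_def)
qed

lemma intermediate_field_agree:
  assumes "\<sigma> \<in> Aut" "\<tau> \<in> Aut"
  shows "intermediate_field c {z. \<sigma> z = \<tau> z}"
  using assms
  by (auto simp: intermediate_field_def aut_const aut_add aut_mult aut_minus aut_inverse)

lemma aut_agree_adjoin:
  assumes "\<sigma> \<in> Aut" "\<tau> \<in> Aut" "\<And>s. s \<in> S \<Longrightarrow> \<sigma> s = \<tau> s" "z \<in> adjoin c S"
  shows "\<sigma> z = \<tau> z"
  using adjoin_minimal[OF intermediate_field_agree[OF assms(1,2)], of S] assms(3,4) by blast

lemma intermediate_field_range:
  assumes add: "\<And>y z. \<sigma> (y + z) = \<sigma> y + \<sigma> z" and mult: "\<And>y z. \<sigma> (y * z) = \<sigma> y * \<sigma> z"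
    and const: "\<And>a. \<sigma> (c a) = c a"
  shows "intermediate_field c (range \<sigma>)"
proof -
  have minus: "- \<sigma> z = \<sigma> (- z)" for z
    using mult[of "c (- 1)" z] const[of "- 1"] by (simp add: c_minus)
  have inverse: "inverse (\<sigma> z) = \<sigma> (inverse z)" for z
  proof (cases "z = 0")
    case True
    then show ?thesis using const[of 0] by simp
  next
    case False
    then have "\<sigma> z * \<sigma> (inverse z) = 1" using const[of 1] by (simp flip: mult)
    then show ?thesis by (rule inverse_unique)
  qed
  show ?thesis unfolding intermediate_field_def
    by (auto simp: minus inverse simp flip: add mult) (metis const rangeI)
qed

text \<open>Substituting \<open>w + 1\<close> for \<open>w\<close> in rational functions of \<open>w\<close> is well defined since \<open>w + 1\<close> is
  transcendental, and surjective since its range is a field containing \<open>w = (w + 1) - 1\<close>.\<close>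

lemma translation_automorphism:
  assumes w: "w \<notin> range c" and gen: "UNIV = adjoin c {w}"
  shows "\<exists>\<sigma>\<in>Aut. \<sigma> w = w + 1"
proof -
  have w1: "w + 1 \<notin> range c"
  proof
    assume "w + 1 \<in> range c"
    then obtain a where "w + 1 = c a" by auto
    then have "w = c (a - 1)" by (simp add: c_diff eq_diff_eq)
    with w show False by simp
  qed
  have "\<exists>p q. q \<noteq> 0 \<and> z = poly_at c p w / poly_at c q w" for z
  proof -
    obtain p q where "poly_at c q w \<noteq> 0" "z = poly_at c p w / poly_at c q w"
      using adjoin_single[of z w] gen by blast
    moreover from this have "q \<noteq> 0" by auto
    ultimately show ?thesis by blast
  qed
  then obtain p q where pq: "\<And>z. q z \<noteq> 0" "\<And>z. z = poly_at c (p z) w / poly_at c (q z) w"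
    by metis
  define \<sigma> where "\<sigma> z = poly_at c (p z) (w + 1) / poly_at c (q z) (w + 1)" for z
  \<comment> \<open>The value does not depend on the chosen numerator and denominator.\<close>
  have \<sigma>: "\<sigma> z = poly_at c r (w + 1) / poly_at c s (w + 1)"
    if "s \<noteq> 0" "z = poly_at c r w / poly_at c s w" for r s z
  proof -
    have "poly_at c r w / poly_at c s w = poly_at c (p z) w / poly_at c (q z) w"
      using pq(2)[of z] that(2) by simp
    then have "poly_at c (r * q z) w = poly_at c (p z * s) w"
      using that(1) pq(1)[of z] by (simp add: poly_at_mult frac_eq_eq poly_at_eq_0_iff[OF w])
    then have "r * q z = p z * s" by (simp only: poly_at_eq_iff[OF w])
    then have "poly_at c r (w + 1) * poly_at c (q z) (w + 1) = poly_at c (p z) (w + 1) * poly_at c s (w + 1)"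
      by (metis poly_at_mult)
    then show ?thesis
      using that(1) pq(1)[of z] by (simp add: \<sigma>_def frac_eq_eq poly_at_eq_0_iff[OF w1])
  qed
  have nz: "poly_at c (q z) w \<noteq> 0" "poly_at c (q z) (w + 1) \<noteq> 0" for z
    using pq(1) by (auto simp: poly_at_eq_0_iff[OF w] poly_at_eq_0_iff[OF w1])
  have add: "\<sigma> (y + z) = \<sigma> y + \<sigma> z" for y z
  proof -
    have "y + z = poly_at c (p y * q z + p z * q y) w / poly_at c (q y * q z) w"
      using pq(2)[of y] pq(2)[of z] nz by (metis (no_types) add_frac_eq poly_at_add poly_at_mult)
    then have "\<sigma> (y + z) = poly_at c (p y * q z + p z * q y) (w + 1) / poly_at c (q y * q z) (w + 1)"
      using pq(1) by (intro \<sigma>) auto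
    then show ?thesis using nz by (simp add: \<sigma>_def poly_at_add poly_at_mult add_frac_eq)
  qed
  have mult: "\<sigma> (y * z) = \<sigma> y * \<sigma> z" for y z
  proof -
    have "y * z = poly_at c (p y * p z) w / poly_at c (q y * q z) w"
      using pq(2)[of y] pq(2)[of z] by (metis poly_at_mult times_divide_times_eq)
    then have "\<sigma> (y * z) = poly_at c (p y * p z) (w + 1) / poly_at c (q y * q z) (w + 1)"
      using pq(1) by (intro \<sigma>) auto
    then show ?thesis by (simp add: \<sigma>_def poly_at_mult)
  qed
  have const: "\<sigma> (c a) = c a" for a
    using \<sigma>[of 1 "c a" "[:a:]"] by simp
  have \<sigma>w: "\<sigma> w = w + 1"
    using \<sigma>[of 1 w "[:0, 1:]"] by simp
  have "\<sigma> (w + c (- 1)) = w" unfolding add const \<sigma>w by (simp add: c_minus)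
  then have "w \<in> range \<sigma>" by (metis rangeI)
  moreover have "intermediate_field c (range \<sigma>)"
    by (rule intermediate_field_range[OF add mult const])
  ultimately have "surj \<sigma>" using adjoin_minimal[of "range \<sigma>" "{w}"] gen by auto
  then have "\<sigma> \<in> Aut" by (rule autI[OF add mult const])
  with \<sigma>w show ?thesis by blast
qed

end

text \<open>Dedekind's theorem on the independence of characters.  From a relation at \<open>w z\<close>, subtracting
  \<open>f\<^sub>j(w)\<close> times the relation at \<open>z\<close> leaves a relation without \<open>f\<^sub>j\<close>.\<close>

lemma characters_independent:
  fixes f :: "'i \<Rightarrow> 'k::field \<Rightarrow> 'k" and a :: "'i \<Rightarrow> 'k"
  assumes "finite I" "inj_on f I"
    and "\<And>i y z. i \<in> I \<Longrightarrow> f i (y * z) = f i y * f i z" "\<And>i. i \<in> I \<Longrightarrow> f i 1 = 1"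
    and "\<And>z. (\<Sum>i\<in>I. a i * f i z) = 0" "i \<in> I"
  shows "a i = 0"
  using assms
proof (induction I arbitrary: a i rule: finite_induct)
  case (insert j I)
  have rel: "a j * f j z + (\<Sum>i\<in>I. a i * f i z) = 0" for z
    using insert.prems(4)[of z] insert.hyps by simp
  have zero: "a k = 0" if k: "k \<in> I" for k
  proof -
    have "a k * (f k w - f j w) = 0" for w
    proof (rule insert.IH[of "\<lambda>k. a k * (f k w - f j w)", OF _ _ _ _ k])
      fix z
      have "(\<Sum>i\<in>I. a i * (f i w - f j w) * f i z)
          = (\<Sum>i\<in>I. a i * f i (w * z)) - f j w * (\<Sum>i\<in>I. a i * f i z)"
        using insert.prems(2) by (simp add: sum_distrib_left sum_subtractf algebra_simps)
      also have "(\<Sum>i\<in>I. a i * f i (w * z)) = - (a j * f j (w * z))"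
        using rel[of "w * z"] by (simp add: eq_neg_iff_add_eq_0 add.commute)
      also have "(\<Sum>i\<in>I. a i * f i z) = - (a j * f j z)"
        using rel[of z] by (simp add: eq_neg_iff_add_eq_0 add.commute)
      also have "- (a j * f j (w * z)) - f j w * - (a j * f j z) = 0"
        using insert.prems(2) by simp
      finally show "(\<Sum>i\<in>I. a i * (f i w - f j w) * f i z) = 0" .
    qed (use insert.prems in auto)
    moreover have "f k \<noteq> f j"
      using insert.prems(1) insert.hyps k by (auto simp: inj_on_def)
    ultimately show ?thesis by (metis eq_iff_diff_eq_0 ext mult_eq_0_iff)
  qed
  moreover have "a j = 0" using rel[of 1] zero insert.prems(3) by simp
  ultimately show ?case using insert.prems(5) by blast
qed simp

section \<open>The cyclic covering of the line\<close>

lemma cyclic_subgroup_generator: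
  assumes sub: "subgroup H (aut_group c)" and cyc: "cyclic_group (aut_group c \<lparr>carrier := H\<rparr>)"
    and card: "card H = n" "n > 0"
  shows "\<exists>h\<in>H. h ^^ n = id \<and> H = (\<lambda>i. h ^^ i) ` {..<n}"
proof -
  let ?H = "aut_group c \<lparr>carrier := H\<rparr>"
  interpret H: group ?H
    by (rule subgroup.subgroup_is_group[OF sub group_aut_group])
  obtain h where h: "h \<in> H" and gen: "H = range (\<lambda>k::int. h [^]\<^bsub>?H\<^esub> k)"
    using cyc unfolding H.cyclic_group by auto
  have pow: "h [^]\<^bsub>?H\<^esub> (i::nat) = h ^^ i" for i
    by (induction i) (simp_all add: aut_group_def funpow_swap1 fun_eq_iff)
  have one: "h [^]\<^bsub>?H\<^esub> n = \<one>\<^bsub>?H\<^esub>"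
  proof -
    have "Coset.order ?H = n" using card by (simp add: Coset.order_def)
    moreover have "h [^]\<^bsub>?H\<^esub> Coset.order ?H = \<one>\<^bsub>?H\<^esub>"
      by (rule H.pow_order_eq_1) (use h in simp)
    ultimately show ?thesis by simp
  qed
  have "h [^]\<^bsub>?H\<^esub> k = h ^^ nat (k mod int n)" for k :: int
  proof -
    have "h [^]\<^bsub>?H\<^esub> k = h [^]\<^bsub>?H\<^esub> (int n * (k div int n) + int (nat (k mod int n)))"
      using card(2) by simp
    also have "\<dots> = (h [^]\<^bsub>?H\<^esub> int n) [^]\<^bsub>?H\<^esub> (k div int n) \<otimes>\<^bsub>?H\<^esub> h [^]\<^bsub>?H\<^esub> int (nat (k mod int n))"
      using h by (simp add: H.int_pow_mult H.int_pow_pow)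
    also have "h [^]\<^bsub>?H\<^esub> int n = \<one>\<^bsub>?H\<^esub>" using one by (simp add: int_pow_int)
    also have "\<one>\<^bsub>?H\<^esub> [^]\<^bsub>?H\<^esub> (k div int n) \<otimes>\<^bsub>?H\<^esub> h [^]\<^bsub>?H\<^esub> int (nat (k mod int n))
        = h [^]\<^bsub>?H\<^esub> int (nat (k mod int n))"
      unfolding H.int_pow_one by (rule H.l_one, rule H.int_pow_closed) (use h in simp)
    also have "\<dots> = h ^^ nat (k mod int n)" by (simp only: int_pow_int pow)
    finally show ?thesis .
  qed
  moreover have "nat (k mod int n) < n" for k
    using card(2) by (simp add: nat_less_iff)
  ultimately have "H \<subseteq> (\<lambda>i. h ^^ i) ` {..<n}"
    by (subst gen) (auto intro!: image_eqI)
  moreover have "h ^^ i \<in> H" for i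
    using H.nat_pow_closed[of h i] h by (simp add: pow)
  moreover have "h ^^ n = id" using one unfolding pow by (simp add: aut_group_def)
  ultimately show ?thesis using h by blast
qed

locale superelliptic = field_over_C c for c :: "complex \<Rightarrow> 'k::field" +
  fixes n :: nat and H :: "('k \<Rightarrow> 'k) set" and h :: "'k \<Rightarrow> 'k"
  assumes superelliptic: "superelliptic_curve c n H"
    and h_order: "h ^^ n = id"
    and H_eq: "H = (\<lambda>i. h ^^ i) ` {..<n}"
begin

abbreviation F where "F \<equiv> fixed_field H"

lemma n_ge_2: "n \<ge> 2" and card_H: "card H = n" and H_subgroup: "subgroup H (aut_group c)"
  and central: "\<tau> \<in> H \<Longrightarrow> \<sigma> \<in> Aut \<Longrightarrow> \<tau> (\<sigma> z) = \<sigma> (\<tau> z)"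
  and function_field: "function_field_of_curve c"
  using superelliptic unfolding superelliptic_curve_def by (auto simp: fun_eq_iff)

lemma h_power_in_H: "i < n \<Longrightarrow> h ^^ i \<in> H"
  by (auto simp: H_eq)

lemma h_in_H: "h \<in> H"
  using h_power_in_H[of 1] n_ge_2 by simp

lemma H_subset_Aut: "H \<subseteq> Aut"
  using H_subgroup by (rule subgroup.subset)

lemma h_aut: "h \<in> Aut"
  using h_in_H H_subset_Aut by blast

lemma inj_h_power: "inj_on (\<lambda>i. h ^^ i) {..<n}"
  using card_H H_eq by (intro eq_card_imp_inj_on) auto

lemma F_iff: "z \<in> F \<longleftrightarrow> h z = z"
proof
  assume "h z = z"
  then have "(h ^^ i) z = z" for i by (induction i) auto
  then show "z \<in> F" by (auto simp: fixed_field_def H_eq)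
qed (use h_in_H in \<open>auto simp: fixed_field_def\<close>)

lemma F_intermediate: "intermediate_field c F"
  using intermediate_field_agree[OF h_aut aut_id] by (simp add: F_iff Collect_mem_eq flip: F_iff)

lemma aut_F: "\<sigma> \<in> Aut \<Longrightarrow> \<sigma> z \<in> F \<longleftrightarrow> z \<in> F"
  using central[OF h_in_H, of \<sigma> z] aut_eq_iff[of \<sigma> "h z" z] by (simp add: F_iff)

end

sublocale superelliptic \<subseteq> subfield_of_curve c "fixed_field H"
  by unfold_locales (rule F_intermediate, rule function_field)

context superelliptic
begin

definition \<zeta> :: complex where "\<zeta> = cis (2 * pi / real n)"

lemma zeta_power: "\<zeta> ^ i = cis (2 * pi * real i / real n)"
  by (simp add: \<zeta>_def DeMoivre mult_ac)

lemma zeta_power_n [simp]: "\<zeta> ^ n = 1"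
  using n_ge_2 by (simp add: zeta_power)

lemma zeta_ne_0 [simp]: "\<zeta> \<noteq> 0"
  by (simp add: \<zeta>_def cis_neq_zero)

lemma root_of_unity_iff: "b ^ n = 1 \<longleftrightarrow> (\<exists>i<n. b = \<zeta> ^ i)"
proof
  assume "b ^ n = 1"
  then show "\<exists>i<n. b = \<zeta> ^ i"
    using bij_betw_roots_unity[of n] n_ge_2 by (fastforce simp: bij_betw_def zeta_power)
next
  assume "\<exists>i<n. b = \<zeta> ^ i"
  then show "b ^ n = 1" by (metis mult.commute power_mult power_one zeta_power_n)
qed

lemma zeta_primitive:
  assumes "0 < i" "i < n"
  shows "\<zeta> ^ i \<noteq> 1"
proof
  assume "\<zeta> ^ i = 1"
  then have "cis (2 * pi * real i / real n) = cis (2 * pi * real 0 / real n)"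
    by (simp add: zeta_power)
  then have "i = 0"
    using bij_betw_roots_unity[of n] assms n_ge_2 unfolding bij_betw_def inj_on_def
    by (metis gr_implies_not0 lessThan_iff not_gr_zero)
  with assms show False by simp
qed

text \<open>Such an element \<open>y\<close> generates the function field over \<open>F\<close>, and \<open>y\<^sup>n\<close> lies in \<open>F\<close>.\<close>

definition kummer :: "'k \<Rightarrow> bool" where
  "kummer y \<longleftrightarrow> y \<noteq> 0 \<and> h y = c \<zeta> * y"

text \<open>Applying \<open>h\<close> shifts the terms of a Lagrange resolvent cyclically.\<close>

lemma resolvent_eigenvector:
  assumes "b ^ n = 1" "b \<noteq> 0"
  shows "h (\<Sum>i<n. c (b ^ i) * (h ^^ i) z) = c (inverse b) * (\<Sum>i<n. c (b ^ i) * (h ^^ i) z)"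
proof -
  define g where "g i = c (b ^ i) * (h ^^ i) z" for i
  have "g n = g 0" by (simp add: g_def assms h_order)
  then have shift: "(\<Sum>i<n. g (Suc i)) = (\<Sum>i<n. g i)"
    using sum.lessThan_Suc_shift[of g n] sum.lessThan_Suc[of g n] by simp
  have "h (g i) = c (inverse b) * g (Suc i)" for i
  proof -
    have "h (g i) = c (b ^ i) * (h ^^ Suc i) z"
      using h_aut by (simp add: g_def aut_mult aut_const)
    also have "c (b ^ i) = c (inverse b * b ^ Suc i)" using assms(2) by simp
    finally show ?thesis by (simp only: g_def c_mult mult.assoc)
  qed
  then have "h (\<Sum>i<n. g i) = c (inverse b) * (\<Sum>i<n. g (Suc i))"
    using h_aut by (simp add: aut_sum sum_distrib_left)
  then show ?thesis by (simp only: shift) (simp add: g_def)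
qed

lemma kummer_exists: "\<exists>y. kummer y"
proof -
  define b where "b = inverse \<zeta>"
  have b: "b ^ n = 1" "b \<noteq> 0" by (simp_all add: b_def power_inverse)
  have "\<exists>z. (\<Sum>i<n. c (b ^ i) * (h ^^ i) z) \<noteq> 0"
  proof (rule ccontr)
    assume "\<not> ?thesis"
    then have zero: "\<And>z. (\<Sum>i<n. c (b ^ i) * (h ^^ i) z) = 0" by blast
    have "c (b ^ 0) = 0"
      by (rule characters_independent[of "{..<n}" "\<lambda>i. h ^^ i" "\<lambda>i. c (b ^ i)"])
        (use zero inj_h_power n_ge_2 aut_funpow[OF h_aut] in \<open>auto simp: aut_mult aut_1\<close>)
    then show False by simp
  qed
  then obtain z where "(\<Sum>i<n. c (b ^ i) * (h ^^ i) z) \<noteq> 0" by blast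
  then show ?thesis unfolding kummer_def
    using resolvent_eigenvector[OF b] by (metis b_def inverse_inverse_eq)
qed

lemma kummer_ne_0: "kummer y \<Longrightarrow> y \<noteq> 0"
  and h_kummer: "kummer y \<Longrightarrow> h y = c \<zeta> * y"
  by (simp_all add: kummer_def)

lemma kummer_power: "kummer y \<Longrightarrow> y ^ n \<in> F"
  using h_aut by (simp add: F_iff aut_power h_kummer power_mult_distrib flip: c_power)

lemma kummer_mult: "kummer y \<Longrightarrow> s \<in> F \<Longrightarrow> s \<noteq> 0 \<Longrightarrow> kummer (s * y)"
  using h_aut by (simp add: kummer_def F_iff aut_mult)

text \<open>The function field is the sum of the eigenspaces of \<open>h\<close>, and dividing by a power of \<open>y\<close> moves
  each eigenspace into \<open>F\<close>.\<close>

lemma kummer_generates: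
  assumes y: "kummer y" and M: "intermediate_field c M" "F \<subseteq> M" "y \<in> M"
  shows "M = UNIV"
proof -
  interpret M: subfield_over_C c M by unfold_locales (rule M(1))
  have "z \<in> M" for z
  proof -
    define b where "b = inverse \<zeta>"
    have b: "b ^ n = 1" "b \<noteq> 0" by (simp_all add: b_def power_inverse)
    define e where "e j = (\<Sum>i<n. c ((b ^ j) ^ i) * (h ^^ i) z)" for j
    have "e j / y ^ j \<in> F" for j
    proof -
      have "(b ^ j) ^ n = 1" "b ^ j \<noteq> 0"
        using b by (simp_all flip: power_mult) (metis mult.commute power_mult power_one b(1))
      then have "h (e j) = c (inverse (b ^ j)) * e j"
        unfolding e_def by (rule resolvent_eigenvector)
      also have "inverse (b ^ j) = \<zeta> ^ j" by (simp add: b_def power_inverse)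
      finally have "h (e j) = c \<zeta> ^ j * e j" by (simp add: c_power)
      then show ?thesis
        using h_aut by (simp add: F_iff aut_divide aut_power h_kummer[OF y] power_mult_distrib)
    qed
    then have "e j / y ^ j * y ^ j \<in> M" for j using M by (intro M.F_mult M.F_power) auto
    then have e: "e j \<in> M" for j using kummer_ne_0[OF y] by simp
    \<comment> \<open>Orthogonality of the powers of \<open>b\<close> recovers \<open>n z\<close> as the sum of the components.\<close>
    have orth: "(\<Sum>j<n. (b ^ j) ^ i) = (if i = 0 then of_nat n else 0)" if "i < n" for i
    proof (cases "i = 0")
      case False
      have "b ^ i \<noteq> 1" using zeta_primitive[of i] False that by (simp add: b_def power_inverse)
      then have "(\<Sum>j<n. (b ^ i) ^ j) = ((b ^ i) ^ n - 1) / (b ^ i - 1)"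
        by (rule geometric_sum)
      also have "(b ^ i) ^ n = 1" using b(1) by (metis mult.commute power_mult power_one)
      finally show ?thesis using False by (simp add: mult.commute flip: power_mult)
    qed simp
    have "(\<Sum>j<n. e j) = (\<Sum>i<n. \<Sum>j<n. c ((b ^ j) ^ i) * (h ^^ i) z)"
      unfolding e_def by (rule sum.swap)
    also have "\<dots> = (\<Sum>i<n. c (\<Sum>j<n. (b ^ j) ^ i) * (h ^^ i) z)"
    proof -
      have "c (\<Sum>j\<in>J. f j) = (\<Sum>j\<in>J. c (f j))" for J :: "nat set" and f
        by (induction J rule: infinite_finite_induct) (simp_all add: c_add)
      then show ?thesis by (simp add: sum_distrib_right)
    qed
    also have "\<dots> = (\<Sum>i<n. if i = 0 then of_nat n * z else 0)"
      using orth by (intro sum.cong) (auto simp: c_of_nat)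
    also have "\<dots> = of_nat n * z" using n_ge_2 by (simp add: sum.delta)
    finally have "of_nat n * z \<in> M" using M.F_sum[of "{..<n}" e] e by simp
    then have "c (inverse (of_nat n)) * (of_nat n * z) \<in> M" by (rule M.F_mult[OF M.F_const])
    moreover have "c (inverse (of_nat n)) * (of_nat n * z) = z"
      unfolding c_inverse c_of_nat mult.assoc[symmetric] using n_ge_2 by simp
    ultimately show ?thesis by simp
  qed
  then show ?thesis by blast
qed

lemma root_of_one_constant:
  assumes "z ^ n = 1"
  shows "\<exists>i<n. z = c (\<zeta> ^ i)"
proof -
  have "z \<in> range c"
    using power_constant_imp_constant[of z n] assms n_ge_2 by (metis c_one le0 not_numeral_le_zero not_gr_zero rangeI)
  then obtain b where b: "z = c b" by blast
  with assms have "c (b ^ n) = c 1" by (simp add: c_power)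
  then have "b ^ n = 1" by (simp only: c_eq_iff)
  then show ?thesis using root_of_unity_iff[of b] b by auto
qed

text \<open>Because \<open>\<sigma>\<close> commutes with \<open>h\<close>, it preserves the eigenspaces of \<open>h\<close>, and these are
  one-dimensional over \<open>F\<close>.\<close>

lemma aut_kummer:
  assumes "kummer y" "\<sigma> \<in> Aut"
  shows "\<sigma> y / y \<in> F"
proof -
  have "h (\<sigma> y) = c \<zeta> * \<sigma> y"
    using central[OF h_in_H assms(2)] assms by (simp add: h_kummer aut_mult aut_const)
  then show ?thesis using h_aut assms kummer_ne_0[OF assms(1)]
    by (simp add: F_iff aut_divide h_kummer)
qed

text \<open>An automorphism over \<open>F\<close> preserves \<open>y\<^sup>n\<close>, so it multiplies \<open>y\<close> by a root of unity, as some
  power of \<open>h\<close> does.\<close>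

lemma trivial_on_F_imp_H:
  assumes \<sigma>: "\<sigma> \<in> Aut" and triv: "\<And>z. z \<in> F \<Longrightarrow> \<sigma> z = z"
  shows "\<sigma> \<in> H"
proof -
  obtain y where y: "kummer y" using kummer_exists by blast
  have "(\<sigma> y / y) ^ n = 1"
    using triv[OF kummer_power[OF y]] \<sigma> kummer_ne_0[OF y] by (simp add: aut_power power_divide)
  then obtain i where i: "i < n" "\<sigma> y / y = c (\<zeta> ^ i)" using root_of_one_constant by blast
  have hy: "(h ^^ j) y = c (\<zeta> ^ j) * y" for j
    by (induction j) (use h_aut in \<open>simp_all add: aut_mult aut_const h_kummer[OF y] c_mult\<close>)
  have hF: "(h ^^ j) z = z" if "z \<in> F" for z j
    using that by (induction j) (auto simp: F_iff)
  have "{z. \<sigma> z = (h ^^ i) z} = UNIV"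
    by (rule kummer_generates[OF y intermediate_field_agree[OF \<sigma> aut_funpow[OF h_aut]]])
      (use i hy hF triv kummer_ne_0[OF y] in \<open>auto simp: field_simps\<close>)
  then have "\<sigma> = h ^^ i" by auto
  with i(1) h_power_in_H show ?thesis by simp
qed

text \<open>If \<open>F\<close> were \<open>\<complex>\<close>, then \<open>y\<close> would be algebraic over \<open>\<complex>\<close>, hence a constant, which \<open>h\<close> fixes.\<close>

lemma F_nonconstant: "F \<noteq> range c"
proof
  assume F: "F = range c"
  obtain y where y: "kummer y" using kummer_exists by blast
  have "y \<in> range c"
    using power_constant_imp_constant[of y n] kummer_power[OF y] n_ge_2 by (simp add: F)
  then have "y \<in> F" unfolding F .
  then have "h y = y" by (simp only: F_iff)
  then have "c \<zeta> = c 1" using h_kummer[OF y] kummer_ne_0[OF y] by simp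
  then have "\<zeta> = 1" by (simp only: c_eq_iff)
  then show False using zeta_primitive[of 1] n_ge_2 by simp
qed

end

sublocale superelliptic \<subseteq> genus_zero_field c "fixed_field H"
proof unfold_locales
  show "has_genus c F 0" using superelliptic by (simp add: superelliptic_curve_def)
qed (rule F_nonconstant)

context superelliptic
begin

text \<open>If the curve were itself a line on which \<open>h\<close> acts by \<open>w \<mapsto> a w\<close>, then \<open>h\<close> would not commute
  with the translation \<open>w \<mapsto> w + 1\<close>.  In this way the centrality of \<open>H\<close> excludes
  coverings with only two branch points.\<close>

lemma not_scaling_of_line:
  assumes gen: "UNIV = adjoin c {w}" and hw: "h w = c a * w"
  shows False
proof -
  have "w \<notin> range c"
  proof
    assume "w \<in> range c"
    moreover have "intermediate_field c (range c)"
      by (auto simp: intermediate_field_def simp flip: c_add c_mult c_minus c_inverse)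
    ultimately have "UNIV = range c" using adjoin_minimal[of "range c" "{w}"] gen by auto
    moreover have "range c \<subseteq> F" by auto
    ultimately show False using F_nonconstant by blast
  qed
  then obtain \<sigma> where \<sigma>: "\<sigma> \<in> Aut" "\<sigma> w = w + 1"
    using translation_automorphism gen by blast
  have "\<sigma> (h w) = c a * w + c a" using \<sigma> by (simp add: hw aut_mult aut_const distrib_left)
  moreover have "h (\<sigma> w) = c a * w + 1" using \<sigma> h_aut by (simp add: hw aut_add aut_1)
  ultimately have "c a = c 1" using central[OF h_in_H \<sigma>(1), of w] by simp
  then have "h w = w" by (simp add: hw)
  then have "h z = id z" for z
    using aut_agree_adjoin[OF h_aut aut_id, of "{w}" z] gen by auto
  then have "F = UNIV" by (auto simp: F_iff)
  moreover obtain y where "kummer y" using kummer_exists by blast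
  ultimately have "c \<zeta> * y = y" "y \<noteq> 0" using F_iff h_kummer kummer_ne_0 by auto
  then have "c \<zeta> = c 1" by simp
  then have "\<zeta> = 1" by (simp only: c_eq_iff)
  then show False using zeta_primitive[of 1] n_ge_2 by simp
qed

end

section \<open>Finite groups acting with at most two fixed points\<close>

text \<open>The action is on the right because automorphisms of a field act on its valuations by
  composition, \<open>v \<mapsto> v \<circ> \<sigma>\<close>.\<close>

locale finite_right_action = group G for G (structure) +
  fixes X :: "'p set" and act :: "'p \<Rightarrow> 'a \<Rightarrow> 'p"
  assumes finite_G: "finite (carrier G)"
    and act_closed: "p \<in> X \<Longrightarrow> g \<in> carrier G \<Longrightarrow> act p g \<in> X"
    and act_one: "p \<in> X \<Longrightarrow> act p \<one> = p"
    and act_mult: "p \<in> X \<Longrightarrow> g \<in> carrier G \<Longrightarrow> k \<in> carrier G \<Longrightarrow> act p (g \<otimes> k) = act (act p g) k"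
begin

definition act_kernel where "act_kernel = {g \<in> carrier G. \<forall>p\<in>X. act p g = p}"
definition stab where "stab p = {g \<in> carrier G. act p g = p}"
definition orb where "orb p = act p ` carrier G"

lemma act_inv: "p \<in> X \<Longrightarrow> g \<in> carrier G \<Longrightarrow> act (act p g) (inv g) = p"
  using act_mult[of p g "inv g"] by (simp add: act_one)

lemma act_inv': "p \<in> X \<Longrightarrow> g \<in> carrier G \<Longrightarrow> act (act p (inv g)) g = p"
  using act_mult[of p "inv g" g] by (simp add: act_one)

lemma act_eq_iff: "p \<in> X \<Longrightarrow> q \<in> X \<Longrightarrow> g \<in> carrier G \<Longrightarrow> act p g = act q g \<longleftrightarrow> p = q"
  by (metis act_inv)

lemma kernel_subset_stab: "p \<in> X \<Longrightarrow> act_kernel \<subseteq> stab p"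
  by (auto simp: act_kernel_def stab_def)

lemma finite_stab: "finite (stab p)" and finite_kernel: "finite act_kernel"
  using finite_G by (auto simp: stab_def act_kernel_def)

lemma one_in_kernel: "\<one> \<in> act_kernel"
  by (simp add: act_kernel_def act_one)

lemma card_kernel_pos: "card act_kernel > 0"
  using one_in_kernel finite_kernel by (metis card_gt_0_iff empty_iff)

lemma orb_subset: "p \<in> X \<Longrightarrow> orb p \<subseteq> X"
  by (auto simp: orb_def act_closed)

lemma self_in_orb: "p \<in> X \<Longrightarrow> p \<in> orb p"
  unfolding orb_def by (rule image_eqI[of _ _ \<one>]) (simp_all add: act_one)

lemma orb_eq:
  assumes "p \<in> X" "q \<in> orb p"
  shows "orb q = orb p"
proof -
  obtain k where k: "k \<in> carrier G" "q = act p k" using assms(2) by (auto simp: orb_def)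
  have "act q g = act p (k \<otimes> g)" if "g \<in> carrier G" for g
    using that k assms(1) by (simp add: act_mult)
  then have "orb q \<subseteq> orb p" using k(1) by (auto simp: orb_def)
  moreover have "act p g = act q (inv k \<otimes> g)" if "g \<in> carrier G" for g
    using that k assms(1) by (simp add: act_mult act_closed act_inv)
  then have "orb p \<subseteq> orb q" using k(1) by (auto simp: orb_def)
  ultimately show ?thesis by blast
qed

lemma stab_conj_iff:
  assumes "p \<in> X" "k \<in> carrier G" "g \<in> carrier G"
  shows "g \<in> stab (act p k) \<longleftrightarrow> k \<otimes> g \<otimes> inv k \<in> stab p"
proof -
  have "act p (k \<otimes> g \<otimes> inv k) = act (act (act p k) g) (inv k)"
    using assms by (simp add: act_mult act_closed)
  moreover have "act (act (act p k) g) (inv k) = p \<longleftrightarrow> act (act p k) g = act p k"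
    using assms act_inv act_inv' act_closed by (metis inv_closed)
  ultimately show ?thesis using assms by (auto simp: stab_def)
qed

lemma card_stab_act:
  assumes "p \<in> X" "k \<in> carrier G"
  shows "card (stab (act p k)) = card (stab p)"
proof -
  have le: "card (stab (act p k)) \<le> card (stab p)" if "p \<in> X" "k \<in> carrier G" for p k
  proof (rule card_inj_on_le[of "\<lambda>g. k \<otimes> g \<otimes> inv k"])
    show "inj_on (\<lambda>g. k \<otimes> g \<otimes> inv k) (stab (act p k))"
      using that by (auto simp: inj_on_def stab_def)
    show "(\<lambda>g. k \<otimes> g \<otimes> inv k) ` stab (act p k) \<subseteq> stab p"
      using stab_conj_iff[OF that] by (auto simp: stab_def)
  qed (rule finite_stab)
  show ?thesis
    using le[OF assms] le[of "act p k" "inv k"] assms by (simp add: act_inv act_closed)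
qed

lemma orbit_stabilizer:
  assumes p: "p \<in> X"
  shows "card (orb p) * card (stab p) = card (carrier G)"
proof -
  have card: "card {g \<in> carrier G. act p g = q} = card (stab p)" if q: "q \<in> orb p" for q
  proof -
    obtain k where k: "k \<in> carrier G" "q = act p k" using q by (auto simp: orb_def)
    have "bij_betw (\<lambda>g. g \<otimes> k) (stab p) {g \<in> carrier G. act p g = q}"
    proof (rule bij_betw_byWitness[of _ "\<lambda>g. g \<otimes> inv k"])
      show "(\<lambda>g. g \<otimes> k) ` stab p \<subseteq> {g \<in> carrier G. act p g = q}"
        using k p by (auto simp: stab_def act_mult)
      show "(\<lambda>g. g \<otimes> inv k) ` {g \<in> carrier G. act p g = q} \<subseteq> stab p"
        using k p by (auto simp: stab_def act_mult act_inv)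
    qed (use k in \<open>auto simp: stab_def m_assoc\<close>)
    then show ?thesis by (simp add: bij_betw_same_card)
  qed
  have "carrier G = (\<Union>q\<in>orb p. {g \<in> carrier G. act p g = q})" by (auto simp: orb_def)
  then have "card (carrier G) = card (\<Union>q\<in>orb p. {g \<in> carrier G. act p g = q})" by simp
  also have "\<dots> = (\<Sum>q\<in>orb p. card {g \<in> carrier G. act p g = q})"
    using finite_G by (intro card_UN_disjoint) (auto simp: orb_def)
  also have "\<dots> = card (orb p) * card (stab p)" using card by simp
  finally show ?thesis by simp
qed

text \<open>A stabiliser that is larger than the kernel contains a second coset of it.\<close>

lemma twice_kernel_le_stab:
  assumes p: "p \<in> X" and g: "g \<in> stab p" "g \<notin> act_kernel"
  shows "2 * card act_kernel \<le> card (stab p)"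
proof -
  have gG: "g \<in> carrier G" using g by (simp add: stab_def)
  have "g \<otimes> m \<notin> act_kernel" if m: "m \<in> act_kernel" for m
  proof
    assume gm: "g \<otimes> m \<in> act_kernel"
    have mG: "m \<in> carrier G" using m by (simp add: act_kernel_def)
    have "act q g = q" if "q \<in> X" for q
    proof -
      have "act (act q g) m = act q (g \<otimes> m)" using that gG mG by (simp add: act_mult)
      also have "\<dots> = q" using gm that by (simp add: act_kernel_def)
      also have "act (act q g) m = act q g" using m that gG by (simp add: act_kernel_def act_closed)
      finally show ?thesis .
    qed
    with g(2) gG show False by (simp add: act_kernel_def)
  qed
  then have disj: "act_kernel \<inter> (\<lambda>m. g \<otimes> m) ` act_kernel = {}" by blast
  have "card ((\<lambda>m. g \<otimes> m) ` act_kernel) = card act_kernel"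
    using gG by (intro card_image) (auto simp: inj_on_def act_kernel_def)
  then have "2 * card act_kernel = card (act_kernel \<union> (\<lambda>m. g \<otimes> m) ` act_kernel)"
    using disj finite_kernel by (simp add: card_Un_disjoint)
  also have "\<dots> \<le> card (stab p)"
    using g p by (intro card_mono finite_stab) (auto simp: stab_def act_kernel_def act_mult)
  finally show ?thesis .
qed

end

text \<open>The hypotheses are those satisfied by a finite group of Moebius transformations.  Suppose that no
  element exchanges two points.  If the stabiliser of \<open>p\<close> exceeds the kernel, then the elements
  outside the kernel that fix some point of the orbit of \<open>p\<close> form at least half of the group, and
  two orbits yield equal or disjoint sets.  So there is at most one such set, it consists of all
  elements outside the kernel, and counting it shows that the orbit is a point.\<close>

theorem (in finite_right_action) fixed_point_or_swap:
  assumes "X \<noteq> {}"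
    and fixed: "\<And>g. g \<in> carrier G \<Longrightarrow> \<exists>p\<in>X. act p g = p"
    and two: "\<And>g p q r. g \<in> carrier G \<Longrightarrow> p \<in> X \<Longrightarrow> q \<in> X \<Longrightarrow> r \<in> X \<Longrightarrow> p \<noteq> q \<Longrightarrow> p \<noteq> r \<Longrightarrow> q \<noteq> r \<Longrightarrow>
      act p g = p \<Longrightarrow> act q g = q \<Longrightarrow> act r g = r \<Longrightarrow> g \<in> act_kernel"
    and same: "\<And>g k p q. g \<in> carrier G \<Longrightarrow> k \<in> carrier G \<Longrightarrow> p \<in> X \<Longrightarrow> q \<in> X \<Longrightarrow> p \<noteq> q \<Longrightarrow> g \<notin> act_kernel \<Longrightarrow>
      act p g = p \<Longrightarrow> act q g = q \<Longrightarrow> act p k = p \<Longrightarrow> act q k = q"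
  shows "(\<exists>p\<in>X. \<forall>g\<in>carrier G. act p g = p) \<or>
    (\<exists>g\<in>carrier G. \<exists>p\<in>X. \<exists>q\<in>X. p \<noteq> q \<and> act p g = q \<and> act q g = p)"
proof (rule ccontr)
  assume neg: "\<not> ?thesis"
  then have no_swap: "\<And>g p q. g \<in> carrier G \<Longrightarrow> p \<in> X \<Longrightarrow> q \<in> X \<Longrightarrow> p \<noteq> q \<Longrightarrow> act p g = q \<Longrightarrow> act q g \<noteq> p"
    and no_fix: "\<And>p. p \<in> X \<Longrightarrow> \<exists>g\<in>carrier G. act p g \<noteq> p" by blast+
  define C where "C p = (\<Union>q\<in>orb p. stab q - act_kernel)" for p
  have same_stab: "stab p = stab q"
    if "p \<in> X" "q \<in> X" "g \<in> stab p" "g \<in> stab q" "g \<notin> act_kernel" for p q g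
  proof -
    have "stab p \<subseteq> stab q"
      if "p \<in> X" "q \<in> X" "g \<in> stab p" "g \<in> stab q" "g \<notin> act_kernel" for p q
      using same[of g _ p q] that unfolding stab_def by blast
    with that show ?thesis by blast
  qed
  \<comment> \<open>Two points of one orbit with a common stabiliser would be exchanged: if \<open>k\<close> maps \<open>p\<close> to \<open>q\<close>,
    then the stabiliser also fixes \<open>act q k\<close>, which must be \<open>p\<close>.\<close>
  have disj: "(stab p - act_kernel) \<inter> (stab q - act_kernel) = {}" if pq: "p \<in> X" "q \<in> orb p" "p \<noteq> q" for p q
  proof (rule ccontr)
    assume "\<not> ?thesis"
    then obtain g where g: "g \<in> stab p" "g \<in> stab q" "g \<notin> act_kernel" by blast
    have q: "q \<in> X" using pq orb_subset by blast
    obtain k where k: "k \<in> carrier G" "q = act p k" using pq(2) by (auto simp: orb_def)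
    have gG: "g \<in> carrier G" using g(1) by (simp add: stab_def)
    have "stab p = stab q" using same_stab pq(1) q g by blast
    moreover have "k \<otimes> g \<otimes> inv k \<in> stab p" using stab_conj_iff[OF pq(1) k(1) gG] g(2) k(2) by simp
    ultimately have "g \<in> stab (act q k)" using stab_conj_iff[OF q k(1) gG] by simp
    moreover have "act q k \<noteq> q" using pq(1,3) q k act_eq_iff by metis
    moreover have "act q k \<noteq> p" using no_swap[OF k(1) pq(1) q pq(3)] k(2) by simp
    ultimately show False
      using two[OF gG pq(1) q act_closed[OF q k(1)] pq(3)] g by (auto simp: stab_def)
  qed
  have card_C: "card (C p) = card (orb p) * (card (stab p) - card act_kernel)" if p: "p \<in> X" for p
  proof -
    have "card (C p) = (\<Sum>q\<in>orb p. card (stab q - act_kernel))"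
      unfolding C_def
    proof (rule card_UN_disjoint)
      show "\<forall>i\<in>orb p. \<forall>j\<in>orb p. i \<noteq> j \<longrightarrow> (stab i - act_kernel) \<inter> (stab j - act_kernel) = {}"
        using disj orb_eq[OF p] orb_subset[OF p] by blast
    qed (use finite_G finite_stab in \<open>auto simp: orb_def\<close>)
    also have "\<dots> = (\<Sum>q\<in>orb p. card (stab p) - card act_kernel)"
    proof (rule sum.cong[OF refl])
      fix q assume q: "q \<in> orb p"
      then have "card (stab q) = card (stab p)" using card_stab_act p by (auto simp: orb_def)
      moreover have "act_kernel \<subseteq> stab q" using kernel_subset_stab orb_subset[OF p] q by blast
      ultimately show "card (stab q - act_kernel) = card (stab p) - card act_kernel"
        using finite_kernel by (simp add: card_Diff_subset)
    qed
    finally show ?thesis by simp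
  qed
  have C_sub: "C p \<subseteq> carrier G - act_kernel" for p
    by (auto simp: C_def stab_def)
  have half: "card (carrier G) \<le> 2 * card (C p)" if "p \<in> X" "g \<in> stab p" "g \<notin> act_kernel" for p g
  proof -
    have "card (stab p) \<le> 2 * (card (stab p) - card act_kernel)"
      using twice_kernel_le_stab[OF that] by simp
    then have "card (orb p) * card (stab p) \<le> card (orb p) * (2 * (card (stab p) - card act_kernel))"
      by (rule mult_left_mono) simp
    then show ?thesis
      using orbit_stabilizer[OF that(1)] card_C[OF that(1)] by simp
  qed
  have C_eq: "C p = C q" if p: "p \<in> X" and q: "q \<in> X" and meet: "C p \<inter> C q \<noteq> {}" for p q
  proof -
    obtain g p' q' where g: "p' \<in> orb p" "q' \<in> orb q" "g \<in> stab p'" "g \<in> stab q'" "g \<notin> act_kernel"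
      using meet by (auto simp: C_def)
    have X: "p' \<in> X" "q' \<in> X" using g p q orb_subset by blast+
    have st: "stab p' = stab q'" using same_stab X g by blast
    have "stab (act p' k) = stab (act q' k)" if "k \<in> carrier G" for k
      using stab_conj_iff[OF X(1) that] stab_conj_iff[OF X(2) that] st by (auto simp: stab_def)
    then have "C p' = C q'" by (simp add: C_def orb_def)
    then show ?thesis using orb_eq[OF p g(1)] orb_eq[OF q g(2)] by (simp add: C_def)
  qed
  obtain g where g: "g \<in> carrier G" "g \<notin> act_kernel"
    using no_fix \<open>X \<noteq> {}\<close> by (fastforce simp: act_kernel_def)
  obtain p where p: "p \<in> X" "g \<in> stab p" using fixed[OF g(1)] g(1) by (auto simp: stab_def)
  have "carrier G - act_kernel \<subseteq> C p"
  proof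
    fix k assume k: "k \<in> carrier G - act_kernel"
    then obtain q where q: "q \<in> X" "k \<in> stab q" using fixed[of k] by (auto simp: stab_def)
    then have kC: "k \<in> C q" using k self_in_orb by (auto simp: C_def)
    show "k \<in> C p"
    proof (rule ccontr)
      assume "k \<notin> C p"
      then have "C p \<inter> C q = {}" using C_eq[OF p(1) q(1)] kC by blast
      then have "card (C p) + card (C q) = card (C p \<union> C q)"
        using C_sub finite_G by (intro card_Un_disjoint[symmetric]) (auto intro: finite_subset)
      also have "\<dots> \<le> card (carrier G - act_kernel)"
        using C_sub finite_G by (intro card_mono) auto
      also have "\<dots> < card (carrier G)"
        using one_in_kernel finite_G by (intro psubset_card_mono) auto
      finally show False using half[OF p g(2)] half[OF q] k by simp
    qed
  qed
  with C_sub have "C p = carrier G - act_kernel" by blast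
  then have "card (C p) = card (carrier G) - card act_kernel"
    using finite_kernel by (simp add: card_Diff_subset act_kernel_def)
  \<comment> \<open>With orbit size \<open>m\<close>, stabiliser order \<open>t\<close> and kernel order \<open>r\<close>: \<open>m (t - r) = m t - r\<close>,
    so \<open>m = 1\<close>.\<close>
  then have "card (orb p) * (card (stab p) - card act_kernel) = card (orb p) * card (stab p) - card act_kernel"
    using card_C[OF p(1)] orbit_stabilizer[OF p(1)] by simp
  moreover have "card act_kernel \<le> card (stab p)"
    using kernel_subset_stab[OF p(1)] finite_stab by (intro card_mono)
  moreover have "card (orb p) > 0"
    using self_in_orb[OF p(1)] finite_G by (auto simp: card_gt_0_iff orb_def)
  ultimately have "card (orb p) * card act_kernel = card act_kernel"
    using card_kernel_pos
    by (smt (verit) diff_diff_cancel diff_mult_distrib2 le_trans mult_le_mono2 nat_mult_1 Suc_leI One_nat_def mult.commute)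
  then have "card (orb p) = 1" using card_kernel_pos by simp
  then obtain q where "orb p = {q}" by (auto simp: card_1_singleton_iff)
  then have "orb p = {p}" using self_in_orb[OF p(1)] by auto
  then have "\<forall>g\<in>carrier G. act p g = p" by (auto simp: orb_def)
  with no_fix p(1) show False by blast
qed

section \<open>The automorphism group on the places of the line\<close>

context genus_zero_field
begin

lemma coordinate_affine:
  assumes x: "coordinate x P" and a: "a \<noteq> 0"
  shows "coordinate (c a * x + c b) P"
proof -
  note xD = coordinateD[OF x]
  have "P (c a * x + c b) = - 1"
    using pole_poly_at[OF x, of "[:b, a:]"] a by (simp add: add.commute mult.commute)
  moreover have "c a * x + c b \<noteq> 0"
    using poly_at_eq_0_iff[OF xD(6), of "[:b, a:]"] a by (simp add: add.commute mult.commute)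
  moreover have "ord_ge v 0 (c a * x + c b)" if "v \<in> places c F" "v \<noteq> P" for v
    using that xD by (intro ord_ge_add ord_ge_const_mult ord_ge_const) auto
  ultimately show ?thesis using xD(1,2) by (simp add: coordinate_def)
qed

lemma coordinate_with_zero:
  assumes "P \<in> places c F" "Q \<in> places c F" "P \<noteq> Q"
  shows "\<exists>x. coordinate x P \<and> ord_ge Q 1 x"
proof -
  obtain x where x: "coordinate x P" using coordinate_exists assms by blast
  obtain a where a: "ord_ge Q 1 (x - c a)" using coordinate_value[OF x] assms by blast
  have "coordinate (c 1 * x + c (- a)) P" by (rule coordinate_affine[OF x]) simp
  with a show ?thesis by (intro exI[of _ "x - c a"]) (simp add: c_minus)
qed

lemma place_at_0:
  assumes x: "coordinate x P" and v: "v \<in> places c F" "ord_ge v 1 x"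
  shows "v x = 1"
  using place_local_parameter[OF x, of v 0] v by simp

end

context superelliptic
begin

lemma place_comp:
  assumes v: "v \<in> places c F" and \<sigma>: "\<sigma> \<in> Aut"
  shows "v \<circ> \<sigma> \<in> places c F"
proof -
  obtain \<tau> where \<tau>: "\<tau> \<in> Aut" "\<sigma> \<circ> \<tau> = id" using aut_inverse_exists[OF \<sigma>] by blast
  obtain t where t: "t \<in> F" "t \<noteq> 0" "v t = 1" using place_uniformizer[OF v] by blast
  have "\<sigma> (\<tau> t) = t" using \<tau>(2) by (metis comp_apply id_apply)
  then have "\<exists>t\<in>F - {0}. (v \<circ> \<sigma>) t = 1"
    using t \<tau> aut_F[OF \<tau>(1)] aut_eq_0_iff[OF \<tau>(1)] by (intro bexI[of _ "\<tau> t"]) auto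
  moreover have "\<sigma> y \<in> F - {0} \<longleftrightarrow> y \<in> F - {0}" for y
    using aut_F[OF \<sigma>] aut_eq_0_iff[OF \<sigma>] by auto
  moreover have "v (\<sigma> y * \<sigma> z) = v (\<sigma> y) + v (\<sigma> z)" if "y \<in> F - {0}" "z \<in> F - {0}" for y z
    using that aut_F[OF \<sigma>] aut_eq_0_iff[OF \<sigma>] by (intro place_mult[OF v]) auto
  moreover have "min (v (\<sigma> y)) (v (\<sigma> z)) \<le> v (\<sigma> y + \<sigma> z)"
    if "y \<in> F - {0}" "z \<in> F - {0}" "y + z \<noteq> 0" for y z
    using that aut_F[OF \<sigma>] aut_eq_0_iff[OF \<sigma>] aut_eq_0_iff[OF \<sigma>, of "y + z"] aut_add[OF \<sigma>]
    by (intro place_add_ge[OF v]) auto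
  moreover have "(v \<circ> \<sigma>) z = 0" if "z \<notin> F - {0}" for z
    using that place_outside[OF v, of "\<sigma> z"] aut_F[OF \<sigma>] aut_eq_0_iff[OF \<sigma>] by simp
  moreover have "(v \<circ> \<sigma>) (c a) = 0" for a
    using place_const[OF v] aut_const[OF \<sigma>] by simp
  ultimately show ?thesis
    unfolding places_def mem_Collect_eq
    by (intro conjI allI ballI impI) (simp_all add: aut_mult[OF \<sigma>] aut_add[OF \<sigma>])
qed

lemma ord_ge_comp: "\<sigma> \<in> Aut \<Longrightarrow> ord_ge (v \<circ> \<sigma>) k z \<longleftrightarrow> ord_ge v k (\<sigma> z)"
  using aut_eq_0_iff[of \<sigma> z] by (simp add: ord_ge_def)

lemma comp_aut_cancel:
  assumes "\<sigma> \<in> Aut" "v \<circ> \<sigma> = w \<circ> \<sigma>"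
  shows "v = w"
proof
  fix z
  obtain u where "z = \<sigma> u" using aut_bij[OF assms(1)] by (metis bij_pointE)
  then show "v z = w z" using fun_cong[OF assms(2), of u] by simp
qed

lemma aut_eq_const_iff: "\<sigma> \<in> Aut \<Longrightarrow> \<sigma> z = c a \<longleftrightarrow> z = c a"
  by (metis aut_const aut_eq_iff)

lemma trivial_on_F_imp_fixes:
  assumes "\<sigma> \<in> Aut" "\<And>z. z \<in> F \<Longrightarrow> \<sigma> z = z" "v \<in> places c F"
  shows "v \<circ> \<sigma> = v"
proof
  fix z
  show "(v \<circ> \<sigma>) z = v z"
  proof (cases "z \<in> F")
    case False
    then have "\<sigma> z \<notin> F" using aut_F[OF assms(1)] by simp
    with False show ?thesis using place_outside[OF assms(3)] by simp
  qed (use assms(2) in simp)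
qed

lemma coordinate_trivial:
  assumes "coordinate x P" "\<sigma> \<in> Aut" "\<sigma> x = x" "z \<in> F"
  shows "\<sigma> z = z"
  using aut_agree_adjoin[OF assms(2) aut_id, of "{x}" z] assms(3,4) coordinate_adjoin[OF assms(1)]
  by simp

text \<open>If \<open>P\<close> is fixed, then \<open>\<sigma> x\<close> again has its only pole, a simple one, at \<open>P\<close>.\<close>

lemma fixed_pole_affine:
  assumes x: "coordinate x P" and \<sigma>: "\<sigma> \<in> Aut" and fix_P: "P \<circ> \<sigma> = P"
  shows "\<exists>a b. a \<noteq> 0 \<and> \<sigma> x = c a * x + c b"
proof -
  note xD = coordinateD[OF x]
  have F: "\<sigma> x \<in> F" using aut_F[OF \<sigma>] xD by simp
  have "ord_ge v 0 (\<sigma> x)" if v: "v \<in> places c F" "v \<noteq> P" for v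
  proof -
    have "v \<circ> \<sigma> \<noteq> P" using comp_aut_cancel[OF \<sigma>, of v P] fix_P v by auto
    then have "ord_ge (v \<circ> \<sigma>) 0 x" using xD(5) place_comp[OF v(1) \<sigma>] by blast
    then show ?thesis by (simp add: ord_ge_comp[OF \<sigma>])
  qed
  moreover have "ord_ge P (- int 1) (\<sigma> x)"
    using fun_cong[OF fix_P, of x] xD by (simp add: ord_ge_def)
  ultimately obtain p where p: "degree p \<le> 1" "\<sigma> x = poly_at c p x"
    using one_pole_imp_polynomial[OF x F, of 1] by blast
  then obtain b a where "p = [:b, a:]"
    by (metis One_nat_def degree_pCons_eq_if le_zero_eq Suc_le_mono degree_eq_zeroE pCons_0_0 pCons_cases)
  then have eq: "\<sigma> x = c a * x + c b" using p(2) by (simp add: add.commute mult.commute)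
  moreover have "a \<noteq> 0"
    using eq aut_eq_const_iff[OF \<sigma>, of x b] xD(6) by auto
  ultimately show ?thesis by blast
qed

text \<open>The only pole of \<open>\<sigma> x\<close> is the place that \<open>\<sigma>\<close> maps to \<open>P\<close>.  If \<open>x\<close> has the value \<open>e\<close> there, the
  factor \<open>x - e\<close> cancels this pole and adds a simple pole at \<open>P\<close>.\<close>

lemma moved_pole_moebius:
  assumes x: "coordinate x P" and \<sigma>: "\<sigma> \<in> Aut" and moved: "P \<circ> \<sigma> \<noteq> P"
  shows "\<exists>a b e. (x - c e) * \<sigma> x = c a * x + c b"
proof -
  note xD = coordinateD[OF x]
  obtain \<tau> where \<tau>: "\<tau> \<in> Aut" "\<tau> \<circ> \<sigma> = id" using aut_inverse_exists[OF \<sigma>] by blast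
  define Q where "Q = P \<circ> \<tau>"
  have Q: "Q \<in> places c F" unfolding Q_def using place_comp xD \<tau> by blast
  have Q\<sigma>: "Q \<circ> \<sigma> = P" using \<tau> by (simp add: Q_def comp_assoc)
  have QP: "Q \<noteq> P" using moved Q\<sigma> by auto
  obtain e where e: "ord_ge Q 1 (x - c e)" using coordinate_value[OF x Q QP] by blast
  have F: "\<sigma> x \<in> F" using aut_F[OF \<sigma>] xD by simp
  have nonneg: "ord_ge v 0 (\<sigma> x)" if v: "v \<in> places c F" "v \<noteq> Q" for v
  proof -
    have "v \<circ> \<sigma> \<noteq> P" using comp_aut_cancel[OF \<sigma>, of v Q] Q\<sigma> v by auto
    then have "ord_ge (v \<circ> \<sigma>) 0 x" using xD(5) place_comp[OF v(1) \<sigma>] by blast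
    then show ?thesis by (simp add: ord_ge_comp[OF \<sigma>])
  qed
  have prod: "(x - c e) * \<sigma> x \<in> F" using xD F by simp
  have "ord_ge v 0 ((x - c e) * \<sigma> x)" if v: "v \<in> places c F" "v \<noteq> P" for v
  proof (cases "v = Q")
    case True
    have "ord_ge Q (- 1) (\<sigma> x)" using fun_cong[OF Q\<sigma>, of x] xD by (simp add: ord_ge_def)
    then show ?thesis using ord_ge_mult[OF Q _ F e, of "- 1"] xD True by simp
  next
    case False
    have "ord_ge v 0 (x - c e)" using v xD by (intro ord_ge_diff ord_ge_const) auto
    then show ?thesis using ord_ge_mult[OF v(1) _ F _ nonneg[OF v(1) False], of "x - c e" 0] xD by simp
  qed
  moreover have "ord_ge P (- int 1) ((x - c e) * \<sigma> x)"
  proof -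
    have "ord_ge P (- 1) (x - c e)" using pole_shift[OF x] by (simp add: ord_ge_def)
    then show ?thesis using ord_ge_mult[OF xD(1) _ F _ nonneg[OF xD(1)], of "x - c e" "- 1"] xD QP by simp
  qed
  ultimately obtain p where p: "degree p \<le> 1" "(x - c e) * \<sigma> x = poly_at c p x"
    using one_pole_imp_polynomial[OF x prod, of 1] by blast
  then obtain b a where "p = [:b, a:]"
    by (metis One_nat_def degree_pCons_eq_if le_zero_eq Suc_le_mono degree_eq_zeroE pCons_0_0 pCons_cases)
  then have "(x - c e) * \<sigma> x = c a * x + c b" using p(2) by (simp add: add.commute mult.commute)
  then show ?thesis by blast
qed

text \<open>A Moebius transformation that moves infinity fixes the roots of a quadratic polynomial.\<close>

lemma fixed_place_exists:
  assumes \<sigma>: "\<sigma> \<in> Aut"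
  shows "\<exists>v\<in>places c F. v \<circ> \<sigma> = v"
proof -
  obtain P x where x: "coordinate x P" using places_nonempty coordinate_exists by blast
  note xD = coordinateD[OF x]
  show ?thesis
  proof (cases "P \<circ> \<sigma> = P")
    case False
    obtain a b e where eq: "(x - c e) * \<sigma> x = c a * x + c b"
      using moved_pole_moebius[OF x \<sigma> False] by blast
    have "\<not> constant (poly [:- b, - (e + a), 1:])" by (simp add: constant_degree)
    then obtain r where "poly [:- b, - (e + a), 1:] r = 0"
      using fundamental_theorem_of_algebra by blast
    then have r: "b = r * r - (e + a) * r" by (simp add: algebra_simps)
    have "(x - c e) * (\<sigma> x - c r) = c a * x + c b - (x - c e) * c r"
      by (simp only: right_diff_distrib eq)
    also have "\<dots> = c (a - r) * (x - c r)"
      by (simp add: r c_diff c_mult c_add algebra_simps)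
    finally have key: "(x - c e) * (\<sigma> x - c r) = c (a - r) * (x - c r)" .
    have ne: "x - c e \<noteq> 0" "x - c r \<noteq> 0" by (rule coordinate_ne_const[OF x])+
    have s_ne: "\<sigma> x \<noteq> c d" for d using aut_eq_const_iff[OF \<sigma>] xD(6) by auto
    have ar: "a \<noteq> r" using key ne s_ne[of r] by auto
    have re: "r \<noteq> e"
    proof
      assume "r = e"
      then have "(x - c e) * (\<sigma> x - c e) = (x - c e) * c (a - e)" using key by (simp add: mult.commute)
      then have "\<sigma> x - c e = c (a - e)" using ne by simp
      then show False using s_ne[of a] by (simp add: c_diff)
    qed
    obtain v where v: "v \<in> places c F" "ord_ge v 1 (x - c r)" using place_exists[OF x] by blast
    have "ord_ge v 0 (x - c e)"
      by (rule ord_ge_diff[OF v(1)])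
        (use xD value_imp_no_pole[OF v(1) xD(2) v(2)] ord_ge_const[OF v(1)] in auto)
    moreover have "\<not> ord_ge v 1 (x - c e)" using value_unique[OF v(1) xD(2) v(2)] re by blast
    ultimately have v0: "v (x - c e) = 0" by (auto simp: ord_ge_def)
    have "v ((x - c e) * (\<sigma> x - c r)) = v (\<sigma> x - c r)"
      using place_mult[OF v(1), of "x - c e" "\<sigma> x - c r"] v0 ne s_ne[of r] xD aut_F[OF \<sigma>] by simp
    moreover have "v (c (a - r) * (x - c r)) = v (x - c r)"
      using place_const_mult[OF v(1)] xD ne ar by simp
    ultimately have "v (\<sigma> x - c r) = v (x - c r)" using key by simp
    then have "ord_ge v 1 (\<sigma> (x - c r))"
      using v(2) ne \<sigma> by (simp add: ord_ge_def aut_diff aut_const)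
    then have "ord_ge (v \<circ> \<sigma>) 1 (x - c r)" by (simp add: ord_ge_comp[OF \<sigma>])
    then have "v \<circ> \<sigma> = v" using place_unique[OF x place_comp[OF v(1) \<sigma>] _ v] by blast
    with v(1) show ?thesis by blast
  qed (use xD in blast)
qed

lemma fixed_value_iff:
  assumes x: "coordinate x P" and Q: "Q \<in> places c F" "ord_ge Q 1 (x - c e)"
    and \<sigma>: "\<sigma> \<in> Aut" "\<sigma> x = c a * x + c b"
  shows "Q \<circ> \<sigma> = Q \<longleftrightarrow> a * e + b = e"
proof -
  note xD = coordinateD[OF x]
  have "Q \<circ> \<sigma> = Q \<longleftrightarrow> ord_ge (Q \<circ> \<sigma>) 1 (x - c e)"
    using place_unique[OF x place_comp[OF Q(1) \<sigma>(1)] _ Q] Q(2) by auto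
  also have "\<dots> \<longleftrightarrow> ord_ge Q 1 (poly_at c [:b - e, a:] x)"
    using \<sigma> by (simp add: ord_ge_comp aut_diff aut_const c_diff algebra_simps)
  also have "\<dots> \<longleftrightarrow> a * e + b = e"
    by (subst ord_ge_poly_at_iff[OF Q(1) xD(2) Q(2)]) (auto simp: algebra_simps)
  finally show ?thesis .
qed

lemma three_fixed_places_imp_trivial:
  assumes \<sigma>: "\<sigma> \<in> Aut" and places: "P \<in> places c F" "Q \<in> places c F" "R \<in> places c F"
    and distinct: "P \<noteq> Q" "P \<noteq> R" "Q \<noteq> R"
    and fixed: "P \<circ> \<sigma> = P" "Q \<circ> \<sigma> = Q" "R \<circ> \<sigma> = R"
    and z: "z \<in> F"
  shows "\<sigma> z = z"
proof -
  obtain x where x: "coordinate x P" using coordinate_exists places by blast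
  obtain a b where ab: "\<sigma> x = c a * x + c b" using fixed_pole_affine[OF x \<sigma> fixed(1)] by blast
  obtain e where e: "ord_ge Q 1 (x - c e)" using coordinate_value[OF x] places distinct by metis
  obtain d where d: "ord_ge R 1 (x - c d)" using coordinate_value[OF x] places distinct by metis
  have ed: "e \<noteq> d" using place_unique[OF x places(2) e places(3)] d distinct by blast
  have ab_fix: "a * e + b = e" "a * d + b = d"
    using fixed_value_iff[OF x _ _ \<sigma> ab] places e d fixed by blast+
  have "(a - 1) * (e - d) = (a * e + b - e) - (a * d + b - d)" by (simp add: algebra_simps)
  then have "a = 1" using ab_fix ed by simp
  then have "b = 0" using ab_fix(1) by simp
  then have "\<sigma> x = x" using ab \<open>a = 1\<close> by simp
  then show ?thesis using coordinate_trivial[OF x \<sigma> _ z] by blast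
qed

lemma no_translation:
  assumes fin: "finite Aut" and \<sigma>: "\<sigma> \<in> Aut" "\<sigma> w = w + c e"
  shows "e = 0"
proof (rule ccontr)
  assume e: "e \<noteq> 0"
  have pow: "(\<sigma> ^^ i) w = w + c (of_nat i * e)" for i
    by (induction i) (use \<sigma> in \<open>simp_all add: aut_add aut_const c_add distrib_right\<close>)
  have "inj (\<lambda>i. \<sigma> ^^ i)"
  proof (rule injI)
    fix i j assume "\<sigma> ^^ i = \<sigma> ^^ j"
    then have "(\<sigma> ^^ i) w = (\<sigma> ^^ j) w" by simp
    then show "i = j" unfolding pow using e by simp
  qed
  moreover have "range (\<lambda>i. \<sigma> ^^ i) \<subseteq> Aut" using aut_funpow[OF \<sigma>(1)] by blast
  ultimately show False using fin by (metis finite_imageD finite_subset infinite_UNIV_nat)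
qed

text \<open>If \<open>g\<close> and \<open>k\<close> are affine and \<open>k\<close> moves the finite fixed point of \<open>g\<close>, then their commutator
  is a nontrivial translation, which has infinite order.\<close>

lemma common_fixed_places:
  assumes fin: "finite Aut" and g: "g \<in> Aut" and k: "k \<in> Aut"
    and P: "P \<in> places c F" and Q: "Q \<in> places c F" "P \<noteq> Q"
    and nontrivial: "\<exists>z\<in>F. g z \<noteq> z"
    and fixed: "P \<circ> g = P" "Q \<circ> g = Q" "P \<circ> k = P"
  shows "Q \<circ> k = Q"
proof -
  obtain x where x: "coordinate x P" using coordinate_exists P by blast
  obtain a b where ab: "a \<noteq> 0" "g x = c a * x + c b" using fixed_pole_affine[OF x g fixed(1)] by blast
  obtain d f where df: "d \<noteq> 0" "k x = c d * x + c f" using fixed_pole_affine[OF x k fixed(3)] by blast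
  obtain e where e: "ord_ge Q 1 (x - c e)" using coordinate_value[OF x] Q by metis
  have b: "b = e - a * e" using fixed_value_iff[OF x Q(1) e g ab(2)] fixed(2) by (simp add: eq_diff_eq add.commute)
  have "a \<noteq> 1"
  proof
    assume "a = 1"
    then have "g x = x" using ab(2) b by simp
    then show False using coordinate_trivial[OF x g] nontrivial by blast
  qed
  obtain \<tau> where \<tau>: "\<tau> \<in> Aut" "\<tau> \<circ> (k \<circ> g) = id" using aut_inverse_exists[OF aut_comp[OF k g]] by blast
  have "\<tau> (k (g x)) = x" using fun_cong[OF \<tau>(2), of x] by simp
  moreover have gk: "g (k x) = k (g x) + c ((1 - a) * (d * e + f - e))"
  proof -
    have "g (k x) = c d * g x + c f" using g df(2) by (simp add: aut_add aut_mult aut_const)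
    then have 1: "g (k x) = c (a * d) * x + c (d * b + f)"
      by (simp add: ab(2) c_add c_mult distrib_left mult_ac)
    have "k (g x) = c a * k x + c b" using k ab(2) by (simp add: aut_add aut_mult aut_const)
    then have 2: "k (g x) = c (a * d) * x + c (a * f + b)"
      by (simp add: df(2) c_add c_mult distrib_left mult_ac)
    have "d * b + f = (a * f + b) + (1 - a) * (d * e + f - e)"
      unfolding b by (simp add: algebra_simps)
    then show ?thesis unfolding 1 2 by (simp only: c_add add.assoc)
  qed
  ultimately have "((g \<circ> k) \<circ> \<tau>) (k (g x)) = k (g x) + c ((1 - a) * (d * e + f - e))" by simp
  then have "(1 - a) * (d * e + f - e) = 0"
    by (rule no_translation[OF fin aut_comp[OF aut_comp[OF g k] \<tau>(1)]])
  then have "d * e + f = e" using \<open>a \<noteq> 1\<close> by simp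
  then show ?thesis using fixed_value_iff[OF x Q(1) e k df(2)] by blast
qed

text \<open>Zeros and poles cancel in the product of \<open>k x\<close> and \<open>x\<close>.\<close>

lemma swap_inversion:
  assumes x: "coordinate x P" and Q: "Q \<in> places c F" "ord_ge Q 1 x"
    and k: "k \<in> Aut" "P \<circ> k = Q" "Q \<circ> k = P"
  shows "\<exists>a. a \<noteq> 0 \<and> k x = c a / x"
proof -
  note xD = coordinateD[OF x]
  have F: "k x \<in> F" using aut_F[OF k(1)] xD by simp
  have "ord_ge v 0 (k x * x)" if v: "v \<in> places c F" for v
  proof -
    consider "v = P" | "v = Q" | "v \<noteq> P" "v \<noteq> Q" by blast
    then show ?thesis
    proof cases
      case 1
      have "ord_ge P 1 (k x)" using ord_ge_comp[OF k(1), of P 1 x] k Q by simp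
      moreover have "ord_ge P (- 1) x" using xD by (simp add: ord_ge_def)
      ultimately show ?thesis using ord_ge_mult[OF v F xD(2), of 1 "- 1"] 1 by simp
    next
      case 2
      have "ord_ge P (- 1) x" using xD by (simp add: ord_ge_def)
      then have "ord_ge Q (- 1) (k x)" using ord_ge_comp[OF k(1), of Q "- 1" x] k by simp
      then show ?thesis using ord_ge_mult[OF v F xD(2), of "- 1" 1] 2 Q by simp
    next
      case 3
      have "v \<circ> k \<noteq> P" using comp_aut_cancel[OF k(1), of v Q] k(3) 3 by auto
      then have "ord_ge v 0 (k x)"
        using xD(5)[OF place_comp[OF v k(1)]] ord_ge_comp[OF k(1)] by blast
      then show ?thesis using ord_ge_mult[OF v F xD(2), of 0 0] xD(5)[OF v 3(1)] by simp
    qed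
  qed
  then obtain a where a: "k x * x = c a" using no_poles_imp_constant[of "k x * x"] F xD by auto
  then have "k x = c a / x" using xD(3) by (simp add: field_simps)
  moreover have "a \<noteq> 0" using a xD(3) aut_eq_0_iff[OF k(1), of x] by auto
  ultimately show ?thesis by blast
qed

lemma swap_imp_square_trivial:
  assumes P: "P \<in> places c F" and Q: "Q \<in> places c F" "P \<noteq> Q"
    and k: "k \<in> Aut" "P \<circ> k = Q" "Q \<circ> k = P" and z: "z \<in> F"
  shows "k (k z) = z"
proof -
  obtain x where x: "coordinate x P" "ord_ge Q 1 x" using coordinate_with_zero[OF P Q] by blast
  obtain a where a: "a \<noteq> 0" "k x = c a / x" using swap_inversion[OF x(1) Q(1) x(2) k] by blast
  have "k (k x) = x" using k(1) a coordinateD(3)[OF x(1)] by (simp add: aut_divide aut_const)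
  then show ?thesis using coordinate_trivial[OF x(1) aut_comp[OF k(1) k(1)] _ z] by simp
qed

end

section \<open>The branch places\<close>

context superelliptic
begin

lemma kummer_quotient:
  assumes "kummer y" "kummer y'"
  shows "\<exists>s\<in>F. s \<noteq> 0 \<and> y' = s * y"
proof -
  have "y' / y \<in> F"
    using assms h_aut by (simp add: F_iff aut_divide h_kummer)
  then show ?thesis
    using assms kummer_ne_0 by (intro bexI[of _ "y' / y"]) auto
qed

text \<open>The places where the multiplicity of \<open>y\<^sup>n\<close> is not divisible by \<open>n\<close>.  The condition is the same
  for all Kummer generators \<open>y\<close>, since they differ by factors from \<open>F\<close>.\<close>

definition branch :: "('k \<Rightarrow> int) set" where
  "branch = {v \<in> places c F. \<exists>y. kummer y \<and> \<not> int n dvd v (y ^ n)}"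

lemma place_kummer_mult:
  assumes "kummer y" "s \<in> F" "s \<noteq> 0" "v \<in> places c F"
  shows "v ((s * y) ^ n) = int n * v s + v (y ^ n)"
  using assms kummer_power[OF assms(1)] kummer_ne_0[OF assms(1)]
  by (simp add: power_mult_distrib place_mult place_power)

lemma branch_iff:
  assumes y: "kummer y" and v: "v \<in> places c F"
  shows "v \<in> branch \<longleftrightarrow> \<not> int n dvd v (y ^ n)"
proof -
  have "int n dvd v (y' ^ n) \<longleftrightarrow> int n dvd v (y ^ n)" if y': "kummer y'" for y'
  proof -
    obtain s where "s \<in> F" "s \<noteq> 0" "y' = s * y" using kummer_quotient[OF y y'] by blast
    then have "v (y' ^ n) = int n * v s + v (y ^ n)" using place_kummer_mult[OF y _ _ v] by simp
    then show ?thesis by (simp add: dvd_add_right_iff)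
  qed
  then show ?thesis unfolding branch_def mem_Collect_eq using y v by metis
qed

lemma place_aut_kummer:
  assumes y: "kummer y" and \<sigma>: "\<sigma> \<in> Aut" and v: "v \<in> places c F"
  shows "(v \<circ> \<sigma>) (y ^ n) = int n * v (\<sigma> y / y) + v (y ^ n)"
proof -
  have "\<sigma> y / y \<noteq> 0" using kummer_ne_0[OF y] aut_eq_0_iff[OF \<sigma>] by simp
  then have "v ((\<sigma> y / y * y) ^ n) = int n * v (\<sigma> y / y) + v (y ^ n)"
    by (rule place_kummer_mult[OF y aut_kummer[OF y \<sigma>] _ v])
  then show ?thesis using kummer_ne_0[OF y] \<sigma> by (simp add: aut_power)
qed

lemma branch_comp:
  assumes \<sigma>: "\<sigma> \<in> Aut" and v: "v \<in> places c F"
  shows "v \<circ> \<sigma> \<in> branch \<longleftrightarrow> v \<in> branch"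
proof -
  obtain y where y: "kummer y" using kummer_exists by blast
  show ?thesis
    using branch_iff[OF y v] branch_iff[OF y place_comp[OF v \<sigma>]] place_aut_kummer[OF y \<sigma> v]
    by (simp add: dvd_add_right_iff)
qed

text \<open>Among the polynomial equations \<open>y\<^sup>n = f(x)\<close>, one of minimal degree has no root of
  multiplicity \<open>n\<close> or more, since \<open>(x - a)\<^sup>n\<close> could be absorbed into \<open>y\<close>.\<close>

lemma reduced_equation:
  assumes x: "coordinate x P"
  shows "\<exists>y f. kummer y \<and> f \<noteq> 0 \<and> y ^ n = poly_at c f x \<and> (\<forall>a. order a f < n)"
proof -
  note xD = coordinateD[OF x]
  define E where "E d \<longleftrightarrow> (\<exists>y f. kummer y \<and> f \<noteq> 0 \<and> y ^ n = poly_at c f x \<and> degree f = d)" for d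
  have "\<exists>d. E d"
  proof -
    obtain y where y: "kummer y" using kummer_exists by blast
    obtain p q where pq: "q \<noteq> 0" "y ^ n = poly_at c p x / poly_at c q x"
      using coordinate_quotient[OF x kummer_power[OF y]] by blast
    have q: "poly_at c q x \<noteq> 0" using pq(1) poly_at_eq_0_iff[OF xD(6)] by simp
    have "p \<noteq> 0" using pq(2) kummer_ne_0[OF y] by auto
    have "(poly_at c q x * y) ^ n = poly_at c (p * q ^ (n - 1)) x"
      using pq(2) q n_ge_2
      by (cases n) (simp_all add: power_mult_distrib poly_at_mult poly_at_power)
    moreover have "kummer (poly_at c q x * y)" using y q xD by (intro kummer_mult) auto
    moreover have "p * q ^ (n - 1) \<noteq> 0" using \<open>p \<noteq> 0\<close> pq(1) by simp
    ultimately show ?thesis unfolding E_def by blast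
  qed
  then have "E (LEAST d. E d)" by (rule LeastI_ex)
  then obtain y f where yf: "kummer y" "f \<noteq> 0" "y ^ n = poly_at c f x" "degree f = (LEAST d. E d)"
    unfolding E_def[of "LEAST d. E d"] by blast
  have "order a f < n" for a
  proof (rule ccontr)
    assume "\<not> order a f < n"
    then have "[:- a, 1:] ^ n dvd f" using yf(2) by (simp add: order_divides)
    then obtain g where g: "f = [:- a, 1:] ^ n * g" by (auto simp: dvd_def)
    have g0: "g \<noteq> 0" using g yf(2) by auto
    have ne: "x - c a \<noteq> 0" by (rule coordinate_ne_const[OF x])
    have "y ^ n = (x - c a) ^ n * poly_at c g x"
      unfolding yf(3) g by (simp only: poly_at_mult poly_at_power) (simp add: c_minus)
    then have "(inverse (x - c a) * y) ^ n = poly_at c g x"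
      using ne by (simp add: power_mult_distrib power_inverse)
    moreover have "kummer (inverse (x - c a) * y)"
      using ne xD yf(1) by (intro kummer_mult) auto
    ultimately have "E (degree g)" unfolding E_def using g0 by blast
    then have "degree f \<le> degree g" unfolding yf(4) by (rule Least_le)
    moreover have "degree f = n + degree g"
      unfolding g using g0 by (subst degree_mult_eq) (simp_all add: degree_power_eq)
    ultimately show False using n_ge_2 by simp
  qed
  with yf show ?thesis by blast
qed

lemma branch_finite_place_iff:
  assumes x: "coordinate x P" and v: "v \<in> places c F" "ord_ge v 1 (x - c a)"
    and y: "kummer y" "y ^ n = poly_at c f x" and f: "f \<noteq> 0" "\<And>a. order a f < n"
  shows "v \<in> branch \<longleftrightarrow> poly f a = 0"
proof -
  have "v (y ^ n) = int (order a f)" using place_poly_at[OF x v f(1)] y(2) by simp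
  then have "v \<in> branch \<longleftrightarrow> \<not> n dvd order a f" using branch_iff[OF y(1) v(1)] by simp
  also have "\<dots> \<longleftrightarrow> order a f \<noteq> 0" using f(2)[of a] by (cases "order a f = 0") (auto dest: dvd_imp_le)
  also have "\<dots> \<longleftrightarrow> poly f a = 0" using f(1) order_root[of f a] by simp
  finally show ?thesis .
qed

lemma finite_branch: "finite branch"
proof -
  obtain P x where x: "coordinate x P" using places_nonempty coordinate_exists by blast
  obtain y f where yf: "kummer y" "f \<noteq> 0" "y ^ n = poly_at c f x" "\<And>a. order a f < n"
    using reduced_equation[OF x] by blast
  obtain pl where pl: "\<And>a. pl a \<in> places c F" "\<And>a. ord_ge (pl a) 1 (x - c a)"
    using place_exists[OF x] by metis
  have "branch \<subseteq> insert P (pl ` {a. poly f a = 0})"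
  proof
    fix v assume v: "v \<in> branch"
    then have vp: "v \<in> places c F" by (simp add: branch_def)
    show "v \<in> insert P (pl ` {a. poly f a = 0})"
    proof (cases "v = P")
      case False
      then obtain a where a: "ord_ge v 1 (x - c a)" using coordinate_value[OF x vp] by blast
      then have "poly f a = 0" using branch_finite_place_iff[OF x vp a yf(1,3,2,4)] v by simp
      moreover have "v = pl a" using place_unique[OF x vp a] pl by blast
      ultimately show ?thesis by blast
    qed simp
  qed
  then show ?thesis using poly_roots_finite[OF yf(2)] by (meson finite_imageI finite_insert finite_subset)
qed

text \<open>With at most two branch places the equation would be \<open>y\<^sup>n = x\<^sup>k\<close>, where \<open>k\<close> is prime to
  \<open>n\<close> because \<open>y\<close> has degree \<open>n\<close> over \<open>F\<close>; so the curve would be a line with coordinate \<open>w\<close>,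
  \<open>w\<^sup>n = x\<close>, on which \<open>h\<close> acts by scaling.\<close>

lemma no_monomial_equation:
  assumes x: "coordinate x P" and y: "kummer y" "y ^ n = x ^ k"
  shows False
proof -
  note xD = coordinateD[OF x]
  define d where "d = gcd k n"
  have d: "d > 0" using n_ge_2 by (simp add: d_def)
  obtain k' n' where kn: "k = d * k'" "n = d * n'"
    unfolding d_def by (meson gcd_dvd1 gcd_dvd2 dvdE)
  have n': "n' > 0" "n' \<le> n" using kn(2) n_ge_2 d by (auto intro: Nat.gr0I)
  have "(y ^ n' / x ^ k') ^ d = y ^ n / x ^ k"
    by (simp add: kn power_divide mult.commute[of d] flip: power_mult)
  also have "\<dots> = c 1" using y xD(3) by simp
  finally have "y ^ n' / x ^ k' \<in> range c"
    using power_constant_imp_constant[of "y ^ n' / x ^ k'" d] d by blast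
  then obtain a where "y ^ n' / x ^ k' = c a" by blast
  then have yn': "y ^ n' = c a * x ^ k'" using xD(3) by (simp add: field_simps)
  then have "h (y ^ n') = y ^ n'" using xD by (simp flip: F_iff)
  then have "c (\<zeta> ^ n') * y ^ n' = y ^ n'"
    using h_aut by (simp add: aut_power h_kummer[OF y(1)] power_mult_distrib c_power)
  then have "c (\<zeta> ^ n') = c 1" using kummer_ne_0[OF y(1)] by simp
  then have "\<zeta> ^ n' = 1" by (simp only: c_eq_iff)
  then have "n' = n" using zeta_primitive[of n'] n' by (meson le_neq_implies_less)
  then have "d = 1" using kn(2) n'(1) by simp
  have "k \<noteq> 0"
  proof
    assume "k = 0"
    then have "d = n" by (simp add: d_def)
    with \<open>d = 1\<close> n_ge_2 show False by simp
  qed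
  then obtain j l where jl: "k * j = n * l + 1"
    using bezout_nat[of k n] \<open>d = 1\<close> unfolding d_def by metis
  \<comment> \<open>An \<open>n\<close>-th root of \<open>x\<close>, by the Bezout relation.\<close>
  define w where "w = y ^ j / x ^ l"
  have "w ^ n = (y ^ n) ^ j / x ^ (n * l)"
    by (simp add: w_def power_divide mult.commute flip: power_mult)
  also have "\<dots> = x ^ (k * j) / x ^ (n * l)" by (simp add: y(2) flip: power_mult)
  also have "\<dots> = x" using xD(3) by (simp add: jl)
  finally have wn: "w ^ n = x" .
  have "h x = x" using xD(2) by (simp only: F_iff)
  then have hw: "h w = c (\<zeta> ^ j) * w"
    using h_aut by (simp add: w_def aut_divide aut_power h_kummer[OF y(1)] power_mult_distrib c_power)
  have w0: "w \<noteq> 0" using wn xD(3) n_ge_2 by (auto simp: power_0_left)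
  interpret W: subfield_over_C c "adjoin c {w}"
    by unfold_locales (rule intermediate_field_adjoin)
  have wW: "w \<in> adjoin c {w}" using subset_adjoin[of "{w}" c] by simp
  have "x \<in> adjoin c {w}" using W.F_power[OF wW, of n] wn by simp
  then have "F \<subseteq> adjoin c {w}"
    using adjoin_minimal[OF intermediate_field_adjoin[of c "{w}"], of "{x}"] coordinate_adjoin[OF x] by simp
  moreover have "y \<in> adjoin c {w}"
  proof -
    have "(y / w ^ k) ^ n = y ^ n / (w ^ n) ^ k"
      by (simp add: power_divide mult.commute flip: power_mult)
    also have "\<dots> = 1" using xD(3) by (simp add: wn y(2))
    finally obtain i where "y / w ^ k = c (\<zeta> ^ i)" using root_of_one_constant by blast
    then have "y = c (\<zeta> ^ i) * w ^ k" using w0 by (simp add: field_simps)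
    then show ?thesis using W.F_mult[OF W.F_const W.F_power[OF wW]] by simp
  qed
  ultimately have "adjoin c {w} = UNIV"
    using kummer_generates[OF y(1) intermediate_field_adjoin] by blast
  then show False using not_scaling_of_line[OF _ hw] by simp
qed

lemma complex_root_exists:
  assumes "m > 0"
  shows "\<exists>b::complex. b ^ m = a"
proof -
  have "degree (monom 1 m + [:- a:]) = m"
    using assms by (subst degree_add_eq_left) (simp_all add: degree_monom_eq)
  then have "\<not> constant (poly (monom 1 m + [:- a:]))"
    using assms by (simp add: constant_degree)
  then obtain b where "poly (monom 1 m + [:- a:]) b = 0"
    using fundamental_theorem_of_algebra by blast
  then show ?thesis by (intro exI[of _ b]) (simp add: poly_monom)
qed

text \<open>Two places containing all branch places can be taken as pole and zero of the coordinate; then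
  a reduced equation has no roots other than \<open>0\<close>.\<close>

lemma card_branch: "card branch \<ge> 3"
proof (rule ccontr)
  assume "\<not> ?thesis"
  then have card: "card branch \<le> 2" by simp
  have sub: "branch \<subseteq> places c F" by (auto simp: branch_def)
  have "infinite (places c F - branch)" using infinite_places finite_branch by simp
  then obtain T where T: "finite T" "card T = 2 - card branch" "T \<subseteq> places c F - branch"
    using infinite_arbitrarily_large by blast
  have "card (branch \<union> T) = 2"
    using T card finite_branch by (subst card_Un_disjoint) auto
  then obtain P Q where PQ: "branch \<union> T = {P, Q}" "P \<noteq> Q" by (auto simp: card_2_iff)
  then have places: "P \<in> places c F" "Q \<in> places c F" using sub T(3) by auto
  obtain x where x: "coordinate x P" "ord_ge Q 1 x"
    using coordinate_with_zero[OF places PQ(2)] by blast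
  obtain y f where yf: "kummer y" "f \<noteq> 0" "y ^ n = poly_at c f x" "\<And>a. order a f < n"
    using reduced_equation[OF x(1)] by blast
  have root: "a = 0" if "poly f a = 0" for a
  proof -
    obtain v where v: "v \<in> places c F" "ord_ge v 1 (x - c a)" using place_exists[OF x(1)] by blast
    then have "v \<in> branch" using branch_finite_place_iff[OF x(1) v yf(1,3,2,4)] that by simp
    moreover have "v \<noteq> P" using value_imp_ne_pole[OF x(1) v] .
    ultimately have "v = Q" using PQ(1) by blast
    then show ?thesis
      using value_unique[OF v(1) coordinateD(2)[OF x(1)] v(2), of 0] x(2) by simp
  qed
  obtain g where g: "f = [:- 0, 1:] ^ order 0 f * g" "\<not> [:- 0, 1:] dvd g"
    using order_decomp[OF yf(2), of 0] by blast
  have "degree g = 0"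
  proof (rule ccontr)
    assume "degree g \<noteq> 0"
    then obtain a where a: "poly g a = 0"
      using fundamental_theorem_of_algebra[of g] by (auto simp: constant_degree)
    then have "poly f a = 0" by (subst g(1)) simp
    then have "a = 0" by (rule root)
    with a g(2) show False by (simp add: poly_eq_0_iff_dvd)
  qed
  then obtain b where b: "g = [:b:]" by (metis degree_eq_zeroE)
  then have "b \<noteq> 0" using g(1) yf(2) by auto
  obtain r where r: "r ^ n = b" using complex_root_exists[of n b] n_ge_2 by auto
  then have r0: "r \<noteq> 0" using \<open>b \<noteq> 0\<close> n_ge_2 by auto
  define k where "k = order 0 f"
  have "poly_at c f x = x ^ k * c b"
    by (subst g(1)) (simp only: poly_at_mult poly_at_power b, simp add: k_def)
  then have "(c (inverse r) * y) ^ n = x ^ k"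
    using r r0 \<open>b \<noteq> 0\<close> by (simp add: power_mult_distrib yf(3) c_inverse power_inverse flip: c_power)
  moreover have "kummer (c (inverse r) * y)" using r0 by (intro kummer_mult yf(1)) auto
  ultimately show False using no_monomial_equation[OF x(1)] by blast
qed

text \<open>An automorphism is determined up to \<open>H\<close> by its action on the branch places, because a Moebius
  transformation fixing three points is the identity.\<close>

lemma finite_Aut: "finite Aut"
proof -
  obtain T where T: "T \<subseteq> branch" "card T = 3" 
    using card_branch by (metis obtain_subset_with_card_n)
  then obtain P Q R where PQR: "T = {P, Q, R}" "P \<noteq> Q" "P \<noteq> R" "Q \<noteq> R"
    by (auto simp: card_3_iff)
  have places: "P \<in> places c F" "Q \<in> places c F" "R \<in> places c F"
    using PQR(1) T(1) by (auto simp: branch_def)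
  define \<phi> where "\<phi> \<sigma> = restrict (\<lambda>v. v \<circ> \<sigma>) branch" for \<sigma> :: "'k \<Rightarrow> 'k"
  have "\<phi> ` Aut \<subseteq> branch \<rightarrow>\<^sub>E branch"
  proof -
    have "v \<circ> \<sigma> \<in> branch" if "\<sigma> \<in> Aut" "v \<in> branch" for \<sigma> v
    proof -
      have "v \<in> places c F" using that(2) by (simp add: branch_def)
      with that show ?thesis using branch_comp by blast
    qed
    then show ?thesis unfolding \<phi>_def by (auto simp del: o_apply)
  qed
  then have fin: "finite (\<phi> ` Aut)"
    using finite_PiE[OF finite_branch, of "\<lambda>_. branch"] finite_branch by (meson finite_subset)
  have fib: "finite {\<sigma> \<in> Aut. \<phi> \<sigma> = \<phi> \<sigma>'}" if \<sigma>': "\<sigma>' \<in> Aut" for \<sigma>'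
  proof -
    obtain \<tau> where \<tau>: "\<tau> \<in> Aut" "\<tau> \<circ> \<sigma>' = id" "\<sigma>' \<circ> \<tau> = id" using aut_inverse_exists[OF \<sigma>'] by blast
    have "\<sigma> \<in> (\<lambda>\<rho>. \<rho> \<circ> \<sigma>') ` H" if \<sigma>: "\<sigma> \<in> Aut" "\<phi> \<sigma> = \<phi> \<sigma>'" for \<sigma>
    proof -
      have "v \<circ> (\<sigma> \<circ> \<tau>) = v" if "v \<in> branch" for v
      proof -
        have "v \<circ> \<sigma> = v \<circ> \<sigma>'" using fun_cong[OF \<sigma>(2), of v] that by (simp add: \<phi>_def)
        then have "v \<circ> (\<sigma> \<circ> \<tau>) = v \<circ> (\<sigma>' \<circ> \<tau>)" by (simp only: o_assoc)
        then show ?thesis by (simp add: \<tau>)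
      qed
      then have "(\<sigma> \<circ> \<tau>) z = z" if "z \<in> F" for z
        using three_fixed_places_imp_trivial[OF aut_comp[OF \<sigma>(1) \<tau>(1)] places PQR(2-4) _ _ _ that]
          PQR(1) T(1) by auto
      then have "\<sigma> \<circ> \<tau> \<in> H" using trivial_on_F_imp_H[OF aut_comp[OF \<sigma>(1) \<tau>(1)]] by blast
      moreover have "\<sigma> = (\<sigma> \<circ> \<tau>) \<circ> \<sigma>'" by (simp add: comp_assoc \<tau>)
      ultimately show ?thesis by blast
    qed
    then have "{\<sigma> \<in> Aut. \<phi> \<sigma> = \<phi> \<sigma>'} \<subseteq> (\<lambda>\<rho>. \<rho> \<circ> \<sigma>') ` H" by blast
    moreover have "finite H" by (simp add: H_eq)
    ultimately show ?thesis by (meson finite_imageI finite_subset)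
  qed
  have "Aut \<subseteq> (\<Union>\<psi>\<in>\<phi> ` Aut. {\<sigma> \<in> Aut. \<phi> \<sigma> = \<psi>})" by blast
  moreover have "finite (\<Union>\<psi>\<in>\<phi> ` Aut. {\<sigma> \<in> Aut. \<phi> \<sigma> = \<psi>})" using fin fib by blast
  ultimately show ?thesis by (rule finite_subset)
qed

end

section \<open>Fixed places and exchanged places\<close>

text \<open>A finite multiplicative group of complex numbers consists of all roots of unity of some
  order.\<close>

lemma finite_unit_group_cyclic:
  fixes A :: "complex set"
  assumes fin: "finite A" and one: "1 \<in> A" and zero: "0 \<notin> A"
    and mult: "\<And>a b. a \<in> A \<Longrightarrow> b \<in> A \<Longrightarrow> a * b \<in> A"
  shows "\<exists>w\<in>A. \<forall>a\<in>A. \<exists>k::nat. a = w ^ k"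
proof -
  define m where "m = card A"
  have m: "m > 0" using fin one by (auto simp: m_def card_gt_0_iff)
  \<comment> \<open>Multiplication by \<open>a\<close> permutes \<open>A\<close>; compare the products of all elements.\<close>
  have "a ^ m = 1" if a: "a \<in> A" for a
  proof -
    have inj: "inj_on ((*) a) A" using a zero by (auto simp: inj_on_def)
    have "(*) a ` A = A"
      by (rule endo_inj_surj[OF fin _ inj]) (use a mult in auto)
    then have "\<Prod>A = (\<Prod>b\<in>A. a * b)" using prod.reindex[OF inj, of "\<lambda>b. b"] by simp
    also have "\<dots> = a ^ m * \<Prod>A" by (simp add: prod.distrib m_def)
    finally show ?thesis using fin zero by simp
  qed
  then have "A \<subseteq> {z. z ^ m = 1}" by blast
  moreover have "card {z::complex. z ^ m = 1} = m" using m by (rule card_roots_unity_eq)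
  ultimately have A: "A = {z. z ^ m = 1}"
    using m by (intro card_subset_eq) (auto simp: m_def intro: card_ge_0_finite)
  have bij: "bij_betw (\<lambda>k. cis (2 * pi * real k / real m)) {..<m} {z. z ^ m = 1}"
    using m by (rule bij_betw_roots_unity)
  define w where "w = cis (2 * pi / real m)"
  have w: "w ^ k = cis (2 * pi * real k / real m)" for k
    by (simp add: w_def DeMoivre mult_ac)
  have "w \<in> A" using m w[of m] by (simp add: A)
  moreover have "\<exists>k. a = w ^ k" if "a \<in> A" for a
    using that bij unfolding A bij_betw_def w by blast
  ultimately show ?thesis by blast
qed

lemma (in normal) cyclic_FactGroup:
  assumes g: "g \<in> carrier G" and "\<And>x. x \<in> carrier G \<Longrightarrow> \<exists>k::nat. x \<in> H #> g [^] k"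
  shows "cyclic_group (G Mod H)"
proof -
  interpret Q: group "G Mod H" by (rule factorgroup_is_group)
  interpret \<phi>: group_hom G "G Mod H" "\<lambda>x. H #> x"
    by unfold_locales (rule r_coset_hom_Mod)
  have pow: "(H #> g) [^]\<^bsub>G Mod H\<^esub> int k = H #> g [^] k" for k :: nat
    using \<phi>.hom_nat_pow[OF g, of k] by (simp add: int_pow_int)
  have "carrier (G Mod H) \<subseteq> range (\<lambda>k::int. (H #> g) [^]\<^bsub>G Mod H\<^esub> k)"
  proof
    fix X assume "X \<in> carrier (G Mod H)"
    then obtain x where x: "x \<in> carrier G" "X = H #> x" by (auto simp: FactGroup_def RCOSETS_def)
    then obtain k :: nat where "x \<in> H #> g [^] k" using assms(2) by blast
    then have "X = H #> g [^] k"
      using repr_independence[of x H "g [^] k"] x g subgroup_axioms by simp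
    then show "X \<in> range (\<lambda>k::int. (H #> g) [^]\<^bsub>G Mod H\<^esub> k)" using pow by blast
  qed
  moreover have "H #> g \<in> carrier (G Mod H)" using g by (rule \<phi>.hom_closed)
  ultimately show ?thesis unfolding Q.cyclic_group using Q.int_pow_closed by blast
qed

context superelliptic
begin

lemma H_normal: "H \<lhd> aut_group c"
proof -
  interpret G: group "aut_group c" by (rule group_aut_group)
  have "\<tau> \<circ> \<sigma> = \<sigma> \<circ> \<tau>" if "\<tau> \<in> H" "\<sigma> \<in> Aut" for \<tau> \<sigma>
    using central[OF that] by auto
  then show ?thesis
    by (intro G.normalI H_subgroup) (auto simp: r_coset_def l_coset_def aut_group_def)
qed

text \<open>Such automorphisms are affine, \<open>x \<mapsto> a x + b\<close>.  The multiplier \<open>a\<close> is a character with kernel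
  \<open>H\<close>, as nontrivial translations have infinite order.\<close>

lemma fixed_place_imp_cyclic:
  assumes P: "P \<in> places c F" and fixed: "\<And>\<sigma>. \<sigma> \<in> Aut \<Longrightarrow> P \<circ> \<sigma> = P"
  shows "cyclic_group (reduced_aut_group c H)"
proof -
  interpret N: normal H "aut_group c" by (rule H_normal)
  obtain x where x: "coordinate x P" using coordinate_exists P by blast
  note xD = coordinateD[OF x]
  have "\<forall>\<sigma>\<in>Aut. \<exists>a. a \<noteq> 0 \<and> (\<exists>b. \<sigma> x = c a * x + c b)"
    using fixed_pole_affine[OF x _ fixed] by blast
  then obtain \<chi> where \<chi>: "\<And>\<sigma>. \<sigma> \<in> Aut \<Longrightarrow> \<chi> \<sigma> \<noteq> 0" "\<And>\<sigma>. \<sigma> \<in> Aut \<Longrightarrow> \<exists>b. \<sigma> x = c (\<chi> \<sigma>) * x + c b"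
    by metis
  have \<chi>_eq: "\<chi> \<sigma> = a" if \<sigma>: "\<sigma> \<in> Aut" "\<sigma> x = c a * x + c b" for \<sigma> a b
  proof -
    obtain b' where "\<sigma> x = c (\<chi> \<sigma>) * x + c b'" using \<chi>(2)[OF \<sigma>(1)] by blast
    then have "poly_at c [:b', \<chi> \<sigma>:] x = poly_at c [:b, a:] x"
      using \<sigma>(2) by (simp add: add.commute mult.commute)
    then have "[:b', \<chi> \<sigma>:] = [:b, a:]" by (simp only: poly_at_eq_iff[OF xD(6)])
    then show ?thesis by simp
  qed
  have \<chi>_comp: "\<chi> (\<sigma> \<circ> \<tau>) = \<chi> \<sigma> * \<chi> \<tau>" if "\<sigma> \<in> Aut" "\<tau> \<in> Aut" for \<sigma> \<tau>
  proof -
    obtain b d where b: "\<sigma> x = c (\<chi> \<sigma>) * x + c b" and d: "\<tau> x = c (\<chi> \<tau>) * x + c d"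
      using \<chi>(2) \<open>\<sigma> \<in> Aut\<close> \<open>\<tau> \<in> Aut\<close> by metis
    have "(\<sigma> \<circ> \<tau>) x = c (\<chi> \<tau>) * \<sigma> x + c d"
      using that(1) d by (simp add: aut_add aut_mult aut_const)
    also have "\<dots> = c (\<chi> \<sigma> * \<chi> \<tau>) * x + c (\<chi> \<tau> * b + d)"
      by (simp add: b c_add c_mult distrib_left mult_ac add.assoc)
    finally show ?thesis by (rule \<chi>_eq[OF aut_comp[OF that]])
  qed
  have \<chi>_id: "\<chi> id = 1" by (rule \<chi>_eq[OF aut_id, of _ 0]) simp
  have kernel: "\<sigma> \<in> H" if \<sigma>: "\<sigma> \<in> Aut" "\<chi> \<sigma> = 1" for \<sigma>
  proof -
    obtain b where b: "\<sigma> x = x + c b" using \<chi>(2)[OF \<sigma>(1)] \<sigma>(2) by auto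
    then have "b = 0" by (rule no_translation[OF finite_Aut \<sigma>(1)])
    then have "\<sigma> x = x" using b by simp
    then show ?thesis using trivial_on_F_imp_H[OF \<sigma>(1)] coordinate_trivial[OF x \<sigma>(1)] by blast
  qed
  have "\<exists>w\<in>\<chi> ` Aut. \<forall>a\<in>\<chi> ` Aut. \<exists>k::nat. a = w ^ k"
  proof (rule finite_unit_group_cyclic)
    show "1 \<in> \<chi> ` Aut" using \<chi>_id aut_id by (metis imageI)
    show "0 \<notin> \<chi> ` Aut" using \<chi>(1) by force
    show "a * b \<in> \<chi> ` Aut" if "a \<in> \<chi> ` Aut" "b \<in> \<chi> ` Aut" for a b
      using that \<chi>_comp aut_comp by (metis (no_types) imageE imageI)
  qed (simp add: finite_Aut)
  then obtain g where g: "g \<in> Aut" "\<And>\<sigma>. \<sigma> \<in> Aut \<Longrightarrow> \<exists>k::nat. \<chi> \<sigma> = \<chi> g ^ k" by auto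
  have pow: "g [^]\<^bsub>aut_group c\<^esub> k = g ^^ k" for k :: nat
    by (induction k) (simp_all add: aut_group_def funpow_swap1 fun_eq_iff)
  have \<chi>_pow: "\<chi> (g ^^ k) = \<chi> g ^ k" for k
  proof (induction k)
    case (Suc k)
    then show ?case using \<chi>_comp[OF g(1) aut_funpow[OF g(1), of k]]
      by (simp only: funpow.simps power_Suc)
  qed (simp only: funpow.simps power_0 \<chi>_id)
  have "cyclic_group (aut_group c Mod H)"
  proof (rule N.cyclic_FactGroup[OF g(1)])
    fix \<sigma> assume \<sigma>: "\<sigma> \<in> Aut"
    obtain k where k: "\<chi> \<sigma> = \<chi> g ^ k" using g(2)[OF \<sigma>] by blast
    have gk: "g ^^ k \<in> Aut" by (rule aut_funpow[OF g(1)])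
    obtain \<tau> where \<tau>: "\<tau> \<in> Aut" "\<tau> \<circ> g ^^ k = id" "g ^^ k \<circ> \<tau> = id" using aut_inverse_exists[OF gk] by blast
    have "\<chi> \<tau> * \<chi> (g ^^ k) = 1" using \<chi>_comp[OF \<tau>(1) gk] \<tau>(2) \<chi>_id by metis
    then have "\<chi> (\<sigma> \<circ> \<tau>) = 1" using \<chi>_comp[OF \<sigma> \<tau>(1)] k \<chi>_pow[of k] by (metis mult.commute)
    then have "\<sigma> \<circ> \<tau> \<in> H" using kernel[OF aut_comp[OF \<sigma> \<tau>(1)]] by blast
    moreover have "\<sigma> = (\<sigma> \<circ> \<tau>) \<circ> g ^^ k" by (simp add: comp_assoc \<tau>)
    ultimately have "\<exists>\<rho>\<in>H. \<sigma> = \<rho> \<circ> g ^^ k" by blast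
    then have "\<sigma> \<in> H #>\<^bsub>aut_group c\<^esub> g [^]\<^bsub>aut_group c\<^esub> k"
      unfolding pow by (simp add: r_coset_def aut_group_def)
    then show "\<exists>k::nat. \<sigma> \<in> H #>\<^bsub>aut_group c\<^esub> g [^]\<^bsub>aut_group c\<^esub> k" by blast
  qed
  then show ?thesis by (simp add: reduced_aut_group_def)
qed

lemma fixed_place_or_swap:
  "(\<exists>P\<in>places c F. \<forall>\<sigma>\<in>Aut. P \<circ> \<sigma> = P) \<or>
    (\<exists>\<sigma>\<in>Aut. \<exists>P\<in>places c F. \<exists>Q\<in>places c F. P \<noteq> Q \<and> P \<circ> \<sigma> = Q \<and> Q \<circ> \<sigma> = P)"
proof -
  interpret G: group "aut_group c" by (rule group_aut_group)
  interpret A: finite_right_action "aut_group c" "places c F" "\<lambda>v \<sigma>. v \<circ> \<sigma>"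
  proof unfold_locales
    show "finite Aut" by (rule finite_Aut)
    show "v \<circ> \<sigma> \<in> places c F" if "v \<in> places c F" "\<sigma> \<in> Aut" for v \<sigma>
      using that by (rule place_comp)
  qed (simp_all add: aut_group_def o_assoc)
  have kernel_iff: "\<sigma> \<in> A.act_kernel \<longleftrightarrow> (\<forall>z\<in>F. \<sigma> z = z)" if \<sigma>: "\<sigma> \<in> Aut" for \<sigma>
  proof
    assume "\<forall>z\<in>F. \<sigma> z = z"
    then show "\<sigma> \<in> A.act_kernel"
      using trivial_on_F_imp_fixes[OF \<sigma>] \<sigma> unfolding A.act_kernel_def by blast
  next
    assume ker: "\<sigma> \<in> A.act_kernel"
    obtain T where T: "T \<subseteq> places c F" "card T = 3"
      using infinite_arbitrarily_large[OF infinite_places] by metis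
    then obtain P Q R where PQR: "T = {P, Q, R}" "P \<noteq> Q" "P \<noteq> R" "Q \<noteq> R"
      by (auto simp: card_3_iff)
    then have places: "P \<in> places c F" "Q \<in> places c F" "R \<in> places c F" using T(1) by auto
    have "v \<circ> \<sigma> = v" if "v \<in> places c F" for v
      using ker that unfolding A.act_kernel_def by blast
    then show "\<forall>z\<in>F. \<sigma> z = z"
      using three_fixed_places_imp_trivial[OF \<sigma> places PQR(2-4)] places by blast
  qed
  show ?thesis
  proof (rule A.fixed_point_or_swap[OF places_nonempty fixed_place_exists])
    fix g P Q R
    assume "g \<in> Aut" "P \<in> places c F" "Q \<in> places c F" "R \<in> places c F"
      "P \<noteq> Q" "P \<noteq> R" "Q \<noteq> R" "P \<circ> g = P" "Q \<circ> g = Q" "R \<circ> g = R"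
    then show "g \<in> A.act_kernel"
      using kernel_iff three_fixed_places_imp_trivial by blast
  next
    fix g k P Q
    assume *: "g \<in> Aut" "k \<in> Aut" "P \<in> places c F" "Q \<in> places c F" "P \<noteq> Q"
      "g \<notin> A.act_kernel" "P \<circ> g = P" "Q \<circ> g = Q" "P \<circ> k = P"
    then have "\<exists>z\<in>F. g z \<noteq> z" using kernel_iff by blast
    then show "Q \<circ> k = Q" by (rule common_fixed_places[OF finite_Aut *(1-5) _ *(7-9)])
  qed
qed

section \<open>Palindromic equations from an involution\<close>

lemma poly_at_reflect:
  assumes "x \<noteq> 0" "coeff p 0 \<noteq> 0"
  shows "poly_at c (reflect_poly p) x = x ^ degree p * poly_at c p (inverse x)"
proof -
  have "poly_at c (reflect_poly p) x = (\<Sum>i\<le>degree p. c (coeff p (degree p - i)) * x ^ i)"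
    unfolding poly_at_altdef using assms(2)
    by (intro sum.cong) (auto simp: coeff_reflect_poly degree_reflect_poly_eq)
  also have "\<dots> = (\<Sum>i\<le>degree p. c (coeff p i) * x ^ (degree p - i))"
    by (rule sum.reindex_bij_witness[of _ "\<lambda>i. degree p - i" "\<lambda>i. degree p - i"]) auto
  also have "\<dots> = (\<Sum>i\<le>degree p. x ^ degree p * (c (coeff p i) * inverse x ^ i))"
    using assms(1) by (intro sum.cong) (auto simp: power_diff power_inverse field_simps)
  also have "\<dots> = x ^ degree p * poly_at c p (inverse x)"
    by (simp add: poly_at_altdef sum_distrib_left)
  finally show ?thesis .
qed

text \<open>The quotient of the reversed polynomial by \<open>f\<close> is an \<open>n\<close>-th power \<open>w\<^sup>n\<close>, by invariance of the
  covering under the involution \<open>x \<mapsto> 1/x\<close>.  All multiplicities being less than \<open>n\<close>, the function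
  \<open>w\<close> has neither zeros nor poles, hence is constant.\<close>

lemma involution_imp_palindromic:
  assumes x: "coordinate x P" and Q: "Q \<in> places c F" "ord_ge Q 1 x"
    and k: "k \<in> Aut" "P \<circ> k = Q" "Q \<circ> k = P" "k x = inverse x"
    and unbranched: "P \<notin> branch" "Q \<notin> branch"
    and y: "kummer y" "y ^ n = poly_at c f x" and f: "f \<noteq> 0" "\<And>a. order a f < n"
  shows "palindromic f \<or> antipalindromic f"
proof -
  note xD = coordinateD[OF x]
  define N where "N = degree f"
  have f0: "poly f 0 \<noteq> 0"
    using branch_finite_place_iff[OF x Q(1) _ y f, of 0] Q(2) unbranched by simp
  then have c0: "coeff f 0 \<noteq> 0" by (simp add: poly_0_coeff_0)
  have Px: "P (y ^ n) = - int N" using pole_poly_at[OF x f(1)] y(2) by (simp add: N_def)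
  then have "n dvd N" using branch_iff[OF y(1) xD(1)] unbranched(1) by simp
  then obtain m where m: "N = n * m" by (auto simp: dvd_def)
  have Qx: "Q x = 1" by (rule place_at_0[OF x Q])
  have Qy: "Q (y ^ n) = 0"
    using place_poly_at[OF x Q(1) _ f(1), of 0] Q(2) y(2) f0 f(1) by (simp add: order_root)
  define s where "s = k y / y"
  have s: "s \<in> F" "s \<noteq> 0"
    using aut_kummer[OF y(1) k(1)] kummer_ne_0[OF y(1)] aut_eq_0_iff[OF k(1)] by (auto simp: s_def)
  define w where "w = x ^ m * s"
  have w: "w \<in> F" "w \<noteq> 0" using s xD by (auto simp: w_def)
  have "w ^ n * y ^ n = x ^ N * k (y ^ n)"
    using kummer_ne_0[OF y(1)] k(1)
    by (simp add: w_def s_def m aut_power power_mult_distrib power_divide mult.commute[of n] flip: power_mult)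
  also have "\<dots> = poly_at c (reflect_poly f) x"
    using poly_at_reflect[OF xD(3) c0] k by (simp add: y(2) aut_poly_at N_def)
  finally have wf: "w ^ n * poly_at c f x = poly_at c (reflect_poly f) x" by (simp add: y(2))
  have val: "int n * v w = int N * v x + (v \<circ> k) (y ^ n) - v (y ^ n)" if v: "v \<in> places c F" for v
  proof -
    have "v w = int m * v x + v s" using v s xD by (simp add: w_def place_mult place_power)
    then have "int n * v w = int N * v x + int n * v s" by (simp add: m distrib_left)
    then show ?thesis using place_aut_kummer[OF y(1) k(1) v] by (simp add: s_def)
  qed
  have small: "0 \<le> v (y ^ n) \<and> v (y ^ n) < int n" if v: "v \<in> places c F" "v \<noteq> P" for v
  proof -
    obtain a where a: "ord_ge v 1 (x - c a)" using coordinate_value[OF x v] by blast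
    show ?thesis using place_poly_at[OF x v(1) a f(1)] f(2)[of a] y(2) by simp
  qed
  have "v w = 0" if v: "v \<in> places c F" for v
  proof -
    have n0: "int n > 0" using n_ge_2 by simp
    consider "v = P" | "v = Q" | "v \<noteq> P" "v \<noteq> Q" by blast
    then show ?thesis
    proof cases
      case 1
      then have "int n * v w = 0" using val[OF xD(1)] xD(4) k(2) Px Qy by simp
      then show ?thesis using n0 by simp
    next
      case 2
      then have "int n * v w = 0" using val[OF Q(1)] k(3) Px Qx Qy by simp
      then show ?thesis using n0 by simp
    next
      case 3
      have "v x = 0"
      proof -
        have "\<not> ord_ge v 1 x" using place_unique[OF x v _ Q(1), of 0] Q(2) 3 by auto
        then show ?thesis using xD(5)[OF v 3(1)] by (auto simp: ord_ge_def)
      qed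
      have "v \<circ> k \<noteq> P" using comp_aut_cancel[OF k(1), of v Q] k(3) 3 by auto
      then have "\<bar>int n * v w\<bar> < int n"
        using val[OF v] small[OF v 3(1)] small[OF place_comp[OF v k(1)]] \<open>v x = 0\<close>
        by (simp add: abs_less_iff)
      then show ?thesis
        using n0 by (simp add: abs_mult mult_less_cancel_left2)
    qed
  qed
  then have "ord_ge v 0 w" if "v \<in> places c F" for v
    unfolding ord_ge_def using that by (metis order_refl)
  then have "w \<in> range c" by (rule no_poles_imp_constant[OF w(1)])
  then obtain b where b: "w = c b" by blast
  define l where "l = b ^ n"
  have "poly_at c (reflect_poly f) x = poly_at c (smult l f) x"
    using wf by (simp add: b l_def poly_at_smult c_power)
  then have refl: "reflect_poly f = smult l f" by (simp only: poly_at_eq_iff[OF xD(6)])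
  have "f = reflect_poly (reflect_poly f)" using c0 by simp
  also have "\<dots> = smult (l * l) f" by (simp add: refl reflect_poly_smult)
  finally have "smult (l * l) f = f" by simp
  then have "coeff (smult (l * l) f) 0 = coeff f 0" by simp
  then have "l * l = 1" using c0 by simp
  then have "l = 1 \<or> l = - 1" by (simp add: square_eq_1_iff)
  moreover have "coeff f (degree f - i) = l * coeff f i" if "i \<le> degree f" for i
  proof -
    have "coeff (reflect_poly f) i = coeff f (degree f - i)" using that by (simp add: coeff_reflect_poly)
    then show ?thesis by (simp add: refl)
  qed
  ultimately show ?thesis
    unfolding palindromic_def antipalindromic_def by auto
qed

text \<open>The pole and the zero of the coordinate are a pair of distinct unbranched places exchanged by the
  involution.  All but finitely many places belong to such a pair.\<close>

lemma swap_imp_palindromic_equation: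
  assumes places: "P \<in> places c F" "Q \<in> places c F" "P \<noteq> Q"
    and k: "k \<in> Aut" "P \<circ> k = Q" "Q \<circ> k = P"
  shows "\<exists>f. has_affine_equation c H n f \<and> (palindromic f \<or> antipalindromic f)"
proof -
  have square: "k (k z) = z" if "z \<in> F" for z
    by (rule swap_imp_square_trivial[OF places k that])
  have "finite {v \<in> places c F. v \<circ> k = v}"
  proof (rule ccontr)
    assume "infinite {v \<in> places c F. v \<circ> k = v}"
    then obtain T where T: "T \<subseteq> {v \<in> places c F. v \<circ> k = v}" "card T = 3"
      using infinite_arbitrarily_large[of "{v \<in> places c F. v \<circ> k = v}" 3] by blast
    then obtain A B C where "T = {A, B, C}" "A \<noteq> B" "A \<noteq> C" "B \<noteq> C" by (auto simp: card_3_iff)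
    with T(1) have "\<And>z. z \<in> F \<Longrightarrow> k z = z"
      by (intro three_fixed_places_imp_trivial[OF k(1), of A B C]) auto
    then have "P \<circ> k = P" by (rule trivial_on_F_imp_fixes[OF k(1) _ places(1)])
    then show False using k(2) places(3) by simp
  qed
  then have "infinite (places c F - (branch \<union> {v \<in> places c F. v \<circ> k = v}))"
    using infinite_places finite_branch by (intro Diff_infinite_finite) auto
  then obtain R where R: "R \<in> places c F" "R \<notin> branch" "R \<circ> k \<noteq> R"
    using infinite_imp_nonempty by blast
  define S where "S = R \<circ> k"
  have S: "S \<in> places c F" "S \<notin> branch" "R \<noteq> S"
    using place_comp[OF R(1) k(1)] branch_comp[OF k(1) R(1)] R by (auto simp: S_def)
  have Sk: "S \<circ> k = R"
    using trivial_on_F_imp_fixes[OF aut_comp[OF k(1) k(1)] _ R(1)] square by (simp add: S_def comp_assoc)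
  obtain x0 where x0: "coordinate x0 R" "ord_ge S 1 x0"
    using coordinate_with_zero[OF R(1) S(1,3)] by blast
  obtain a where a: "a \<noteq> 0" "k x0 = c a / x0"
    using swap_inversion[OF x0(1) S(1) x0(2) k(1)] Sk by (auto simp: S_def)
  \<comment> \<open>Rescaling by a square root turns \<open>x0 \<mapsto> a / x0\<close> into \<open>x \<mapsto> 1 / x\<close>.\<close>
  obtain r where r: "r ^ 2 = a" using complex_root_exists[of 2 a] by auto
  have r0: "r \<noteq> 0" using r a(1) by auto
  define x where "x = c (inverse r) * x0"
  have x: "coordinate x R" using coordinate_affine[OF x0(1), of "inverse r" 0] r0 by (simp add: x_def)
  have Sx: "ord_ge S 1 x"
    unfolding x_def using coordinateD(2)[OF x0(1)] x0(2) by (intro ord_ge_const_mult S(1)) auto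
  have kx: "k x = inverse x"
  proof -
    have "k x = c (inverse r) * (c (r ^ 2) / x0)"
      using k(1) by (simp add: x_def aut_mult aut_const a(2) r)
    also have "\<dots> = c (inverse r * r ^ 2) / x0" by (simp only: c_mult times_divide_eq_right)
    also have "inverse r * r ^ 2 = r" using r0 by (simp add: power2_eq_square)
    also have "c r / x0 = inverse x" using r0 by (simp add: x_def c_inverse divide_inverse)
    finally show ?thesis .
  qed
  obtain y f where yf: "kummer y" "f \<noteq> 0" "y ^ n = poly_at c f x" "\<And>a. order a f < n"
    using reduced_equation[OF x] by blast
  have "palindromic f \<or> antipalindromic f"
    by (rule involution_imp_palindromic[OF x S(1) Sx k(1) _ Sk kx R(2) S(2) yf(1,3,2,4)])
      (simp add: S_def)
  moreover have "has_affine_equation c H n f"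
  proof -
    have F: "F = adjoin c {x}" by (rule coordinate_adjoin[OF x])
    have "adjoin c {x} \<subseteq> adjoin c {x, y}"
      using adjoin_minimal[OF intermediate_field_adjoin] subset_adjoin[of "{x, y}" c] by blast
    moreover have "y \<in> adjoin c {x, y}" using subset_adjoin[of "{x, y}" c] by simp
    ultimately have "adjoin c {x, y} = UNIV"
      using kummer_generates[OF yf(1) intermediate_field_adjoin] F by simp
    with F yf(3) show ?thesis unfolding has_affine_equation_def by metis
  qed
  ultimately show ?thesis by blast
qed

end

lemma palindromic_imp_quasi_palindromic:
  assumes "palindromic f \<or> antipalindromic f"
  shows "quasi_palindromic f"
  using assms unfolding palindromic_def antipalindromic_def quasi_palindromic_def
  by (metis norm_minus_cancel)

theorem theorem3:
  fixes c :: "complex \<Rightarrow> 'k::field" and n :: nat and H :: "('k \<Rightarrow> 'k) set"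
  assumes "superelliptic_curve c n H"
    and "\<not> trivial_group (reduced_aut_group c H)"
    and "\<not> cyclic_group (reduced_aut_group c H)"
  shows "\<exists>f. (has_affine_equation c H n f \<or> has_affine_equation c H n ([:0, 1:] * f)) \<and>
             (palindromic f \<or> antipalindromic f) \<and>
             (reduced_aut_group c H \<cong> alt_group 5 \<longrightarrow> quasi_palindromic f)"
proof -
  have "subgroup H (aut_group c)" "cyclic_group (aut_group c \<lparr>carrier := H\<rparr>)" "card H = n" "n > 0"
    using assms(1) by (auto simp: superelliptic_curve_def)
  then obtain h where h: "h ^^ n = id" "H = (\<lambda>i. h ^^ i) ` {..<n}"
    using cyclic_subgroup_generator by blast
  interpret superelliptic c n H h
  proof unfold_locales
    show "complex_embedding c"
      using assms(1) by (simp add: superelliptic_curve_def function_field_of_curve_def)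
  qed (fact assms(1) h)+
  consider (fixed) P where "P \<in> places c F" "\<And>\<sigma>. \<sigma> \<in> Aut \<Longrightarrow> P \<circ> \<sigma> = P"
    | (swap) k P Q where "k \<in> Aut" "P \<in> places c F" "Q \<in> places c F" "P \<noteq> Q" "P \<circ> k = Q" "Q \<circ> k = P"
    using fixed_place_or_swap by blast
  then show ?thesis
  proof cases
    case fixed
    then show ?thesis using fixed_place_imp_cyclic assms(3) by blast
  next
    case swap
    then obtain f where "has_affine_equation c H n f" "palindromic f \<or> antipalindromic f"
      using swap_imp_palindromic_equation by metis
    then show ?thesis using palindromic_imp_quasi_palindromic by blast
  qed
qed

end
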